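(* Let $G$ be a finite group, $p$ a prime dividing $|G|$, and $S$ a Sylow $p$-subgroup of $G$. Let $K_{\mathscr{O}}$ be the subgroup of $N_G(S)$ generated by the elements $g\in N_G(S)$ such that there exist non-trivial subgroups $1<Q_0,\ldots,Q_r\le S$ and a factorization $g=x_1\cdots x_r$ in $G$, where $x_i\in O^{p'}(N_G(Q_i))$ for $1\le i\le r$ and $Q_0^{x_1\cdots x_i}\le Q_{i+1}$ for $0\le i<r$. Then the natural map induces an isomorphism $$N_G(S)/K_{\mathscr{O}}\xrightarrow{\ \cong\ }\pi_1(\mathscr{O}_p^*(G)).$$ In particular, $N_G(S)\cap O^{p'}(N_G(P))\le\ker\big(N_G(S)\twoheadrightarrow\pi_1(\mathscr{O}_p^*(G))\big)$ for every $1<P\le S$.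
   Context: $Q^x=x^{-1}Qx$. For a finite group $H$, $O^{p'}(H)$ is the subgroup generated by all elements of $p$-power order. $\mathscr{O}_p^*(G)$ is the orbit category with objects $G/P$, $P$ a non-trivial $p$-subgroup of $G$, and morphisms all $G$-maps. $\pi_1(\mathscr{O}_p^*(G))$ is the fundamental group of its nerve based at $G/S$. The natural map $N_G(S)\to\pi_1(\mathscr{O}_p^*(G))$ sends $n$ to the loop given by the automorphism $eS\mapsto n^{-1}S$ of $G/S$; it is surjective. *)

theory Defs
  imports "HOL-Algebra.Group_Action" "HOL-Algebra.Generated_Groups" "HOL-Algebra.Left_Coset"
    "HOL-Algebra.Multiplicative_Group" "HOL-Computational_Algebra.Primes" "HOL-Homology.Homology"
begin

section \<open>Subgroups\<close>

definition p_subgroup :: "('a, 'b) monoid_scheme \<Rightarrow> nat \<Rightarrow> 'a set \<Rightarrow> bool" where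
  "p_subgroup G p P \<longleftrightarrow> subgroup P G \<and> (\<exists>k. card P = p ^ k)"

definition sylow_subgroup :: "('a, 'b) monoid_scheme \<Rightarrow> nat \<Rightarrow> 'a set \<Rightarrow> bool" where
  "sylow_subgroup G p S \<longleftrightarrow> subgroup S G \<and> card S = p ^ multiplicity p (order G)"

definition nontrivial_subgroup_of :: "('a, 'b) monoid_scheme \<Rightarrow> 'a set \<Rightarrow> 'a set \<Rightarrow> bool" where
  "nontrivial_subgroup_of G S Q \<longleftrightarrow> subgroup Q G \<and> Q \<noteq> {\<one>\<^bsub>G\<^esub>} \<and> Q \<subseteq> S"

text \<open>The group \<open>N\<^sub>G(Q)\<close>.\<close>

definition norm_grp :: "('a, 'b) monoid_scheme \<Rightarrow> 'a set \<Rightarrow> ('a, 'b) monoid_scheme" where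
  "norm_grp G Q = G\<lparr>carrier := normalizer G Q\<rparr>"

text \<open>\<open>O\<^sup>p\<^sup>'(H)\<close>, for a finite group \<open>H\<close>.\<close>

definition Op' :: "nat \<Rightarrow> ('a, 'b) monoid_scheme \<Rightarrow> 'a set" where
  "Op' p H = generate H {h \<in> carrier H. \<exists>k. group.ord H h = p ^ k}"

text \<open>\<open>Q\<^sup>x = x\<^sup>-\<^sup>1 Q x\<close>.\<close>

definition conj_set :: "('a, 'b) monoid_scheme \<Rightarrow> 'a set \<Rightarrow> 'a \<Rightarrow> 'a set" where
  "conj_set G Q x = (\<lambda>q. inv\<^bsub>G\<^esub> x \<otimes>\<^bsub>G\<^esub> q \<otimes>\<^bsub>G\<^esub> x) ` Q"

text \<open>\<open>prefix_prod G x i\<close> is the ordered product \<open>x\<^sub>1 \<cdots> x\<^sub>i\<close>; the value \<open>x 0\<close> is not used.\<close>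

primrec prefix_prod :: "('a, 'b) monoid_scheme \<Rightarrow> (nat \<Rightarrow> 'a) \<Rightarrow> nat \<Rightarrow> 'a" where
  "prefix_prod G x 0 = \<one>\<^bsub>G\<^esub>"
| "prefix_prod G x (Suc i) = prefix_prod G x i \<otimes>\<^bsub>G\<^esub> x (Suc i)"

definition K_orbit :: "('a, 'b) monoid_scheme \<Rightarrow> nat \<Rightarrow> 'a set \<Rightarrow> 'a set" where
  "K_orbit G p S = generate (norm_grp G S)
     {g \<in> carrier (norm_grp G S). \<exists>r Q x.
        (\<forall>i\<in>{0..r}. nontrivial_subgroup_of G S (Q i)) \<and>
        g = prefix_prod G x r \<and>
        (\<forall>i\<in>{1..r}. x i \<in> Op' p (norm_grp G (Q i))) \<and>
        (\<forall>i\<in>{0..<r}. conj_set G (Q 0) (prefix_prod G x i) \<subseteq> Q (Suc i))}"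

section \<open>Small categories\<close>

text \<open>\<open>Comp C a b c g f\<close> is the composite of \<open>f : a \<rightarrow> b\<close> and \<open>g : b \<rightarrow> c\<close>.\<close>

record ('o, 'm) small_cat =
  Obj :: "'o set"
  Hom :: "'o \<Rightarrow> 'o \<Rightarrow> 'm set"
  Id :: "'o \<Rightarrow> 'm"
  Comp :: "'o \<Rightarrow> 'o \<Rightarrow> 'o \<Rightarrow> 'm \<Rightarrow> 'm \<Rightarrow> 'm"

text \<open>The \<open>G\<close>-set \<open>G/P\<close> is the set of left cosets of \<open>P\<close>, on which \<open>g\<close> acts by \<open>C \<mapsto> g <# C\<close>.\<close>

definition G_maps :: "('a, 'b) monoid_scheme \<Rightarrow> 'a set set \<Rightarrow> 'a set set \<Rightarrow> ('a set \<Rightarrow> 'a set) set" where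
  "G_maps G X Y = {f \<in> X \<rightarrow>\<^sub>E Y. \<forall>g\<in>carrier G. \<forall>C\<in>X. f (g <#\<^bsub>G\<^esub> C) = g <#\<^bsub>G\<^esub> f C}"

definition orbit_cat :: "('a, 'b) monoid_scheme \<Rightarrow> nat \<Rightarrow> ('a set set, 'a set \<Rightarrow> 'a set) small_cat" where
  "orbit_cat G p =
     \<lparr>Obj = {lcosets\<^bsub>G\<^esub> P |P. p_subgroup G p P \<and> P \<noteq> {\<one>\<^bsub>G\<^esub>}},
      Hom = G_maps G,
      Id = (\<lambda>X. restrict id X),
      Comp = (\<lambda>X Y Z g f. compose X g f)\<rparr>"

section \<open>Simplicial sets and the nerve\<close>

text \<open>\<open>simp_act X m n \<theta>\<close> is the map from \<open>n\<close>-simplices to \<open>m\<close>-simplices induced by a monotone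
  \<open>\<theta> : {0..m} \<rightarrow> {0..n}\<close>.\<close>

record 'x simp_set =
  simps_of :: "nat \<Rightarrow> 'x set"
  simp_act :: "nat \<Rightarrow> nat \<Rightarrow> (nat \<Rightarrow> nat) \<Rightarrow> 'x \<Rightarrow> 'x"

definition simplex_ops :: "nat \<Rightarrow> nat \<Rightarrow> (nat \<Rightarrow> nat) set" where
  "simplex_ops m n = {\<theta>. \<theta> \<in> {..m} \<rightarrow> {..n} \<and> mono_on {..m} \<theta>}"

text \<open>An \<open>n\<close>-simplex of the nerve is a functor from the poset \<open>{0 \<le> \<dots> \<le> n}\<close> to \<open>C\<close>: a pair of an
  object map and a morphism map, the latter defined on the pairs \<open>i \<le> j\<close>. Both are extensional, so
  that equal functors are equal pairs.\<close>

definition le_pairs :: "nat \<Rightarrow> (nat \<times> nat) set" where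
  "le_pairs n = {(i, j). i \<le> j \<and> j \<le> n}"

definition nerve_simplices ::
  "('o, 'm) small_cat \<Rightarrow> nat \<Rightarrow> ((nat \<Rightarrow> 'o) \<times> (nat \<times> nat \<Rightarrow> 'm)) set" where
  "nerve_simplices C n = {(a, f).
     a \<in> {..n} \<rightarrow>\<^sub>E Obj C \<and>
     f \<in> (\<Pi>\<^sub>E (i, j) \<in> le_pairs n. Hom C (a i) (a j)) \<and>
     (\<forall>i\<le>n. f (i, i) = Id C (a i)) \<and>
     (\<forall>i j k. i \<le> j \<and> j \<le> k \<and> k \<le> n \<longrightarrow>
        f (i, k) = Comp C (a i) (a j) (a k) (f (j, k)) (f (i, j)))}"

definition nerve_act ::
  "nat \<Rightarrow> (nat \<Rightarrow> nat) \<Rightarrow> (nat \<Rightarrow> 'o) \<times> (nat \<times> nat \<Rightarrow> 'm) \<Rightarrow> (nat \<Rightarrow> 'o) \<times> (nat \<times> nat \<Rightarrow> 'm)" where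
  "nerve_act m \<theta> x =
     (restrict (\<lambda>i. fst x (\<theta> i)) {..m}, restrict (\<lambda>(i, j). snd x (\<theta> i, \<theta> j)) (le_pairs m))"

definition nerve :: "('o, 'm) small_cat \<Rightarrow> ((nat \<Rightarrow> 'o) \<times> (nat \<times> nat \<Rightarrow> 'm)) simp_set" where
  "nerve C = \<lparr>simps_of = nerve_simplices C, simp_act = (\<lambda>m n. nerve_act m)\<rparr>"

text \<open>The vertex of an object \<open>c\<close> and the edge of a morphism \<open>f : c \<rightarrow> d\<close>.\<close>

definition nerve_vertex ::
  "('o, 'm) small_cat \<Rightarrow> 'o \<Rightarrow> (nat \<Rightarrow> 'o) \<times> (nat \<times> nat \<Rightarrow> 'm)" where
  "nerve_vertex C c = (restrict (\<lambda>i. c) {..0}, restrict (\<lambda>ij. Id C c) (le_pairs 0))"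

definition nerve_edge ::
  "('o, 'm) small_cat \<Rightarrow> 'o \<Rightarrow> 'o \<Rightarrow> 'm \<Rightarrow> (nat \<Rightarrow> 'o) \<times> (nat \<times> nat \<Rightarrow> 'm)" where
  "nerve_edge C c d f =
     (restrict (\<lambda>i. if i = 0 then c else d) {..1},
      restrict (\<lambda>(i, j). if j = 0 then Id C c else if i = 0 then f else Id C d) (le_pairs 1))"

section \<open>Geometric realization\<close>

definition quot_topology :: "'a topology \<Rightarrow> ('a \<times> 'a) set \<Rightarrow> 'a set topology" where
  "quot_topology X r =
     topology (\<lambda>U. U \<subseteq> topspace X // r \<and> openin X {x \<in> topspace X. r `` {x} \<in> U})"

lemma istopology_quot:
  "istopology (\<lambda>U. U \<subseteq> topspace X // r \<and> openin X {x \<in> topspace X. r `` {x} \<in> U})"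
proof -
  have 1: "{x \<in> topspace X. r `` {x} \<in> U \<inter> V} =
      {x \<in> topspace X. r `` {x} \<in> U} \<inter> {x \<in> topspace X. r `` {x} \<in> V}" for U V
    by auto
  have 2: "{x \<in> topspace X. r `` {x} \<in> \<Union>K} = (\<Union>U\<in>K. {x \<in> topspace X. r `` {x} \<in> U})" for K
    by auto
  show ?thesis
    unfolding istopology_def 1 2 by blast
qed

lemma openin_quot_topology:
  "openin (quot_topology X r) U \<longleftrightarrow>
     U \<subseteq> topspace X // r \<and> openin X {x \<in> topspace X. r `` {x} \<in> U}"
  unfolding quot_topology_def by (simp add: topology_inverse'[OF istopology_quot])

lemma quotient_map_quot_topology:
  "quotient_map X (quot_topology X r) (\<lambda>x. r `` {x})"
proof -
  have "{x \<in> topspace X. r `` {x} \<in> topspace X // r} = topspace X"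
    by (auto simp: quotient_def)
  then have "topspace (quot_topology X r) = topspace X // r"
    by (intro subset_antisym openin_subset)
       (auto simp: openin_quot_topology topspace_def[of "quot_topology X r"])
  then show ?thesis
    unfolding quotient_map_def openin_quot_topology by (auto simp: quotient_def)
qed

definition simplex_topology :: "nat \<Rightarrow> (nat \<Rightarrow> real) topology" where
  "simplex_topology n = subtopology (powertop_real UNIV) (standard_simplex n)"

text \<open>The affine map of standard simplices that sends the \<open>i\<close>-th vertex to the \<open>\<theta> i\<close>-th one.\<close>

definition simplex_push :: "nat \<Rightarrow> (nat \<Rightarrow> nat) \<Rightarrow> (nat \<Rightarrow> real) \<Rightarrow> nat \<Rightarrow> real" where
  "simplex_push m \<theta> t = (\<lambda>j. \<Sum>i | i \<le> m \<and> \<theta> i = j. t i)"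

definition simplex_sum :: "'x simp_set \<Rightarrow> ((nat \<times> 'x) \<times> (nat \<Rightarrow> real)) topology" where
  "simplex_sum X = sum_topology (\<lambda>(n, x). simplex_topology n) (SIGMA n:UNIV. simps_of X n)"

definition realization_gluing ::
  "'x simp_set \<Rightarrow> (((nat \<times> 'x) \<times> (nat \<Rightarrow> real)) \<times> ((nat \<times> 'x) \<times> (nat \<Rightarrow> real))) set" where
  "realization_gluing X =
     {(((m, simp_act X m n \<theta> x), t), ((n, x), simplex_push m \<theta> t)) |m n \<theta> x t.
        x \<in> simps_of X n \<and> \<theta> \<in> simplex_ops m n \<and> t \<in> standard_simplex m}"

definition realization_equiv ::
  "'x simp_set \<Rightarrow> (((nat \<times> 'x) \<times> (nat \<Rightarrow> real)) \<times> ((nat \<times> 'x) \<times> (nat \<Rightarrow> real))) set" where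
  "realization_equiv X = (realization_gluing X \<union> (realization_gluing X)\<inverse>)\<^sup>*"

definition realization :: "'x simp_set \<Rightarrow> ((nat \<times> 'x) \<times> (nat \<Rightarrow> real)) set topology" where
  "realization X = quot_topology (simplex_sum X) (realization_equiv X)"

text \<open>The point of the realization with coordinates \<open>t\<close> in the \<open>n\<close>-simplex \<open>x\<close>.\<close>

definition realization_point ::
  "'x simp_set \<Rightarrow> nat \<Rightarrow> 'x \<Rightarrow> (nat \<Rightarrow> real) \<Rightarrow> ((nat \<times> 'x) \<times> (nat \<Rightarrow> real)) set" where
  "realization_point X n x t = realization_equiv X `` {((n, x), t)}"

definition vertex_point :: "'x simp_set \<Rightarrow> 'x \<Rightarrow> ((nat \<times> 'x) \<times> (nat \<Rightarrow> real)) set" where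
  "vertex_point X v = realization_point X 0 v (\<lambda>i. if i = 0 then 1 else 0)"

text \<open>The path that runs through a 1-simplex from its 0-th to its 1-st vertex.\<close>

definition edge_path :: "'x simp_set \<Rightarrow> 'x \<Rightarrow> real \<Rightarrow> ((nat \<times> 'x) \<times> (nat \<Rightarrow> real)) set" where
  "edge_path X e s = realization_point X 1 e (\<lambda>i. if i = 0 then 1 - s else if i = 1 then s else 0)"

section \<open>The fundamental group\<close>

definition based_loops :: "'a topology \<Rightarrow> 'a \<Rightarrow> (real \<Rightarrow> 'a) set" where
  "based_loops X x0 = {\<gamma>. pathin X \<gamma> \<and> \<gamma> 0 = x0 \<and> \<gamma> 1 = x0}"

definition loop_homotopy :: "'a topology \<Rightarrow> 'a \<Rightarrow> ((real \<Rightarrow> 'a) \<times> (real \<Rightarrow> 'a)) set" where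
  "loop_homotopy X x0 = {(\<gamma>, \<delta>).
     homotopic_with (\<lambda>\<eta>. \<eta> 0 = x0 \<and> \<eta> 1 = x0) (top_of_set {0..1}) X \<gamma> \<delta>}"

text \<open>The library's \<open>joinpaths\<close>, without its type class constraint: first \<open>\<gamma>\<close>, then \<open>\<delta>\<close>.\<close>

definition path_join :: "(real \<Rightarrow> 'a) \<Rightarrow> (real \<Rightarrow> 'a) \<Rightarrow> real \<Rightarrow> 'a" where
  "path_join \<gamma> \<delta> = (\<lambda>s. if s \<le> 1/2 then \<gamma> (2 * s) else \<delta> (2 * s - 1))"

text \<open>Products are written in the order of composition of maps: \<open>[\<alpha>] \<otimes> [\<beta>]\<close> is the class of the loop
  that runs through \<open>\<beta>\<close> first and \<open>\<alpha>\<close> second. With this convention, for an object \<open>c\<close> of a category,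
  sending an automorphism of \<open>c\<close> to its edge is a homomorphism (and not an anti-homomorphism) from
  the automorphism group of \<open>c\<close> to the fundamental group of the nerve.\<close>

definition fundamental_group :: "'a topology \<Rightarrow> 'a \<Rightarrow> (real \<Rightarrow> 'a) set monoid" where
  "fundamental_group X x0 =
     \<lparr>carrier = based_loops X x0 // loop_homotopy X x0,
      monoid.mult = (\<lambda>A B. \<Union>\<alpha>\<in>A. \<Union>\<beta>\<in>B. loop_homotopy X x0 `` {path_join \<beta> \<alpha>}),
      monoid.one = loop_homotopy X x0 `` {\<lambda>s. x0}\<rparr>"

section \<open>The fundamental group of the orbit category\<close>

abbreviation orbit_nerve ::
  "('a, 'b) monoid_scheme \<Rightarrow> nat \<Rightarrow>
     ((nat \<Rightarrow> 'a set set) \<times> (nat \<times> nat \<Rightarrow> 'a set \<Rightarrow> 'a set)) simp_set" where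
  "orbit_nerve G p \<equiv> nerve (orbit_cat G p)"

definition orbit_base where
  "orbit_base G p S = vertex_point (orbit_nerve G p) (nerve_vertex (orbit_cat G p) (lcosets\<^bsub>G\<^esub> S))"

definition orbit_pi1 where
  "orbit_pi1 G p S = fundamental_group (realization (orbit_nerve G p)) (orbit_base G p S)"

text \<open>The automorphism of \<open>G/S\<close> that sends the coset \<open>S\<close> to \<open>n\<^sup>-\<^sup>1 S\<close>.\<close>

definition orbit_aut :: "('a, 'b) monoid_scheme \<Rightarrow> 'a set \<Rightarrow> 'a \<Rightarrow> 'a set \<Rightarrow> 'a set" where
  "orbit_aut G S n =
     (THE f. f \<in> G_maps G (lcosets\<^bsub>G\<^esub> S) (lcosets\<^bsub>G\<^esub> S) \<and> f S = inv\<^bsub>G\<^esub> n <#\<^bsub>G\<^esub> S)"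

definition natural_map where
  "natural_map G p S n =
     loop_homotopy (realization (orbit_nerve G p)) (orbit_base G p S) ``
       {edge_path (orbit_nerve G p)
          (nerve_edge (orbit_cat G p) (lcosets\<^bsub>G\<^esub> S) (lcosets\<^bsub>G\<^esub> S) (orbit_aut G S n))}"

end

theory Submission
  imports Defs "HOL-Algebra.Sylow" "HOL-Algebra.Zassenhaus"
    "HOL-Analysis.Abstract_Topological_Spaces" "HOL-Analysis.Lebesgue_Measure" "HOL-Analysis.Lipschitz"
begin

text \<open>
  Write \<open>N\<close> for the normalizer of \<open>S\<close>, \<open>K\<close> for the subgroup of \<open>N\<close> in the theorem, and \<open>\<pi>\<close> for the
  fundamental group. A morphism \<open>G/P \<rightarrow> G/Q\<close> is \<open>gP \<mapsto> gxQ\<close> for some \<open>x\<close> with \<open>P\<^sup>x \<le> Q\<close>, so a functor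
  from the orbit category to a group assigns a value to each such \<open>x\<close>. The proof compares \<open>N/K\<close> and
  \<open>\<pi>\<close> through functors of this kind.

  The group theory is an analogue of Alperin's fusion theorem. Call \<open>z\<close> a chain on \<open>P\<close> if
  \<open>z = x\<^sub>1 \<cdots> x\<^sub>r\<close> where \<open>x\<^sub>i\<close> lies in \<open>O\<^sup>p\<^sup>'(N\<^sub>G(Q\<^sub>i))\<close> for a subgroup
  \<open>1 < Q\<^sub>i \<le> S\<close> that contains the conjugate of \<open>P\<close> by
  \<open>x\<^sub>1 \<cdots> x\<^sub>i\<^sub>-\<^sub>1\<close>. If \<open>P\<close> and \<open>P\<^sup>g\<close> are non-trivial subgroups of \<open>S\<close>, then \<open>g = z n\<close> with \<open>z\<close> a chain on
  \<open>P\<close> and \<open>n \<in> N\<close> (\<open>splits_all\<close>). The coset \<open>K n\<close> depends only on \<open>P\<close> and \<open>g\<close> (\<open>theta_eq\<close>), it is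
  multiplicative, and it does not change when \<open>P\<close> is made smaller. This gives a functor
  from the orbit category to \<open>N/K\<close> (\<open>group_valued_to_quotient\<close>).

  In the other direction, the classes of edges form a functor to \<open>\<pi>\<close>, after each vertex is joined to
  the base point. Every functor to a group takes the trivial value on \<open>O\<^sup>p\<^sup>'(N\<^sub>G(Q))\<close> (\<open>lam_Opn\<close>): an
  element \<open>u\<close> of \<open>p\<close>-power order that normalizes \<open>Q\<close> lies with \<open>Q\<close> in a \<open>p\<close>-subgroup \<open>U\<close>, and
  \<open>G/Q \<rightarrow> G/U\<close> does not see \<open>u\<close>. Hence chains have trivial value, \<open>K\<close> lies in the kernel of
  \<open>N \<rightarrow> \<pi>\<close>, and the value of every morphism comes from \<open>N\<close>.

  Two topological facts about the nerve of a small category finish the proof, and both are proved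
  directly on the geometric realization. First, every loop is generated by edges
  (\<open>loops_generated_by_edges\<close>), so \<open>N \<rightarrow> \<pi>\<close> is onto. The realization is covered by open sets on which
  one class of vertices, joined to each other by identities, has more than half of an initial part of
  the barycentric weight; such a set contracts to a vertex, and the contractions in two such sets
  differ at each point by an edge. Second, two endomorphisms of the base object whose edges are
  homotopic have equal values under every functor to a group
  (\<open>homotopic_edges_imp_equal\<close>); applied to the functor to \<open>N/K\<close>, it shows that the kernel is
  contained in \<open>K\<close>. Here a point of the realization is turned into a step function on \<open>[0,1)\<close> with
  values in the group, well defined up to right translation. Two step functions that agree on a large
  part of \<open>[0,1)\<close> after a translation determine this translation, so there is a parallel transport
  along paths; it is invariant under homotopy, and along an edge it recovers the value of the functor.
\<close>

section \<open>Conjugation and p-subgroups\<close>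

no_notation subset_mset (infix "<#" 50)

context group
begin

lemma conj_set_carrier:
  "Q \<subseteq> carrier G \<Longrightarrow> x \<in> carrier G \<Longrightarrow> conj_set G Q x \<subseteq> carrier G"
  by (auto simp: conj_set_def)

lemma conj_set_one: "Q \<subseteq> carrier G \<Longrightarrow> conj_set G Q \<one> = Q"
  by (force simp: conj_set_def image_def)

lemma conj_set_mult:
  assumes "Q \<subseteq> carrier G" "x \<in> carrier G" "y \<in> carrier G"
  shows "conj_set G (conj_set G Q x) y = conj_set G Q (x \<otimes> y)"
proof -
  have "inv y \<otimes> (inv x \<otimes> q \<otimes> x) \<otimes> y = inv (x \<otimes> y) \<otimes> q \<otimes> (x \<otimes> y)" if "q \<in> Q" for q
    using that assms by (simp add: inv_mult_group m_assoc subset_iff)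
  then show ?thesis
    unfolding conj_set_def image_image by (intro image_cong) auto
qed

lemma conj_set_mono: "Q \<subseteq> R \<Longrightarrow> conj_set G Q x \<subseteq> conj_set G R x"
  by (auto simp: conj_set_def)

lemma conj_set_inv_cancel:
  assumes "Q \<subseteq> carrier G" "x \<in> carrier G"
  shows "conj_set G (conj_set G Q x) (inv x) = Q" "conj_set G (conj_set G Q (inv x)) x = Q"
  using assms by (simp_all add: conj_set_mult conj_set_one)

lemma conj_set_subset_iff:
  assumes "Q \<subseteq> carrier G" "R \<subseteq> carrier G" "x \<in> carrier G"
  shows "conj_set G Q x \<subseteq> R \<longleftrightarrow> Q \<subseteq> conj_set G R (inv x)"
  using assms conj_set_inv_cancel conj_set_mono inv_closed by metis

lemma inj_on_conj: "x \<in> carrier G \<Longrightarrow> inj_on (\<lambda>q. inv x \<otimes> q \<otimes> x) (carrier G)"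
  by (auto simp: inj_on_def)

lemma card_conj_set:
  "Q \<subseteq> carrier G \<Longrightarrow> x \<in> carrier G \<Longrightarrow> card (conj_set G Q x) = card Q"
  unfolding conj_set_def by (intro card_image inj_on_subset[OF inj_on_conj])

lemma conj_hom: "x \<in> carrier G \<Longrightarrow> (\<lambda>q. inv x \<otimes> q \<otimes> x) \<in> hom G G"
proof -
  assume x: "x \<in> carrier G"
  have "x \<otimes> (inv x \<otimes> w) = w" if "w \<in> carrier G" for w
    using x that by (simp add: m_assoc[symmetric])
  then show ?thesis using x by (auto simp: hom_def m_assoc)
qed

lemma conj_group_hom: "x \<in> carrier G \<Longrightarrow> group_hom G G (\<lambda>q. inv x \<otimes> q \<otimes> x)"
  using conj_hom group_axioms by (simp add: group_hom_def group_hom_axioms_def)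

lemma subgroup_conj_set:
  "subgroup Q G \<Longrightarrow> x \<in> carrier G \<Longrightarrow> subgroup (conj_set G Q x) G"
  unfolding conj_set_def using group_hom.subgroup_img_is_subgroup[OF conj_group_hom] by blast

lemma p_subgroup_conj_set:
  "p_subgroup G p Q \<Longrightarrow> x \<in> carrier G \<Longrightarrow> p_subgroup G p (conj_set G Q x)"
  unfolding p_subgroup_def using subgroup_conj_set card_conj_set subgroup.subset by metis

lemma conj_set_trivial_iff:
  assumes "subgroup Q G" "x \<in> carrier G"
  shows "conj_set G Q x = {\<one>} \<longleftrightarrow> Q = {\<one>}"
proof -
  have 1: "conj_set G {\<one>} y = {\<one>}" if "y \<in> carrier G" for y
    using that by (auto simp: conj_set_def)
  show ?thesis
    using 1 assms conj_set_inv_cancel(1)[of Q x] subgroup.subset inv_closed by metis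
qed

lemma conj_set_in_normalizer:
  assumes "Q \<subseteq> carrier G"
  shows "x \<in> normalizer G Q \<longleftrightarrow> x \<in> carrier G \<and> conj_set G Q x = Q"
proof -
  have "x <# Q #> inv x = conj_set G Q (inv x)" if "x \<in> carrier G"
    using that by (auto simp: conj_set_def l_coset_def r_coset_def)
  moreover have "conj_set G Q (inv x) = Q \<longleftrightarrow> conj_set G Q x = Q" if "x \<in> carrier G"
    using that assms by (metis conj_set_inv_cancel)
  ultimately show ?thesis
    using assms by (auto simp: normalizer_def stabilizer_def)
qed

lemma conj_set_eq_of_subset:
  assumes "finite (carrier G)" "Q \<subseteq> carrier G" "x \<in> carrier G" "conj_set G Q x \<subseteq> Q"
  shows "conj_set G Q x = Q"
  using assms card_conj_set card_subset_eq finite_subset by metis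

lemma conj_set_restrict:
  "subgroup H G \<Longrightarrow> x \<in> H \<Longrightarrow> conj_set (G\<lparr>carrier := H\<rparr>) Q x = conj_set G Q x"
  by (simp add: conj_set_def m_inv_consistent)

text \<open>The dictionary between conjugation and actions: \<open>A\<close> is conjugate into \<open>B\<close> by the elements whose
  cosets are the fixed points of \<open>A\<close> on \<open>G/B\<close>.\<close>

lemma coset_fixed_iff:
  assumes "A \<subseteq> carrier G" "subgroup B G" "x \<in> carrier G"
  shows "(\<forall>a\<in>A. a <# (x <# B) = x <# B) \<longleftrightarrow> conj_set G A x \<subseteq> B"
proof -
  have "a <# (x <# B) = x <# B \<longleftrightarrow> inv x \<otimes> a \<otimes> x \<in> B" if "a \<in> A" for a
  proof -
    have a: "a \<in> carrier G" using that assms by auto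
    have B: "B \<subseteq> carrier G" using assms subgroup.subset by blast
    have 1: "a <# (x <# B) = (a \<otimes> x) <# B"
      using a B assms lcos_m_assoc by simp
    have "(a \<otimes> x) <# B = x <# B \<longleftrightarrow> a \<otimes> x \<in> x <# B"
      using l_repr_independence[of "a \<otimes> x" x B] assms a lcos_self[of "a \<otimes> x" B] by auto
    also have "\<dots> \<longleftrightarrow> inv x \<otimes> (a \<otimes> x) \<in> B"
    proof -
      have "a \<otimes> x = x \<otimes> b \<longleftrightarrow> inv x \<otimes> (a \<otimes> x) = b" if "b \<in> carrier G" for b
        using that a assms by (metis inv_solve_left m_closed)
      then show ?thesis
        using B by (force simp: l_coset_def)
    qed
    finally show ?thesis using 1 a assms by (simp add: m_assoc)
  qed
  then show ?thesis by (auto simp: conj_set_def)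
qed

end

text \<open>An orbit of a \<open>p\<close>-group has \<open>p\<close>-power length, so the orbits with more than one point contribute a
  multiple of \<open>p\<close>.\<close>

lemma (in group_action) p_group_fixed_points:
  assumes "prime p" "order G = p ^ k" "finite E"
  shows "card E mod p = card {x \<in> E. \<forall>g\<in>carrier G. \<phi> g x = x} mod p"
proof -
  let ?F = "{x \<in> E. \<forall>g\<in>carrier G. \<phi> g x = x}"
  let ?O = "orbits G E \<phi>"
  have part: "partition E ?O" by (rule orbit_partition)
  have un: "\<Union>?O = E" by (rule partition.partition_coverture[OF part])
  have disj: "pairwise disjnt ?O"
  proof (rule pairwiseI)
    fix C D assume "C \<in> ?O" "D \<in> ?O" "C \<noteq> D"
    then show "disjnt C D" using partition.disjoint_union[OF part, of C D] by (auto simp: disjnt_def)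
  qed
  have fin: "finite ?O" using un assms(3) finite_UnionD by metis
  have finC: "finite C" if "C \<in> ?O" for C 
    using finite_subset[OF Union_upper[OF that]] un assms(3) by simp
  have card_orb: "p dvd card C \<or> card C = 1" if C: "C \<in> ?O" for C
  proof -
    obtain x where "x \<in> E" "C = orbit G \<phi> x" using C by (auto simp: orbits_def)
    then have "card C dvd p ^ k" using orbit_stabilizer_theorem assms(2) by (metis dvd_triv_left)
    then obtain i where "card C = p ^ i" using assms(1) divides_primepow_nat by blast
    then show ?thesis by (cases i) auto
  qed
  have fix_iff: "x \<in> ?F \<longleftrightarrow> {x} \<in> ?O" for x
  proof
    assume x: "x \<in> ?F"
    then have "orbit G \<phi> x = {x}" using orbit_refl[of x] by (auto simp: orbit_def)
    then show "{x} \<in> ?O" using x by (auto simp: orbits_def)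
  next
    assume "{x} \<in> ?O"
    then obtain y where y: "y \<in> E" "{x} = orbit G \<phi> y" by (auto simp: orbits_def)
    then have "y = x" using orbit_refl[of y] by auto
    then show "x \<in> ?F" using y by (auto simp: orbit_def)
  qed
  have "card E = (\<Sum>C\<in>?O. card C)"
    using card_Union_disjoint[OF disj finC] un by simp
  also have "\<dots> = (\<Sum>C\<in>{C\<in>?O. card C = 1}. card C) + (\<Sum>C\<in>{C\<in>?O. card C \<noteq> 1}. card C)"
    using fin by (subst sum.union_disjoint[symmetric]) (auto intro!: sum.cong)
  also have "(\<Sum>C\<in>{C\<in>?O. card C = 1}. card C) = card {C\<in>?O. card C = 1}"
    by simp
  also have "{C\<in>?O. card C = 1} = (\<lambda>x. {x}) ` ?F"
  proof -
    have "{C\<in>?O. card C = 1} = (\<lambda>x. {x}) ` {x. {x} \<in> ?O}"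
      by (auto simp: card_1_singleton_iff)
    then show ?thesis using fix_iff by auto
  qed
  also have "card \<dots> = card ?F" by (simp add: card_image)
  finally have "card E = card ?F + (\<Sum>C\<in>{C\<in>?O. card C \<noteq> 1}. card C)" .
  moreover have "p dvd (\<Sum>C\<in>{C\<in>?O. card C \<noteq> 1}. card C)"
    using card_orb by (intro dvd_sum) auto
  then obtain j where "(\<Sum>C\<in>{C\<in>?O. card C \<noteq> 1}. card C) = p * j" by (rule dvdE)
  ultimately show ?thesis
    by (simp only: mod_mult_self2)
qed

context group
begin

lemma l_coset_action:
  assumes "subgroup A G" "subgroup B G"
  shows "group_action (G\<lparr>carrier := A\<rparr>) (lcosets B) (\<lambda>a. \<lambda>C\<in>lcosets B. a <# C)"
proof -
  have B: "B \<subseteq> carrier G" using assms subgroup.subset by blast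
  have cl: "g <# C \<in> lcosets B" if "g \<in> carrier G" "C \<in> lcosets B" for g C
    using that B by (auto simp: LCOSETS_def lcos_m_assoc)
  have sub: "C \<subseteq> carrier G" if "C \<in> lcosets B" for C
    using that B by (auto simp: LCOSETS_def l_coset_def)
  have assoc: "g <# (h <# C) = (g \<otimes> h) <# C" if "g \<in> carrier G" "h \<in> carrier G" "C \<in> lcosets B" for g h C
    using that sub by (simp add: lcos_m_assoc)
  have bij: "(\<lambda>C\<in>lcosets B. a <# C) \<in> Bij (lcosets B)" if "a \<in> carrier G" for a
  proof -
    have "bij_betw (\<lambda>C. a <# C) (lcosets B) (lcosets B)"
      by (rule bij_betwI[where g = "\<lambda>C. inv a <# C"])
         (use that cl sub assoc in \<open>auto simp: lcos_mult_one\<close>)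
    then show ?thesis by (simp add: Bij_def)
  qed
  have A: "A \<subseteq> carrier G" using assms subgroup.subset by blast
  have "(\<lambda>a. \<lambda>C\<in>lcosets B. a <# C) \<in> hom G (BijGroup (lcosets B))"
    by (rule homI) (use bij cl assoc in \<open>auto simp: BijGroup_def compose_def fun_eq_iff\<close>)
  then have "group_action G (lcosets B) (\<lambda>a. \<lambda>C\<in>lcosets B. a <# C)"
    unfolding group_action_def group_hom_def group_hom_axioms_def
    by (simp add: group_BijGroup group_axioms)
  then show ?thesis using group_action.induced_action assms(1) by blast
qed

text \<open>This count has two uses: if the index of \<open>B\<close> is prime to \<open>p\<close>, it yields the conjugacy part of
  Sylow's theorem, and if the index is divisible by \<open>p\<close>, it yields the growth of normalizers in
  \<open>p\<close>-groups.\<close>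

lemma p_subgroup_fixed_cosets:
  assumes fin: "finite (carrier G)" and "prime p" "p_subgroup G p A" "subgroup B G"
  shows "card (lcosets B) mod p = card {C \<in> lcosets B. \<exists>x\<in>carrier G. C = x <# B \<and> conj_set G A x \<subseteq> B} mod p"
proof -
  obtain k where k: "card A = p ^ k" and A: "subgroup A G" using assms by (auto simp: p_subgroup_def)
  interpret act: group_action "G\<lparr>carrier := A\<rparr>" "lcosets B" "\<lambda>a. \<lambda>C\<in>lcosets B. a <# C"
    using l_coset_action A assms by blast
  have "finite (lcosets B)" using fin lcosets_subset_PowG assms(4) finite_Pow_iff finite_subset by metis
  then have "card (lcosets B) mod p =
    card {C \<in> lcosets B. \<forall>g\<in>A. (\<lambda>C\<in>lcosets B. g <# C) C = C} mod p"
    using act.p_group_fixed_points[OF assms(2), of k] k by (simp add: order_def)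
  moreover have eq_x: "\<exists>x\<in>carrier G. C = x <# B" if "C \<in> lcosets B" for C
    using that by (auto simp: LCOSETS_def)
  moreover have "{C \<in> lcosets B. \<forall>g\<in>A. (\<lambda>C\<in>lcosets B. g <# C) C = C} =
    {C \<in> lcosets B. \<exists>x\<in>carrier G. C = x <# B \<and> conj_set G A x \<subseteq> B}"
  proof (intro Collect_cong conj_cong refl)
    fix C assume C: "C \<in> lcosets B"
    then obtain y where y: "y \<in> carrier G" "C = y <# B" using eq_x by blast
    have "(\<forall>g\<in>A. (\<lambda>C\<in>lcosets B. g <# C) C = C) \<longleftrightarrow> (\<forall>g\<in>A. g <# C = C)"
      using C by simp
    also have "\<dots> \<longleftrightarrow> conj_set G A y \<subseteq> B"
      unfolding y(2) by (rule coset_fixed_iff[OF subgroup.subset[OF A] assms(4) y(1)])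
    also have "\<dots> \<longleftrightarrow> (\<exists>x\<in>carrier G. C = x <# B \<and> conj_set G A x \<subseteq> B)"
      using coset_fixed_iff[OF subgroup.subset[OF A] assms(4)] y by metis
    finally show "(\<forall>g\<in>A. (\<lambda>C\<in>lcosets B. g <# C) C = C) \<longleftrightarrow>
      (\<exists>x\<in>carrier G. C = x <# B \<and> conj_set G A x \<subseteq> B)" .
  qed
  ultimately show ?thesis by simp
qed

lemma p_subgroup_conj_into_sylow:
  assumes fin: "finite (carrier G)" and "prime p" "p_subgroup G p A" "sylow_subgroup G p S"
  shows "\<exists>x\<in>carrier G. conj_set G A x \<subseteq> S"
proof (rule ccontr)
  assume *: "\<not> ?thesis"
  have S: "subgroup S G" "card S = p ^ multiplicity p (order G)"
    using assms by (auto simp: sylow_subgroup_def)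
  have "{C \<in> lcosets S. \<exists>x\<in>carrier G. C = x <# S \<and> conj_set G A x \<subseteq> S} = {}"
    using * by blast
  then have "p dvd card (lcosets S)"
    using p_subgroup_fixed_cosets[OF fin assms(2,3) S(1)] by (simp only: card.empty mod_0 dvd_eq_mod_eq_0)
  then have "p * p ^ multiplicity p (order G) dvd order G"
    using l_lagrange[OF fin S(1)] S(2) by (metis mult_dvd_mono dvd_refl)
  moreover have "order G \<noteq> 0" using fin order_gt_0_iff_finite by simp
  ultimately show False
    using assms(2) power_dvd_iff_le_multiplicity[of "order G" p "Suc (multiplicity p (order G))"]
      prime_gt_1_nat[OF assms(2)]
    by simp
qed

lemma sylow_subgroup_exists:
  assumes fin: "finite (carrier G)" and "prime p"
  shows "\<exists>S. sylow_subgroup G p S"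
proof -
  have "order G \<noteq> 0" using fin order_gt_0_iff_finite by simp
  then obtain m where "order G = p ^ multiplicity p (order G) * m"
    using multiplicity_dvd by (metis dvdE)
  then show ?thesis
    using sylow_thm[OF assms(2) group_axioms _ fin] by (auto simp: sylow_subgroup_def)
qed

lemma p_subgroup_restrict:
  assumes "subgroup H G" "A \<subseteq> H"
  shows "p_subgroup (G\<lparr>carrier := H\<rparr>) p A \<longleftrightarrow> p_subgroup G p A"
  unfolding p_subgroup_def using assms subgroup_incl incl_subgroup by blast

text \<open>Sylow's theorem in \<open>H\<close>, phrased with subgroups and conjugation in \<open>G\<close>, so that the restricted
  group does not appear in later arguments.\<close>

lemma relative_sylow:
  assumes fin: "finite (carrier G)" and "prime p" and H: "subgroup H G"
  obtains U where "p_subgroup G p U" "U \<subseteq> H"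
    "\<And>A. p_subgroup G p A \<Longrightarrow> A \<subseteq> H \<Longrightarrow> \<exists>x\<in>H. conj_set G A x \<subseteq> U"
proof -
  interpret H: group "G\<lparr>carrier := H\<rparr>" using H by (rule subgroup_imp_group)
  have finH: "finite (carrier (G\<lparr>carrier := H\<rparr>))"
    using fin subgroup.subset[OF H] by (simp add: finite_subset)
  obtain U where U: "sylow_subgroup (G\<lparr>carrier := H\<rparr>) p U"
    using H.sylow_subgroup_exists[OF finH assms(2)] by blast
  then have UH: "U \<subseteq> H" and pU: "p_subgroup (G\<lparr>carrier := H\<rparr>) p U"
    using subgroup.subset by (force simp: sylow_subgroup_def p_subgroup_def)+
  show thesis
  proof (rule that)
    show "p_subgroup G p U" using pU p_subgroup_restrict[OF H UH] by simp
    show "U \<subseteq> H" by fact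
    fix A assume "p_subgroup G p A" "A \<subseteq> H"
    then show "\<exists>x\<in>H. conj_set G A x \<subseteq> U"
      using H.p_subgroup_conj_into_sylow[OF finH assms(2) _ U, of A] p_subgroup_restrict[OF H]
        conj_set_restrict[OF H] by auto
  qed
qed

text \<open>Both subgroups are conjugate into one Sylow subgroup of \<open>H\<close>, by \<open>x\<close> and by \<open>y\<close>; conjugating back by
  \<open>y\<close> leaves \<open>B\<close> in place and moves \<open>A\<close> by \<open>x y\<^sup>-\<^sup>1\<close>.\<close>

lemma common_p_overgroup:
  assumes fin: "finite (carrier G)" and "prime p" and H: "subgroup H G"
    and A: "p_subgroup G p A" "A \<subseteq> H" and B: "p_subgroup G p B" "B \<subseteq> H"
  obtains x U where "x \<in> H" "p_subgroup G p U" "U \<subseteq> H" "conj_set G A x \<subseteq> U" "B \<subseteq> U"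
proof -
  obtain U where U: "p_subgroup G p U" "U \<subseteq> H"
    "\<And>A. p_subgroup G p A \<Longrightarrow> A \<subseteq> H \<Longrightarrow> \<exists>x\<in>H. conj_set G A x \<subseteq> U"
    using relative_sylow[OF assms(1-3)] by blast
  obtain x y where x: "x \<in> H" "conj_set G A x \<subseteq> U" and y: "y \<in> H" "conj_set G B y \<subseteq> U"
    using U(3) A B by meson
  have HG: "H \<subseteq> carrier G" using H subgroup.subset by blast
  have AG: "A \<subseteq> carrier G" "B \<subseteq> carrier G" "U \<subseteq> carrier G" using A B U HG by auto
  have xy: "x \<in> carrier G" "y \<in> carrier G" using x y HG by auto
  show thesis
  proof (rule that)
    show "x \<otimes> inv y \<in> H" using H x y by (simp add: subgroup.m_closed subgroup.m_inv_closed)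
    show "p_subgroup G p (conj_set G U (inv y))"
      using U(1) xy by (simp add: p_subgroup_conj_set)
    show "conj_set G U (inv y) \<subseteq> H"
    proof -
      have "inv (inv y) \<otimes> u \<otimes> inv y \<in> H" if "u \<in> U" for u
        using that U(2) y H xy by (simp add: subgroup.m_closed subgroup.m_inv_closed subset_iff)
      then show ?thesis by (auto simp: conj_set_def)
    qed
    show "conj_set G A (x \<otimes> inv y) \<subseteq> conj_set G U (inv y)"
      using conj_set_mono[OF x(2), of "inv y"] AG xy by (simp add: conj_set_mult)
    show "B \<subseteq> conj_set G U (inv y)"
      using y(2) conj_set_subset_iff[of B U y] AG xy by simp
  qed
qed

text \<open>The coset \<open>P\<close> is a fixed point of \<open>P\<close> on \<open>S/P\<close>, and the number of fixed points is divisible by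
  \<open>p\<close>. A second fixed coset consists of further elements that normalize \<open>P\<close>.\<close>

lemma p_subgroup_normalizer_grows:
  assumes fin: "finite (carrier G)" and "prime p" and "p_subgroup G p S"
    and P: "subgroup P G" "P \<subset> S"
  shows "P \<subset> S \<inter> normalizer G P"
proof -
  have S: "subgroup S G" using assms by (auto simp: p_subgroup_def)
  interpret S: group "G\<lparr>carrier := S\<rparr>" using S by (rule subgroup_imp_group)
  obtain k where k: "card S = p ^ k" using assms by (auto simp: p_subgroup_def)
  have PG: "P \<subseteq> carrier G" and SG: "S \<subseteq> carrier G" using P S subgroup.subset by blast+
  have finS: "finite S" using SG fin finite_subset by blast
  have PS: "subgroup P (G\<lparr>carrier := S\<rparr>)" using P S subgroup_incl by blast
  have lag: "card (lcosets\<^bsub>G\<lparr>carrier := S\<rparr>\<^esub> P) * card P = p ^ k"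
    using S.l_lagrange[OF _ PS] finS k by (simp add: order_def)
  then obtain j where j: "card P = p ^ j" using assms(2) divides_primepow_nat by (metis dvd_triv_right)
  obtain i where i: "card (lcosets\<^bsub>G\<lparr>carrier := S\<rparr>\<^esub> P) = p ^ i"
    using lag assms(2) divides_primepow_nat by (metis dvd_triv_left)
  have "card P < card S" using P finS by (simp add: psubset_card_mono)
  then have "i \<noteq> 0" using i lag k by (auto intro!: Nat.gr0I)
  then have pdvd: "p dvd card (lcosets\<^bsub>G\<lparr>carrier := S\<rparr>\<^esub> P)" using i by simp
  let ?F = "{C \<in> lcosets\<^bsub>G\<lparr>carrier := S\<rparr>\<^esub> P. \<exists>x\<in>S. C = x <#\<^bsub>G\<^esub> P \<and> conj_set G P x \<subseteq> P}"
  have pP: "p_subgroup (G\<lparr>carrier := S\<rparr>) p P" using PS j by (auto simp: p_subgroup_def)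
  have lc: "x <#\<^bsub>G\<lparr>carrier := S\<rparr>\<^esub> P = x <# P" for x by (simp add: l_coset_def)
  have "{C \<in> lcosets\<^bsub>G\<lparr>carrier := S\<rparr>\<^esub> P. \<exists>x\<in>carrier (G\<lparr>carrier := S\<rparr>).
      C = x <#\<^bsub>G\<lparr>carrier := S\<rparr>\<^esub> P \<and> conj_set (G\<lparr>carrier := S\<rparr>) P x \<subseteq> P} = ?F"
    using conj_set_restrict[OF S] lc by auto
  then have "card ?F mod p = 0"
    using S.p_subgroup_fixed_cosets[OF _ assms(2) pP PS] finS pdvd by simp
  moreover have PF: "P \<in> ?F"
  proof -
    have "\<one> <# P = P" using PG by (simp add: lcos_mult_one)
    moreover have "\<one> \<in> S" using S by (rule subgroup.one_closed)
    ultimately show ?thesis using PG lc by (force simp: LCOSETS_def conj_set_one)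
  qed
  ultimately have "?F \<noteq> {P}"
    using assms(2) by (auto simp: prime_nat_iff)
  then obtain C where C: "C \<in> ?F" "C \<noteq> P" using PF by blast
  then obtain x where x: "x \<in> S" "C = x <# P" "conj_set G P x \<subseteq> P" by blast
  have xG: "x \<in> carrier G" using x SG by auto
  have "x \<notin> P"
  proof
    assume "x \<in> P"
    then have "x <# P = P" using P(1) xG coset_join3 by blast
    then show False using C x by simp
  qed
  moreover have "x \<in> normalizer G P"
    using conj_set_in_normalizer[OF PG] conj_set_eq_of_subset[OF fin PG xG x(3)] xG by blast
  moreover have "P \<subseteq> normalizer G P"
  proof
    fix x assume x: "x \<in> P"
    then have "conj_set G P x \<subseteq> P"
      using P(1) by (auto simp: conj_set_def subgroup.m_closed subgroup.m_inv_closed)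
    then show "x \<in> normalizer G P"
      using conj_set_in_normalizer[OF PG] conj_set_eq_of_subset[OF fin PG] x PG by blast
  qed
  ultimately show ?thesis using x(1) P(2) by blast
qed

section \<open>Elements of p-power order in normalizers\<close>

lemma carrier_norm_grp [simp]: "carrier (norm_grp G Q) = normalizer G Q"
  by (simp add: norm_grp_def)

lemma norm_grp_mult [simp]: "monoid.mult (norm_grp G Q) = monoid.mult G"
  by (simp add: norm_grp_def)

lemma norm_grp_one [simp]: "monoid.one (norm_grp G Q) = \<one>"
  by (simp add: norm_grp_def)

lemma norm_grp_pow [simp]: "x [^]\<^bsub>norm_grp G Q\<^esub> (n :: nat) = x [^] n"
  by (simp add: norm_grp_def nat_pow_def)

lemma norm_grp_inv: "Q \<subseteq> carrier G \<Longrightarrow> x \<in> normalizer G Q \<Longrightarrow> inv\<^bsub>norm_grp G Q\<^esub> x = inv x"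
  by (simp add: norm_grp_def m_inv_consistent normalizer_imp_subgroup)

lemma group_norm_grp: "Q \<subseteq> carrier G \<Longrightarrow> group (norm_grp G Q)"
  by (simp add: norm_grp_def subgroup_imp_group normalizer_imp_subgroup)

text \<open>Orders in the normalizer become powers in \<open>G\<close>, and the subgroup is generated inside \<open>G\<close>: inductions
  over generated elements then take place in \<open>G\<close> only.\<close>

lemma Op'_norm_grp:
  assumes "prime p" "Q \<subseteq> carrier G"
  shows "Op' p (norm_grp G Q) = generate G {h \<in> normalizer G Q. \<exists>k. h [^] (p ^ k) = \<one>}"
proof -
  interpret N: group "norm_grp G Q" using assms group_norm_grp by blast
  have "(\<exists>k. N.ord h = p ^ k) \<longleftrightarrow> (\<exists>k. h [^] (p ^ k) = \<one>)" if "h \<in> normalizer G Q" for h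
    using that N.pow_eq_id[of h] divides_primepow_nat[OF assms(1)] by (metis carrier_norm_grp dvd_refl norm_grp_one norm_grp_pow)
  then have "Op' p (norm_grp G Q) = generate (norm_grp G Q) {h \<in> normalizer G Q. \<exists>k. h [^] (p ^ k) = \<one>}"
    unfolding Op'_def by (intro arg_cong[where f = "generate (norm_grp G Q)"] Collect_cong) auto
  also have "\<dots> = generate G {h \<in> normalizer G Q. \<exists>k. h [^] (p ^ k) = \<one>}"
    unfolding norm_grp_def
    by (rule generate_consistent) (use normalizer_imp_subgroup[OF assms(2)] in auto)
  finally show ?thesis .
qed

lemma Op'_norm_grp_subgroup:
  assumes "prime p" "Q \<subseteq> carrier G"
  shows "subgroup (Op' p (norm_grp G Q)) G" "Op' p (norm_grp G Q) \<subseteq> normalizer G Q"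
proof -
  have N: "subgroup (normalizer G Q) G" by (rule normalizer_imp_subgroup[OF assms(2)])
  show "subgroup (Op' p (norm_grp G Q)) G"
    unfolding Op'_norm_grp[OF assms] using N subgroup.subset
    by (intro generate_is_subgroup) blast
  show "Op' p (norm_grp G Q) \<subseteq> normalizer G Q"
    unfolding Op'_norm_grp[OF assms] by (intro generate_subgroup_incl N) auto
qed

lemma p_subgroup_le_Op':
  assumes "prime p" "Q \<subseteq> carrier G" "p_subgroup G p A" "A \<subseteq> normalizer G Q"
  shows "A \<subseteq> Op' p (norm_grp G Q)"
proof
  fix a assume a: "a \<in> A"
  obtain k where k: "card A = p ^ k" and A: "subgroup A G" using assms by (auto simp: p_subgroup_def)
  interpret A: group "G\<lparr>carrier := A\<rparr>" using A by (rule subgroup_imp_group)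
  have "a [^]\<^bsub>G\<lparr>carrier := A\<rparr>\<^esub> order (G\<lparr>carrier := A\<rparr>) = \<one>"
    using A.pow_order_eq_1[of a] a by simp
  then have "a [^] (p ^ k) = \<one>" using k by (simp add: order_def nat_pow_def)
  then show "a \<in> Op' p (norm_grp G Q)"
    unfolding Op'_norm_grp[OF assms(1,2)] using a assms(4) by (intro generate.incl) auto
qed

lemma nat_pow_conj:
  assumes "x \<in> carrier G" "h \<in> carrier G"
  shows "(inv x \<otimes> h \<otimes> x) [^] (n :: nat) = inv x \<otimes> (h [^] n) \<otimes> x"
  using group_hom.hom_nat_pow[OF conj_group_hom[OF assms(1)] assms(2)] by simp

lemma normalizer_conj:
  assumes "Q \<subseteq> carrier G" "x \<in> carrier G" "h \<in> normalizer G Q"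
  shows "inv x \<otimes> h \<otimes> x \<in> normalizer G (conj_set G Q x)"
proof -
  have h: "h \<in> carrier G" "conj_set G Q h = Q" using assms conj_set_in_normalizer by auto
  have "conj_set G (conj_set G Q x) (inv x \<otimes> h \<otimes> x) = conj_set G Q (x \<otimes> (inv x \<otimes> h \<otimes> x))"
    using assms h by (simp add: conj_set_mult)
  also have "x \<otimes> (inv x \<otimes> h \<otimes> x) = h \<otimes> x" using assms h by (simp add: m_assoc[symmetric])
  also have "conj_set G Q (h \<otimes> x) = conj_set G Q x"
    using conj_set_mult[OF assms(1) h(1) assms(2)] h by simp
  finally show ?thesis
    using assms h conj_set_in_normalizer conj_set_carrier by simp
qed

lemma Op'_norm_grp_conj:
  assumes "prime p" "Q \<subseteq> carrier G" "x \<in> carrier G" "h \<in> Op' p (norm_grp G Q)"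
  shows "inv x \<otimes> h \<otimes> x \<in> Op' p (norm_grp G (conj_set G Q x))"
proof -
  interpret cx: group_hom G G "\<lambda>q. inv x \<otimes> q \<otimes> x" using assms conj_group_hom by blast
  let ?X = "{h \<in> normalizer G Q. \<exists>k. h [^] (p ^ k) = \<one>}"
  have X: "?X \<subseteq> carrier G" using conj_set_in_normalizer[OF assms(2)] by auto
  have "inv x \<otimes> h \<otimes> x \<in> (\<lambda>q. inv x \<otimes> q \<otimes> x) ` generate G ?X"
    using assms(4) Op'_norm_grp[OF assms(1,2)] by blast
  also have "\<dots> = generate G ((\<lambda>q. inv x \<otimes> q \<otimes> x) ` ?X)"
    by (rule cx.generate_img[OF X, symmetric])
  also have "\<dots> \<subseteq> Op' p (norm_grp G (conj_set G Q x))"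
    unfolding Op'_norm_grp[OF assms(1) conj_set_carrier[OF assms(2,3)]]
  proof (intro mono_generate subsetI)
    fix y assume "y \<in> (\<lambda>q. inv x \<otimes> q \<otimes> x) ` ?X"
    then obtain h k where h: "h \<in> normalizer G Q" "h [^] (p ^ k) = \<one>" "y = inv x \<otimes> h \<otimes> x" by auto
    then have "h \<in> carrier G" using X by auto
    then have "y [^] (p ^ k) = \<one>" using h assms(3) by (simp add: nat_pow_conj)
    moreover have "y \<in> normalizer G (conj_set G Q x)"
      unfolding h(3) by (rule normalizer_conj[OF assms(2,3) h(1)])
    ultimately show "y \<in> {h \<in> normalizer G (conj_set G Q x). \<exists>k. h [^] (p ^ k) = \<one>}" by blast
  qed
  finally show ?thesis .
qed

end

section \<open>Chains of elements of normalizers\<close>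

locale sylow_system = group G for G (structure) +
  fixes p :: nat and S :: "'a set"
  assumes fin: "finite (carrier G)" and prime_p: "prime p" and sylow_S: "sylow_subgroup G p S"
begin

abbreviation sub where "sub \<equiv> nontrivial_subgroup_of G S"
abbreviation Opn where "Opn Q \<equiv> Op' p (norm_grp G Q)"
abbreviation N where "N \<equiv> normalizer G S"
abbreviation K where "K \<equiv> K_orbit G p S"

lemma S: "subgroup S G" "S \<subseteq> carrier G" "p_subgroup G p S" "finite S"
  using sylow_S fin subgroup.subset[of S G] finite_subset[of S "carrier G"]
  by (auto simp: sylow_subgroup_def p_subgroup_def)

lemma subD: "sub Q \<Longrightarrow> subgroup Q G" "sub Q \<Longrightarrow> Q \<noteq> {\<one>}" "sub Q \<Longrightarrow> Q \<subseteq> S" "sub Q \<Longrightarrow> Q \<subseteq> carrier G"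
  using S by (auto simp: nontrivial_subgroup_of_def)

lemma p_subgroup_sub: "subgroup Q G \<Longrightarrow> Q \<subseteq> S \<Longrightarrow> p_subgroup G p Q"
proof -
  assume Q: "subgroup Q G" "Q \<subseteq> S"
  interpret SG: group "G\<lparr>carrier := S\<rparr>" using S(1) by (rule subgroup_imp_group)
  have "subgroup Q (G\<lparr>carrier := S\<rparr>)" using Q S subgroup_incl by blast
  then have "card Q dvd card S"
    using SG.l_lagrange[of Q] S by (auto simp: order_def) (metis dvd_triv_right)
  then show ?thesis
    using S(3) Q(1) divides_primepow_nat[OF prime_p] by (auto simp: p_subgroup_def)
qed

lemma sub_conj: "sub P \<Longrightarrow> g \<in> carrier G \<Longrightarrow> conj_set G P g \<subseteq> S \<Longrightarrow> sub (conj_set G P g)"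
  by (simp add: nontrivial_subgroup_of_def subgroup_conj_set conj_set_trivial_iff)

lemma sub_mono: "sub P \<Longrightarrow> subgroup Q G \<Longrightarrow> P \<subseteq> Q \<Longrightarrow> Q \<subseteq> S \<Longrightarrow> sub Q"
  using subgroup.one_closed unfolding nontrivial_subgroup_of_def by blast

lemma N_iff: "n \<in> N \<longleftrightarrow> n \<in> carrier G \<and> conj_set G S n = S"
  by (rule conj_set_in_normalizer[OF S(2)])

lemma N_subgroup: "subgroup N G"
  by (rule normalizer_imp_subgroup[OF S(2)])

lemma N_carrier: "n \<in> N \<Longrightarrow> n \<in> carrier G"
  using N_iff by blast

lemma N_inv: "n \<in> N \<Longrightarrow> inv n \<in> N"
  by (rule subgroup.m_inv_closed[OF N_subgroup])

lemma N_mult: "m \<in> N \<Longrightarrow> n \<in> N \<Longrightarrow> m \<otimes> n \<in> N"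
  by (rule subgroup.m_closed[OF N_subgroup])

lemma conj_N_le_S: "P \<subseteq> S \<Longrightarrow> n \<in> N \<Longrightarrow> conj_set G P n \<subseteq> S"
  using conj_set_mono N_iff by metis

lemma Opn:
  assumes Q: "sub Q"
  shows "subgroup (Opn Q) G" "x \<in> Opn Q \<Longrightarrow> x \<in> carrier G"
    "x \<in> Opn Q \<Longrightarrow> conj_set G Q x = Q"
proof -
  note o = Op'_norm_grp_subgroup[OF prime_p subD(4)[OF Q]]
  show "subgroup (Opn Q) G" by (rule o(1))
  assume "x \<in> Opn Q"
  then have "x \<in> normalizer G Q" using o(2) by blast
  then show "x \<in> carrier G" "conj_set G Q x = Q"
    using conj_set_in_normalizer[OF subD(4)[OF Q]] by simp_all
qed

text \<open>\<open>chain P g\<close> is the factorization of the theorem with \<open>Q\<^sub>0\<close> replaced by \<open>P\<close>, grown at its right end.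
  Keeping the starting subgroup as a parameter allows chains to be restricted, concatenated and
  reversed.\<close>

inductive chain :: "'a set \<Rightarrow> 'a \<Rightarrow> bool" for P where
  one: "chain P \<one>"
| step: "chain P g \<Longrightarrow> sub Q \<Longrightarrow> conj_set G P g \<subseteq> Q \<Longrightarrow> x \<in> Opn Q \<Longrightarrow> chain P (g \<otimes> x)"

lemma chain_carrier: "chain P g \<Longrightarrow> g \<in> carrier G"
  by (induction rule: chain.induct) (auto simp: Opn)

lemma chain_conj: 
  assumes "chain P g" "P \<subseteq> S"
  shows "conj_set G P g \<subseteq> S"
  using assms
proof (induction rule: chain.induct)
  case one
  then show ?case using S by (simp add: conj_set_one subset_trans[OF _ S(2)])
next
  case (step g Q x)
  have PG: "P \<subseteq> carrier G" using step.prems S by blast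
  have "conj_set G P (g \<otimes> x) = conj_set G (conj_set G P g) x"
    using conj_set_mult[OF PG] chain_carrier Opn step by simp
  also have "\<dots> \<subseteq> Q"
    using conj_set_mono[OF step.hyps(3), of x] Opn(3)[OF step.hyps(2,4)] by simp
  finally show ?case using subD step by blast
qed

lemma chain_antimono: "chain P g \<Longrightarrow> P' \<subseteq> P \<Longrightarrow> chain P' g"
proof (induction rule: chain.induct)
  case (step g Q x)
  then show ?case using chain.step[of P' g Q x] conj_set_mono[of P' P g] by blast
qed (rule chain.one)

lemma chain_mult:
  assumes "chain (conj_set G P g) h" "chain P g" "P \<subseteq> S"
  shows "chain P (g \<otimes> h)"
  using assms
proof (induction rule: chain.induct)
  case one
  then show ?case using chain_carrier by simp
next
  case (step h Q x)
  have PG: "P \<subseteq> carrier G" using step.prems S by blast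
  have c: "g \<in> carrier G" "h \<in> carrier G" "x \<in> carrier G" using step chain_carrier Opn by auto
  have "chain P (g \<otimes> h \<otimes> x)"
  proof (rule chain.step[OF _ step.hyps(2) _ step.hyps(4)])
    show "chain P (g \<otimes> h)" using step by blast
    show "conj_set G P (g \<otimes> h) \<subseteq> Q" using step.hyps(3) conj_set_mult[OF PG c(1,2)] by simp
  qed
  then show ?case using c by (simp add: m_assoc)
qed

lemma chain_single: "sub Q \<Longrightarrow> P \<subseteq> Q \<Longrightarrow> x \<in> Opn Q \<Longrightarrow> chain P x"
  using chain.step[OF chain.one, of Q P x] conj_set_one[of P] subD[of Q] Opn[of Q] by auto

text \<open>Each factor \<open>x\<^sub>i\<close> normalizes its \<open>Q\<^sub>i\<close>, so the conjugates of \<open>P\<close> before and after it both lie in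
  \<open>Q\<^sub>i\<close>, and the chain can be run backwards through the same subgroups.\<close>

lemma chain_inv:
  assumes "chain P g" "P \<subseteq> S"
  shows "chain (conj_set G P g) (inv g)"
  using assms
proof (induction rule: chain.induct)
  case one
  then show ?case by (simp add: chain.one)
next
  case (step g Q x)
  have PG: "P \<subseteq> carrier G" using step.prems S by blast
  have c: "g \<in> carrier G" "x \<in> carrier G" using step chain_carrier Opn by auto
  have eq: "conj_set G P (g \<otimes> x) = conj_set G (conj_set G P g) x"
    using conj_set_mult[OF PG c] by simp
  have sub: "conj_set G P (g \<otimes> x) \<subseteq> Q" 
    unfolding eq using conj_set_mono[OF step.hyps(3), of x] Opn(3)[OF step.hyps(2,4)] by simp
  have 1: "chain (conj_set G P (g \<otimes> x)) (inv x)"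
    using chain_single[OF step.hyps(2) sub] subgroup.m_inv_closed[OF Opn(1)[OF step.hyps(2)]] step.hyps(4) by blast
  have 2: "conj_set G (conj_set G P (g \<otimes> x)) (inv x) = conj_set G P g"
    unfolding eq using conj_set_inv_cancel conj_set_carrier PG c by simp
  have "chain (conj_set G P (g \<otimes> x)) (inv x \<otimes> inv g)"
    using chain_mult[OF _ 1] 2 step.IH[OF step.prems] subD(3)[OF step.hyps(2)] sub by auto
  then show ?case using c by (simp add: inv_mult_group)
qed

text \<open>\<open>N\<close> permutes the subgroups of \<open>S\<close>, so it conjugates all the \<open>Q\<^sub>i\<close> at once. This makes \<open>K\<close> normal.\<close>

lemma chain_N_conj:
  assumes "chain P g" "P \<subseteq> S" "n \<in> N"
  shows "chain (conj_set G P n) (inv n \<otimes> g \<otimes> n)"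
  using assms
proof (induction rule: chain.induct)
  case one
  then show ?case using N_carrier by (simp add: chain.one)
next
  case (step g Q x)
  have PG: "P \<subseteq> carrier G" using step.prems S by blast
  have c: "g \<in> carrier G" "x \<in> carrier G" "n \<in> carrier G" using step chain_carrier Opn N_carrier by auto
  have nn: "n \<otimes> (inv n \<otimes> w) = w" if "w \<in> carrier G" for w
    using c that by (simp add: m_assoc[symmetric])
  have "chain (conj_set G P n) (inv n \<otimes> g \<otimes> n \<otimes> (inv n \<otimes> x \<otimes> n))"
  proof (rule chain.step)
    show "chain (conj_set G P n) (inv n \<otimes> g \<otimes> n)" using step by blast
    show "sub (conj_set G Q n)" using step subD conj_N_le_S c by (intro sub_conj) auto
    show "inv n \<otimes> x \<otimes> n \<in> Opn (conj_set G Q n)"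
      using step subD c by (intro Op'_norm_grp_conj prime_p) auto
    have "conj_set G (conj_set G P n) (inv n \<otimes> g \<otimes> n) = conj_set G (conj_set G P g) n"
      using PG c nn by (simp add: conj_set_mult m_assoc)
    then show "conj_set G (conj_set G P n) (inv n \<otimes> g \<otimes> n) \<subseteq> conj_set G Q n"
      using conj_set_mono[OF step.hyps(3), of n] by simp
  qed
  then show ?case using c nn by (simp add: m_assoc)
qed

lemma S_chain: "sub P \<Longrightarrow> s \<in> S \<Longrightarrow> chain P s"
proof -
  assume P: "sub P" and s: "s \<in> S"
  have "S \<subseteq> N"
    using subgroup_in_normalizer[OF S(1)] normal_imp_subgroup subgroup.subset by force
  then have "S \<subseteq> Opn S" using p_subgroup_le_Op'[OF prime_p S(2,3)] by blast
  moreover have "sub S" using sub_mono[OF P S(1)] subD[OF P] by blast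
  ultimately show ?thesis using chain_single subD[OF P] s by blast
qed

lemma chain_iff_factorization:
  "(\<exists>P. sub P \<and> chain P g) \<longleftrightarrow> (\<exists>r Q x.
        (\<forall>i\<in>{0..r}. sub (Q i)) \<and>
        g = prefix_prod G x r \<and>
        (\<forall>i\<in>{1..r}. x i \<in> Opn (Q i)) \<and>
        (\<forall>i\<in>{0..<r}. conj_set G (Q 0) (prefix_prod G x i) \<subseteq> Q (Suc i)))" (is "_ \<longleftrightarrow> ?F g")
proof
  assume "\<exists>P. sub P \<and> chain P g"
  then obtain P where P: "sub P" "chain P g" by blast
  have "\<exists>r Q x. Q 0 = P \<and> (\<forall>i\<in>{0..r}. sub (Q i)) \<and>
        g = prefix_prod G x r \<and>
        (\<forall>i\<in>{1..r}. x i \<in> Opn (Q i)) \<and>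
        (\<forall>i\<in>{0..<r}. conj_set G (Q 0) (prefix_prod G x i) \<subseteq> Q (Suc i))"
    using P(2)
  proof (induction rule: chain.induct)
    case one
    show ?case by (rule exI[of _ 0], rule exI[of _ "\<lambda>_. P"]) (use P in auto)
  next
    case (step g R y)
    then obtain r Q x where IH: "Q 0 = P" "\<forall>i\<in>{0..r}. sub (Q i)" "g = prefix_prod G x r"
      "\<forall>i\<in>{1..r}. x i \<in> Opn (Q i)"
      "\<forall>i\<in>{0..<r}. conj_set G (Q 0) (prefix_prod G x i) \<subseteq> Q (Suc i)" by blast
    define Q' where "Q' = Q(Suc r := R)"
    define x' where "x' = x(Suc r := y)"
    have new: "Q' (Suc r) = R" "x' (Suc r) = y" by (simp_all add: Q'_def x'_def)
    have old: "Q' i = Q i" "x' i = x i" if "i \<le> r" for i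
      using that by (simp_all add: Q'_def x'_def)
    have pp: "prefix_prod G x' i = prefix_prod G x i" if "i \<le> r" for i
      using that by (induction i) (auto simp: old)
    have "Q' 0 = P" using IH(1) old(1)[of 0] by simp
    moreover have "\<forall>i\<in>{0..Suc r}. sub (Q' i)"
      using IH(2) old(1) new(1) step.hyps(2) by (auto simp: le_Suc_eq)
    moreover have "g \<otimes> y = prefix_prod G x' (Suc r)"
      using IH(3) pp[of r] new(2) by simp
    moreover have "\<forall>i\<in>{1..Suc r}. x' i \<in> Opn (Q' i)"
      using IH(4) old new step.hyps(4) by (auto simp: le_Suc_eq)
    moreover have "\<forall>i\<in>{0..<Suc r}. conj_set G (Q' 0) (prefix_prod G x' i) \<subseteq> Q' (Suc i)"
    proof
      fix i assume "i \<in> {0..<Suc r}"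
      then consider "i < r" | "i = r" by fastforce
      then show "conj_set G (Q' 0) (prefix_prod G x' i) \<subseteq> Q' (Suc i)"
      proof cases
        case 1
        then show ?thesis using IH(5) old(1)[of 0] old(1)[of "Suc i"] pp[of i] by simp
      next
        case 2
        then show ?thesis using step.hyps(3) IH(1,3) old(1)[of 0] new(1) pp[of i] by simp
      qed
    qed
    ultimately show ?case by blast
  qed
  then show "?F g" by blast
next
  assume "?F g"
  then obtain r Q x where F: "\<forall>i\<in>{0..r}. sub (Q i)" "g = prefix_prod G x r"
      "\<forall>i\<in>{1..r}. x i \<in> Opn (Q i)"
      "\<forall>i\<in>{0..<r}. conj_set G (Q 0) (prefix_prod G x i) \<subseteq> Q (Suc i)" by blast
  have "chain (Q 0) (prefix_prod G x i)" if "i \<le> r" for i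
    using that
  proof (induction i)
    case 0
    then show ?case by (simp add: chain.one)
  next
    case (Suc i)
    then show ?case using F by (auto intro!: chain.step[where Q = "Q (Suc i)"])
  qed
  then have "chain (Q 0) g" using F(2) by simp
  moreover have "sub (Q 0)" using F(1) by simp
  ultimately show "\<exists>P. sub P \<and> chain P g" by blast
qed

lemma K_eq: "K = generate (norm_grp G S) {g \<in> N. \<exists>P. sub P \<and> chain P g}"
  unfolding K_orbit_def chain_iff_factorization by simp

lemma chain_in_K: "sub P \<Longrightarrow> chain P g \<Longrightarrow> g \<in> N \<Longrightarrow> g \<in> K"
  unfolding K_eq by (rule generate.incl) blast

lemma K_normal: "K \<lhd> norm_grp G S"
proof -
  interpret N: group "norm_grp G S" by (rule group_norm_grp[OF S(2)])
  show ?thesis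
    unfolding K_eq
  proof (rule N.normal_generateI)
    show "{g \<in> N. \<exists>P. sub P \<and> chain P g} \<subseteq> carrier (norm_grp G S)" by auto
    fix h g assume h: "h \<in> {g \<in> N. \<exists>P. sub P \<and> chain P g}" and g: "g \<in> carrier (norm_grp G S)"
    then obtain P where P: "sub P" "chain P h" by auto
    have g': "inv g \<in> N" "g \<in> N" "g \<in> carrier G" "h \<in> N"
      using g h N_inv N_carrier by auto
    have "chain (conj_set G P (inv g)) (inv (inv g) \<otimes> h \<otimes> inv g)"
      using chain_N_conj[OF P(2) subD(3)[OF P(1)] g'(1)] .
    moreover have "sub (conj_set G P (inv g))"
      using P subD conj_N_le_S g' by (intro sub_conj) auto
    moreover have "g \<otimes> h \<otimes> inv g \<in> N" by (intro N_mult g')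
    ultimately show "g \<otimes>\<^bsub>norm_grp G S\<^esub> h \<otimes>\<^bsub>norm_grp G S\<^esub> inv\<^bsub>norm_grp G S\<^esub> g \<in> {g \<in> N. \<exists>P. sub P \<and> chain P g}"
      using g' norm_grp_inv[OF S(2)] by auto
  qed
qed

section \<open>Factorization into chains and elements of N\<close>

definition splits :: "'a set \<Rightarrow> 'a \<Rightarrow> bool" where
  "splits P g \<longleftrightarrow> (\<exists>z n. chain P z \<and> n \<in> N \<and> g = z \<otimes> n)"

lemma splits_chain: "chain P z \<Longrightarrow> splits P z"
  unfolding splits_def using chain_carrier subgroup.one_closed[OF N_subgroup]
  by (metis r_one)

lemma splits_antimono: "splits P g \<Longrightarrow> P' \<subseteq> P \<Longrightarrow> splits P' g"
  unfolding splits_def using chain_antimono by blast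

text \<open>The second chain has to be moved across \<open>n\<close>. Conjugation by \<open>n\<close> turns a chain on \<open>P\<^sup>z\<^sup>n\<close> into a chain
  on \<open>P\<^sup>z\<close>, which continues \<open>z\<close>.\<close>

lemma split_mult:
  assumes P: "P \<subseteq> S" and z: "chain P z" "n \<in> N"
    and z': "chain (conj_set G P (z \<otimes> n)) z'" "n' \<in> N"
  shows "chain P (z \<otimes> (n \<otimes> z' \<otimes> inv n))" "n \<otimes> n' \<in> N"
    "(z \<otimes> n) \<otimes> (z' \<otimes> n') = (z \<otimes> (n \<otimes> z' \<otimes> inv n)) \<otimes> (n \<otimes> n')"
proof -
  have c: "z \<in> carrier G" "z' \<in> carrier G" "n \<in> carrier G" "n' \<in> carrier G"
    using assms chain_carrier N_carrier by auto
  have PG: "P \<subseteq> carrier G" using P S by blast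
  have ni: "inv n \<in> N" by (rule N_inv[OF z(2)])
  have nn: "inv n \<otimes> (n \<otimes> w) = w" if "w \<in> carrier G" for w
    using c that by (simp add: m_assoc[symmetric])
  have eq: "conj_set G P (z \<otimes> n) = conj_set G (conj_set G P z) n"
    using conj_set_mult[OF PG] c by simp
  have 1: "conj_set G P (z \<otimes> n) \<subseteq> S"
    unfolding eq using chain_conj[OF z(1) P] conj_N_le_S z(2) by blast
  have "chain (conj_set G (conj_set G P (z \<otimes> n)) (inv n)) (inv (inv n) \<otimes> z' \<otimes> inv n)"
    by (rule chain_N_conj[OF z'(1) 1 ni])
  also have "conj_set G (conj_set G P (z \<otimes> n)) (inv n) = conj_set G P z"
    unfolding eq using conj_set_inv_cancel conj_set_carrier PG c by simp
  finally have "chain (conj_set G P z) (n \<otimes> z' \<otimes> inv n)" using c by simp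
  then show "chain P (z \<otimes> (n \<otimes> z' \<otimes> inv n))" using chain_mult z(1) P by blast
  show "n \<otimes> n' \<in> N" by (rule N_mult[OF z(2) z'(2)])
  show "(z \<otimes> n) \<otimes> (z' \<otimes> n') = (z \<otimes> (n \<otimes> z' \<otimes> inv n)) \<otimes> (n \<otimes> n')"
    using c nn by (simp add: m_assoc)
qed

lemma splits_mult:
  assumes "splits P g" "splits (conj_set G P g) h" "P \<subseteq> S"
  shows "splits P (g \<otimes> h)"
proof -
  obtain z n z' n' where *: "chain P z" "n \<in> N" "g = z \<otimes> n" "chain (conj_set G P g) z'" "n' \<in> N" "h = z' \<otimes> n'"
    using assms unfolding splits_def by blast
  note sm = split_mult[OF assms(3) *(1,2) *(4)[unfolded *(3)] *(5)]
  show ?thesis unfolding splits_def using sm *(3,6) by metis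
qed

lemma splits_inv:
  assumes "splits P g" "P \<subseteq> S"
  shows "splits (conj_set G P g) (inv g)"
proof -
  obtain z n where *: "chain P z" "n \<in> N" "g = z \<otimes> n"
    using assms unfolding splits_def by blast
  have c: "z \<in> carrier G" "n \<in> carrier G" using * chain_carrier N_carrier by auto
  have PG: "P \<subseteq> carrier G" using assms S by blast
  have "chain (conj_set G (conj_set G P z) n) (inv n \<otimes> inv z \<otimes> n)"
    by (rule chain_N_conj[OF chain_inv[OF *(1) assms(2)] chain_conj[OF *(1) assms(2)] *(2)])
  then have "chain (conj_set G P g) (inv n \<otimes> inv z \<otimes> n)"
    using conj_set_mult[OF PG c] *(3) by simp
  moreover have "inv g = (inv n \<otimes> inv z \<otimes> n) \<otimes> inv n"
    using * c by (simp add: inv_mult_group m_assoc)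
  moreover have "inv n \<in> N" by (rule N_inv[OF *(2)])
  ultimately show ?thesis unfolding splits_def by blast
qed

lemma p_subgroup_conj_into_S:
  assumes "p_subgroup G p A"
  obtains x where "x \<in> carrier G" "conj_set G A x \<subseteq> S"
  using p_subgroup_conj_into_sylow[OF fin prime_p assms sylow_S] by blast

text \<open>Induction on \<open>|S| - |P|\<close>. Let \<open>P < S\<close> and \<open>P' = P\<^sup>g\<close>. The normalizers \<open>T\<close> of \<open>P\<close> and \<open>T'\<close> of \<open>P'\<close> in
  \<open>S\<close> are strictly larger than \<open>P\<close> and \<open>P'\<close>. Both \<open>T\<close> and \<open>B\<close>, the conjugate of \<open>T'\<close> by \<open>g\<^sup>-\<^sup>1\<close>, are \<open>p\<close>-subgroups
  of \<open>N\<^sub>G(P)\<close>, so they lie in \<open>O\<^sup>p\<^sup>'(N\<^sub>G(P))\<close>, and Sylow's theorem in this group gives an element \<open>o\<close> of it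
  such that \<open>T\<^sup>o\<close> and \<open>B\<close> lie in one \<open>p\<close>-subgroup \<open>U\<close>. Choose \<open>w\<close> with \<open>U\<^sup>w \<le> S\<close>. Then \<open>o w\<close> takes
  \<open>T\<close> into \<open>S\<close> and \<open>g\<^sup>-\<^sup>1 w\<close> takes \<open>T'\<close> into \<open>S\<close>, so both split by induction, on \<open>P\<close> and on \<open>P'\<close> in
  particular. As \<open>o\<close> is a chain with one factor on \<open>P\<close>, the product
  \<open>g = o\<^sup>-\<^sup>1 (o w) (g\<^sup>-\<^sup>1 w)\<^sup>-\<^sup>1\<close> splits on \<open>P\<close>.\<close>

theorem splits_all:
  assumes "sub P" "g \<in> carrier G" "conj_set G P g \<subseteq> S"
  shows "splits P g"
  using assms
proof (induction "card S - card P" arbitrary: P g rule: less_induct)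
  case less
  note P = subD[OF less.prems(1)]
  have subP': "sub (conj_set G P g)" by (rule sub_conj[OF less.prems])
  show ?case
  proof (cases "P = S")
    case True
    then have "g \<in> N" using less.prems conj_set_eq_of_subset[OF fin S(2)] N_iff by blast
    then show ?thesis
      using chain.one[of P] less.prems(2) unfolding splits_def by (metis l_one)
  next
    case False
    define P' where "P' = conj_set G P g"
    define T where "T = S \<inter> normalizer G P"
    define T' where "T' = S \<inter> normalizer G P'"
    note P' = subD[OF subP', folded P'_def]
    have cardP': "card P' = card P" unfolding P'_def using card_conj_set P less.prems by blast
    have P'S: "P' \<subset> S"
      using P'(3) cardP' False P(3) S(4) by (metis card_subset_eq psubsetI)
    have T: "P \<subset> T" "P' \<subset> T'"
      unfolding T_def T'_def using p_subgroup_normalizer_grows[OF fin prime_p S(3)] P(1,3) P'(1) P'S False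
      by (simp_all add: psubset_eq)
    have TS: "subgroup T G" "subgroup T' G" "T \<subseteq> S" "T' \<subseteq> S" "T \<subseteq> carrier G" "T' \<subseteq> carrier G"
      unfolding T_def T'_def using S(1,2) normalizer_imp_subgroup P(4) P'(4)
      by (auto intro!: subgroups_Inter_pair)
    have subT: "sub T" "sub T'"
      using sub_mono[OF less.prems(1) TS(1) _ TS(3)] sub_mono[OF subP'[folded P'_def] TS(2) _ TS(4)] T
      by (simp_all add: less_imp_le)
    have finT: "finite T" "finite T'" using TS(3,4) S(4) finite_subset by blast+
    have cT: "card P < card T" "card P < card T'"
      using psubset_card_mono[OF finT(1) T(1)] psubset_card_mono[OF finT(2) T(2)] cardP' by auto
    have leS: "card T \<le> card S" "card T' \<le> card S" using TS S(4) card_mono by blast+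
    have IH: "splits T h" if "h \<in> carrier G" "conj_set G T h \<subseteq> S" for h
      using less.hyps[OF _ subT(1) that] cT(1) leS(1) by simp
    have IH': "splits T' h" if "h \<in> carrier G" "conj_set G T' h \<subseteq> S" for h
      using less.hyps[OF _ subT(2) that] cT(2) leS(2) by simp
    have gi: "inv g \<in> carrier G" using less.prems by simp
    define B where "B = conj_set G T' (inv g)"
    have O: "subgroup (Opn P) G" by (rule Opn(1)[OF less.prems(1)])
    have pT: "p_subgroup G p T" "p_subgroup G p T'" using TS p_subgroup_sub by blast+
    have pB: "p_subgroup G p B" unfolding B_def by (rule p_subgroup_conj_set[OF pT(2) gi])
    have TO: "T \<subseteq> Opn P" by (rule p_subgroup_le_Op'[OF prime_p P(4) pT(1)]) (simp add: T_def)
    have BO: "B \<subseteq> Opn P"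
    proof (rule p_subgroup_le_Op'[OF prime_p P(4) pB])
      have "conj_set G P' (inv g) = P" unfolding P'_def using conj_set_inv_cancel P less.prems by blast
      then have "inv (inv g) \<otimes> t \<otimes> inv g \<in> normalizer G P" if "t \<in> T'" for t
        using normalizer_conj[OF P'(4) gi, of t] that unfolding T'_def by simp
      then show "B \<subseteq> normalizer G P" unfolding B_def conj_set_def by blast
    qed
    obtain o' U where oU: "o' \<in> Opn P" "p_subgroup G p U" "U \<subseteq> Opn P" "conj_set G T o' \<subseteq> U" "B \<subseteq> U"
      using common_p_overgroup[OF fin prime_p O pT(1) TO pB BO] by blast
    obtain w where w: "w \<in> carrier G" "conj_set G U w \<subseteq> S"
      using p_subgroup_conj_into_S[OF oU(2)] by blast
    have o: "o' \<in> carrier G" "conj_set G P o' = P" "inv o' \<in> Opn P"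
      using Opn(2,3)[OF less.prems(1) oU(1)] subgroup.m_inv_closed[OF O oU(1)] by simp_all
    have Poi: "conj_set G P (inv o') = P" "inv o' \<in> carrier G" using Opn(2,3)[OF less.prems(1) o(3)] by simp_all
    have "conj_set G T (o' \<otimes> w) \<subseteq> S"
      using conj_set_mono[OF oU(4), of w] w(2) conj_set_mult[OF TS(5) o(1) w(1)] by simp
    then have "splits T (o' \<otimes> w)" using IH o w by simp
    then have "splits P (o' \<otimes> w)" using splits_antimono T by blast
    moreover have "splits P (inv o')" using splits_chain chain_single[OF less.prems(1) subset_refl o(3)] by blast
    ultimately have "splits P (inv o' \<otimes> (o' \<otimes> w))" using splits_mult P(3) Poi by simp
    then have sw: "splits P w" using o w by (simp add: m_assoc[symmetric])
    have giw: "inv g \<otimes> w \<in> carrier G" using gi w by simp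
    have "conj_set G T' (inv g \<otimes> w) \<subseteq> S"
      using conj_set_mono[OF oU(5), of w] w(2) conj_set_mult[OF TS(6) gi w(1)] unfolding B_def by simp
    then have "splits T' (inv g \<otimes> w)" using IH' giw by blast
    then have "splits P' (inv g \<otimes> w)" using splits_antimono T by blast
    then have "splits (conj_set G P' (inv g \<otimes> w)) (inv (inv g \<otimes> w))" using splits_inv P' by blast
    moreover have "conj_set G P' (inv g \<otimes> w) = conj_set G P w"
      unfolding P'_def using conj_set_mult P(4) less.prems(2) giw w by (simp add: m_assoc[symmetric])
    moreover have "inv (inv g \<otimes> w) = inv w \<otimes> g" using less.prems(2) w by (simp add: inv_mult_group)
    ultimately have "splits P (w \<otimes> (inv w \<otimes> g))" using splits_mult[OF sw _ P(3)] by simp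
    then show ?thesis using less.prems(2) w by (simp add: m_assoc[symmetric])
  qed
qed

section \<open>The class of an element in N/K\<close>

abbreviation Gam where "Gam \<equiv> norm_grp G S Mod K"

lemma Gam_group: "group Gam"
  using normal.factorgroup_is_group[OF K_normal] .

text \<open>The class in \<open>N/K\<close> of the map that \<open>g\<close> induces on \<open>P\<close>. Every splitting of \<open>g\<close> on \<open>P\<close> gives the same
  coset, so the choice does not matter.\<close>

definition theta :: "'a set \<Rightarrow> 'a \<Rightarrow> 'a set" where
  "theta P g = K #>\<^bsub>norm_grp G S\<^esub> (SOME n. n \<in> N \<and> (\<exists>z. chain P z \<and> g = z \<otimes> n))"

text \<open>If \<open>z n = y n'\<close> are two splittings on \<open>P\<close>, then \<open>n' n\<^sup>-\<^sup>1 = y\<^sup>-\<^sup>1 z\<close> is a chain on \<open>P\<^sup>y\<close> and lies in \<open>N\<close>,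
  hence in \<open>K\<close>.\<close>

lemma theta_eq:
  assumes P: "sub P" and z: "chain P z" "n \<in> N"
  shows "theta P (z \<otimes> n) = K #>\<^bsub>norm_grp G S\<^esub> n"
proof -
  interpret N: group "norm_grp G S" by (rule group_norm_grp[OF S(2)])
  define n' where "n' = (SOME m. m \<in> N \<and> (\<exists>y. chain P y \<and> z \<otimes> n = y \<otimes> m))"
  have "n' \<in> N \<and> (\<exists>y. chain P y \<and> z \<otimes> n = y \<otimes> n')"
    unfolding n'_def by (rule someI_ex) (use z in blast)
  then obtain y where y: "n' \<in> N" "chain P y" "z \<otimes> n = y \<otimes> n'" by blast
  have c: "z \<in> carrier G" "y \<in> carrier G" "n \<in> carrier G" "n' \<in> carrier G"
    using y z chain_carrier N_carrier by auto
  note PS = subD(3)[OF P]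
  have "chain (conj_set G (conj_set G P y) (inv y)) z"
    using z(1) conj_set_inv_cancel(1)[OF subD(4)[OF P] c(2)] by simp
  then have ch: "chain (conj_set G P y) (inv y \<otimes> z)"
    by (rule chain_mult[OF _ chain_inv[OF y(2) PS] chain_conj[OF y(2) PS]])
  have "inv y \<otimes> z = inv y \<otimes> ((z \<otimes> n) \<otimes> inv n)" using c by (simp add: m_assoc)
  also have "\<dots> = n' \<otimes> inv n" unfolding y(3) using c by (simp add: m_assoc[symmetric])
  finally have eq: "inv y \<otimes> z = n' \<otimes> inv n" .
  have nin: "n' \<otimes> inv n \<in> N" by (rule N_mult[OF y(1) N_inv[OF z(2)]])
  have "n' \<otimes> inv n \<in> K"
    using chain_in_K[OF sub_conj[OF P c(2) chain_conj[OF y(2) PS]] ch] eq nin by simp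
  then have "K #>\<^bsub>norm_grp G S\<^esub> (n' \<otimes>\<^bsub>norm_grp G S\<^esub> inv\<^bsub>norm_grp G S\<^esub> n) = K"
    using N.coset_join2[OF _ normal_imp_subgroup[OF K_normal]] nin norm_grp_inv[OF S(2) z(2)] by simp
  then have "K #>\<^bsub>norm_grp G S\<^esub> n' = K #>\<^bsub>norm_grp G S\<^esub> n"
    using N.coset_mult_inv1[of K n' n] y(1) z(2) subgroup.subset[OF normal_imp_subgroup[OF K_normal]] by simp
  then show ?thesis unfolding theta_def n'_def by simp
qed

lemma theta_closed:
  assumes "sub P" "g \<in> carrier G" "conj_set G P g \<subseteq> S"
  shows "theta P g \<in> carrier Gam"
proof -
  obtain z n where "chain P z" "n \<in> N" "g = z \<otimes> n"
    using splits_all[OF assms] unfolding splits_def by blast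
  then show ?thesis using theta_eq[OF assms(1)] by (auto simp: FactGroup_def RCOSETS_def)
qed

lemma theta_mono:
  assumes "sub P" "sub Q" "P \<subseteq> Q" "g \<in> carrier G" "conj_set G Q g \<subseteq> S"
  shows "theta P g = theta Q g"
proof -
  obtain z n where "chain Q z" "n \<in> N" "g = z \<otimes> n"
    using splits_all[OF assms(2,4,5)] unfolding splits_def by blast
  then show ?thesis using theta_eq assms chain_antimono by metis
qed

lemma theta_mult:
  assumes P: "sub P" "g \<in> carrier G" "conj_set G P g \<subseteq> S"
    and h: "h \<in> carrier G" "conj_set G P (g \<otimes> h) \<subseteq> S"
  shows "theta P (g \<otimes> h) = theta P g \<otimes>\<^bsub>Gam\<^esub> theta (conj_set G P g) h"
proof -
  have cm: "conj_set G (conj_set G P g) h = conj_set G P (g \<otimes> h)"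
    by (rule conj_set_mult[OF subD(4)[OF P(1)] P(2) h(1)])
  have sP: "sub (conj_set G P g)" by (rule sub_conj[OF P])
  obtain z n z' n' where *: "chain P z" "n \<in> N" "g = z \<otimes> n" "chain (conj_set G P g) z'" "n' \<in> N" "h = z' \<otimes> n'"
    using splits_all[OF P] splits_all[OF sP h(1)] h(2) cm unfolding splits_def by metis
  note sm = split_mult[OF subD(3)[OF P(1)] *(1,2) *(4)[unfolded *(3)] *(5)]
  have "theta P (g \<otimes> h) = K #>\<^bsub>norm_grp G S\<^esub> (n \<otimes> n')"
    using theta_eq[OF P(1) sm(1,2)] sm(3) *(3,6) by simp
  also have "\<dots> = (K #>\<^bsub>norm_grp G S\<^esub> n) \<otimes>\<^bsub>Gam\<^esub> (K #>\<^bsub>norm_grp G S\<^esub> n')"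
    using normal.rcos_sum[OF K_normal, of n n'] *(2,5) by (simp add: FactGroup_def)
  also have "\<dots> = theta P g \<otimes>\<^bsub>Gam\<^esub> theta (conj_set G P g) h"
    using theta_eq[OF P(1) *(1,2)] theta_eq[OF sP *(4,5)] *(3,6) by simp
  finally show ?thesis .
qed

lemma theta_N:
  assumes "sub P" "n \<in> N"
  shows "theta P n = K #>\<^bsub>norm_grp G S\<^esub> n"
  using theta_eq[OF assms(1) chain.one assms(2)] N_carrier[OF assms(2)] by simp

lemma theta_chain:
  assumes "sub P" "chain P z"
  shows "theta P z = \<one>\<^bsub>Gam\<^esub>"
proof -
  interpret N: group "norm_grp G S" by (rule group_norm_grp[OF S(2)])
  have "theta P z = K #>\<^bsub>norm_grp G S\<^esub> \<one>"
    using theta_eq[OF assms subgroup.one_closed[OF N_subgroup]] chain_carrier[OF assms(2)] by simp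
  also have "\<dots> = K"
    using N.coset_mult_one[OF subgroup.subset[OF normal_imp_subgroup[OF K_normal]]] by simp
  finally show ?thesis by (simp add: FactGroup_def)
qed

end

section \<open>Homotopy of paths in abstract topologies\<close>

abbreviation unit_interval where "unit_interval \<equiv> top_of_set {0..1::real}"

definition path_between :: "'a topology \<Rightarrow> 'a \<Rightarrow> 'a \<Rightarrow> (real \<Rightarrow> 'a) \<Rightarrow> bool" where
  "path_between X a b \<gamma> \<longleftrightarrow> pathin X \<gamma> \<and> \<gamma> 0 = a \<and> \<gamma> 1 = b"

definition path_homotopic :: "'a topology \<Rightarrow> (real \<Rightarrow> 'a) \<Rightarrow> (real \<Rightarrow> 'a) \<Rightarrow> bool" where
  "path_homotopic X \<gamma> \<delta> \<longleftrightarrow>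
     homotopic_with (\<lambda>\<eta>. \<eta> 0 = \<gamma> 0 \<and> \<eta> 1 = \<gamma> 1) unit_interval X \<gamma> \<delta>"

definition path_rev :: "(real \<Rightarrow> 'a) \<Rightarrow> real \<Rightarrow> 'a" where
  "path_rev \<gamma> = (\<lambda>s. \<gamma> (1 - s))"

notation path_join (infixr "\<star>" 75)

lemma path_betweenD:
  "path_between X a b \<gamma> \<Longrightarrow> continuous_map unit_interval X \<gamma>"
  "path_between X a b \<gamma> \<Longrightarrow> \<gamma> 0 = a" "path_between X a b \<gamma> \<Longrightarrow> \<gamma> 1 = b"
  by (simp_all add: path_between_def pathin_def)

lemma path_between_topspace:
  assumes "path_between X a b \<gamma>"
  shows "a \<in> topspace X" "b \<in> topspace X" "s \<in> {0..1} \<Longrightarrow> \<gamma> s \<in> topspace X"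
proof -
  have *: "s \<in> {0..1} \<Longrightarrow> \<gamma> s \<in> topspace X" for s
    using path_betweenD(1)[OF assms] by (auto simp: continuous_map_def Pi_def)
  show "a \<in> topspace X" "b \<in> topspace X" "s \<in> {0..1} \<Longrightarrow> \<gamma> s \<in> topspace X"
    using *[of 0] *[of 1] * assms by (auto simp: path_between_def)
qed

lemma path_homotopic_ends:
  assumes "path_homotopic X \<gamma> \<delta>"
  shows "\<delta> 0 = \<gamma> 0" "\<delta> 1 = \<gamma> 1"
  using homotopic_with_imp_property[OF assms[unfolded path_homotopic_def]] by simp_all

lemma path_homotopic_pathin:
  assumes "path_homotopic X \<gamma> \<delta>"
  shows "pathin X \<gamma>" "pathin X \<delta>"
  using homotopic_with_imp_continuous_maps[OF assms[unfolded path_homotopic_def]]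
  by (simp_all add: pathin_def)

lemma path_homotopic_between:
  "path_homotopic X \<gamma> \<delta> \<Longrightarrow> path_between X a b \<delta> \<longleftrightarrow> path_between X a b \<gamma>"
  using path_homotopic_ends[of X \<gamma> \<delta>] path_homotopic_pathin[of X \<gamma> \<delta>] by (simp add: path_between_def)

lemma path_homotopic_refl: "path_between X a b \<gamma> \<Longrightarrow> path_homotopic X \<gamma> \<gamma>"
  unfolding path_homotopic_def path_between_def pathin_def by simp

lemma path_homotopic_sym: "path_homotopic X \<gamma> \<delta> \<Longrightarrow> path_homotopic X \<delta> \<gamma>"
  using path_homotopic_ends[of X \<gamma> \<delta>] by (simp add: path_homotopic_def homotopic_with_symD)

lemma path_homotopic_trans [trans]:
  assumes "path_homotopic X \<gamma> \<delta>" "path_homotopic X \<delta> \<epsilon>"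
  shows "path_homotopic X \<gamma> \<epsilon>"
  using assms path_homotopic_ends[OF assms(1)] unfolding path_homotopic_def
  by (simp add: homotopic_with_trans[where g = \<delta>])

lemma path_homotopic_eqI:
  assumes "path_between X a b \<gamma>" "\<And>s. 0 \<le> s \<Longrightarrow> s \<le> 1 \<Longrightarrow> \<delta> s = \<gamma> s"
  shows "path_homotopic X \<gamma> \<delta>"
  unfolding path_homotopic_def using assms
  by (intro homotopic_with_equal) (auto simp: path_between_def pathin_def)

lemma path_homotopic_compose:
  assumes "path_homotopic X \<gamma> \<delta>" "continuous_map X Y f"
  shows "path_homotopic Y (f \<circ> \<gamma>) (f \<circ> \<delta>)"
  using assms unfolding path_homotopic_def
  by (intro homotopic_with_compose_continuous_map_left[where p = "\<lambda>\<eta>. \<eta> 0 = \<gamma> 0 \<and> \<eta> 1 = \<gamma> 1"]) auto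

lemma path_homotopic_euclidean: "path_homotopic (top_of_set S) p q \<longleftrightarrow> homotopic_paths S p q"
  by (simp add: path_homotopic_def homotopic_paths_def pathstart_def pathfinish_def)

lemma path_homotopic_via_convex:
  fixes S :: "'a::real_normed_vector set"
  assumes f: "continuous_map (top_of_set S) X f" and S: "convex S"
    and p: "continuous_on {0..1} p" "p ` {0..1} \<subseteq> S" and q: "continuous_on {0..1} q" "q ` {0..1} \<subseteq> S"
    and eq: "p 0 = q 0" "p 1 = q 1"
  shows "path_homotopic X (f \<circ> p) (f \<circ> q)"
proof -
  have "homotopic_paths S p q"
  proof (rule homotopic_paths_linear)
    show "path p" "path q" using p q by (auto simp: path_def)
    show "pathstart q = pathstart p" "pathfinish q = pathfinish p"
      using eq by (auto simp: pathstart_def pathfinish_def)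
    fix t :: real assume "t \<in> {0..1}"
    then show "closed_segment (p t) (q t) \<subseteq> S"
      using p(2) q(2) S by (intro closed_segment_subset) auto
  qed
  then show ?thesis
    using path_homotopic_compose[OF _ f] path_homotopic_euclidean by blast
qed

lemma path_homotopic_reparam:
  assumes "path_between X a b \<gamma>"
    and "continuous_on {0..1} \<phi>" "\<phi> ` {0..1} \<subseteq> {0..1}" "continuous_on {0..1} \<psi>" "\<psi> ` {0..1} \<subseteq> {0..1}"
    and "\<phi> 0 = \<psi> 0" "\<phi> 1 = \<psi> 1"
  shows "path_homotopic X (\<gamma> \<circ> \<phi>) (\<gamma> \<circ> \<psi>)"
  using path_homotopic_via_convex[OF path_betweenD(1)[OF assms(1)] _ assms(2-7)] by simp

lemma path_between_reparam:
  assumes "path_between X a b \<gamma>" "continuous_on {0..1} \<phi>" "\<phi> ` {0..1} \<subseteq> {0..1}"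
  shows "path_between X (\<gamma> (\<phi> 0)) (\<gamma> (\<phi> 1)) (\<gamma> \<circ> \<phi>)"
  using path_homotopic_pathin(1)[OF path_homotopic_reparam[OF assms(1) assms(2,3) assms(2,3)]]
  by (simp add: path_between_def)

lemma path_between_rev: "path_between X a b \<gamma> \<Longrightarrow> path_between X b a (path_rev \<gamma>)"
  using path_between_reparam[of X a b \<gamma> "\<lambda>s. 1 - s"]
  by (auto simp: path_rev_def o_def path_between_def continuous_intros)

lemma path_between_const: "a \<in> topspace X \<Longrightarrow> path_between X a a (\<lambda>s. a)"
  by (simp add: path_between_def pathin_def)

text \<open>Continuity of a concatenation in the path parameter and in a further parameter in \<open>Z\<close>, which is the
  homotopy parameter below.\<close>

lemma continuous_map_join_aux:
  assumes h: "continuous_map (prod_topology Z unit_interval) X h"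
    and k: "continuous_map (prod_topology Z unit_interval) X k"
    and eq: "\<And>z. z \<in> topspace Z \<Longrightarrow> h (z, 1) = k (z, 0)"
  shows "continuous_map (prod_topology Z unit_interval) X
           (\<lambda>x. if snd x \<le> 1/2 then h (fst x, 2 * snd x) else k (fst x, 2 * snd x - 1))"
proof (rule continuous_map_cases_le)
  let ?Y = "prod_topology Z unit_interval"
  have snd: "continuous_map ?Y euclideanreal snd"
    using continuous_map_snd[of Z unit_interval] continuous_map_in_subtopology by blast
  show "continuous_map ?Y euclideanreal snd" by (rule snd)
  show "continuous_map ?Y euclideanreal (\<lambda>x. 1/2)" by simp
  have sndA: "continuous_map (subtopology ?Y A) euclideanreal snd" for A
    by (rule continuous_map_from_subtopology[OF snd])
  have fstA: "continuous_map (subtopology ?Y A) Z fst" for A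
    by (rule continuous_map_from_subtopology[OF continuous_map_fst])
  let ?A = "{x \<in> topspace ?Y. snd x \<le> 1 / 2}" and ?B = "{x \<in> topspace ?Y. 1 / 2 \<le> snd x}"
  have "continuous_map (subtopology ?Y ?A) ?Y (\<lambda>x. (fst x, 2 * snd x))"
    unfolding continuous_map_paired
    by (intro conjI fstA continuous_map_into_subtopology continuous_map_real_mult sndA)
       (auto simp: continuous_map_const)
  from continuous_map_compose[OF this h]
  show "continuous_map (subtopology ?Y ?A) X (\<lambda>x. h (fst x, 2 * snd x))" by (simp add: o_def)
  have "continuous_map (subtopology ?Y ?B) ?Y (\<lambda>x. (fst x, 2 * snd x - 1))"
    unfolding continuous_map_paired
    by (intro conjI fstA continuous_map_into_subtopology continuous_map_diff continuous_map_real_mult sndA)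
       (auto simp: continuous_map_const)
  from continuous_map_compose[OF this k]
  show "continuous_map (subtopology ?Y ?B) X (\<lambda>x. k (fst x, 2 * snd x - 1))" by (simp add: o_def)
  show "h (fst x, 2 * snd x) = k (fst x, 2 * snd x - 1)" if "x \<in> topspace ?Y" "snd x = 1/2" for x
    using that(1) eq[of "fst x"] unfolding that(2) by (simp add: mem_Times_iff)
qed

lemma path_homotopic_join:
  assumes "path_homotopic X \<gamma> \<gamma>'" "path_homotopic X \<delta> \<delta>'" "\<gamma> 1 = \<delta> 0"
  shows "path_homotopic X (\<gamma> \<star> \<delta>) (\<gamma>' \<star> \<delta>')"
proof -
  obtain h where h: "continuous_map (prod_topology unit_interval unit_interval) X h"
    "\<And>s. h (0, s) = \<gamma> s" "\<And>s. h (1, s) = \<gamma>' s" "\<And>t. t \<in> {0..1} \<Longrightarrow> h (t, 0) = \<gamma> 0 \<and> h (t, 1) = \<gamma> 1"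
    using assms(1) unfolding path_homotopic_def homotopic_with_def by blast
  obtain k where k: "continuous_map (prod_topology unit_interval unit_interval) X k"
    "\<And>s. k (0, s) = \<delta> s" "\<And>s. k (1, s) = \<delta>' s" "\<And>t. t \<in> {0..1} \<Longrightarrow> k (t, 0) = \<delta> 0 \<and> k (t, 1) = \<delta> 1"
    using assms(2) unfolding path_homotopic_def homotopic_with_def by blast
  have c: "continuous_map (prod_topology unit_interval unit_interval) X
           (\<lambda>x. if snd x \<le> 1/2 then h (fst x, 2 * snd x) else k (fst x, 2 * snd x - 1))"
    by (rule continuous_map_join_aux[OF h(1) k(1)]) (use h(4) k(4) assms(3) in auto)
  show ?thesis
    unfolding path_homotopic_def homotopic_with_def
    by (rule exI[of _ "\<lambda>x. if snd x \<le> 1/2 then h (fst x, 2 * snd x) else k (fst x, 2 * snd x - 1)"])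
       (use c h k in \<open>auto simp: path_join_def fun_eq_iff\<close>)
qed

lemma path_between_join:
  assumes "path_between X a b \<gamma>" "path_between X b c \<delta>"
  shows "path_between X a c (\<gamma> \<star> \<delta>)"
proof -
  have "path_homotopic X (\<gamma> \<star> \<delta>) (\<gamma> \<star> \<delta>)"
    using path_homotopic_join[OF path_homotopic_refl[OF assms(1)] path_homotopic_refl[OF assms(2)]]
      path_betweenD assms by metis
  then show ?thesis
    using path_homotopic_pathin(1) path_betweenD(2)[OF assms(1)] path_betweenD(3)[OF assms(2)]
    by (auto simp: path_between_def path_join_def)
qed

lemma path_homotopic_reparamI:
  assumes "path_between X a b \<gamma>"
    and "continuous_on {0..1} \<psi>" "\<And>s. 0 \<le> s \<Longrightarrow> s \<le> 1 \<Longrightarrow> 0 \<le> \<psi> s \<and> \<psi> s \<le> 1" "\<psi> 0 = 0" "\<psi> 1 = 1"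
    and "\<And>s. 0 \<le> s \<Longrightarrow> s \<le> 1 \<Longrightarrow> \<delta> s = \<gamma> (\<psi> s)"
  shows "path_homotopic X \<gamma> \<delta>"
proof -
  have im: "\<psi> ` {0..1} \<subseteq> {0..1}" using assms(3) by auto
  have "path_homotopic X (\<gamma> \<circ> (\<lambda>s. s)) (\<gamma> \<circ> \<psi>)"
    by (rule path_homotopic_reparam[OF assms(1) _ _ assms(2) im]) (use assms(4,5) in auto)
  also have "path_homotopic X (\<gamma> \<circ> \<psi>) \<delta>"
    by (rule path_homotopic_eqI[OF path_between_reparam[OF assms(1,2) im]]) (use assms(6) in auto)
  finally show ?thesis by (simp add: o_def)
qed

lemma path_homotopic_assoc:
  assumes "path_between X a b \<alpha>" "path_between X b c \<beta>" "path_between X c d \<gamma>"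
  shows "path_homotopic X ((\<alpha> \<star> \<beta>) \<star> \<gamma>) (\<alpha> \<star> (\<beta> \<star> \<gamma>))"
proof (rule path_homotopic_reparamI)
  \<comment> \<open>The piecewise linear reparametrization that takes the breakpoints \<open>1/2\<close> and \<open>3/4\<close> to \<open>1/4\<close> and \<open>1/2\<close>;
    being convex, it is the maximum of its three linear pieces.\<close>
  let ?\<psi> = "\<lambda>s :: real. max (s / 2) (max (s - 1/4) (2 * s - 1))"
  show "path_between X a d ((\<alpha> \<star> \<beta>) \<star> \<gamma>)" using assms path_between_join by metis
  show "continuous_on {0..1} ?\<psi>" by (intro continuous_intros) simp
  show "0 \<le> ?\<psi> s \<and> ?\<psi> s \<le> 1" if "0 \<le> s" "s \<le> 1" for s
    using that by (auto simp: max_def)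
  have "?\<psi> s = (if s \<le> 1/2 then s/2 else if s \<le> 3/4 then s - 1/4 else 2 * s - 1)" for s
    by (auto simp: max_def field_simps)
  then show "(\<alpha> \<star> (\<beta> \<star> \<gamma>)) s = ((\<alpha> \<star> \<beta>) \<star> \<gamma>) (?\<psi> s)" for s
    by (auto simp: path_join_def field_simps) (simp add: diff_divide_distrib mult.commute)
qed auto

lemma path_homotopic_const_right:
  assumes "path_between X a b \<gamma>"
  shows "path_homotopic X (\<gamma> \<star> (\<lambda>s. b)) \<gamma>"
proof (rule path_homotopic_sym[OF path_homotopic_reparamI[OF assms]])
  show "continuous_on {0..1} (\<lambda>s::real. min (2 * s) 1)" by (intro continuous_intros)
  show "(\<gamma> \<star> (\<lambda>s. b)) s = \<gamma> (min (2 * s) 1)" for s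
    using assms by (auto simp: path_join_def path_between_def min_def)
qed auto

lemma path_homotopic_const_left:
  assumes "path_between X a b \<gamma>"
  shows "path_homotopic X ((\<lambda>s. a) \<star> \<gamma>) \<gamma>"
proof (rule path_homotopic_sym[OF path_homotopic_reparamI[OF assms]])
  show "continuous_on {0..1} (\<lambda>s::real. max (2 * s - 1) 0)" by (intro continuous_intros)
  show "((\<lambda>s. a) \<star> \<gamma>) s = \<gamma> (max (2 * s - 1) 0)" for s
    using assms by (auto simp: path_join_def path_between_def max_def)
qed auto

lemma path_homotopic_rev_right:
  assumes "path_between X a b \<gamma>"
  shows "path_homotopic X (\<gamma> \<star> path_rev \<gamma>) (\<lambda>s. a)"
proof -
  let ?\<psi> = "\<lambda>s::real. min (2 * s) (2 - 2 * s)"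
  have c: "continuous_on {0..1} ?\<psi>" by (intro continuous_intros)
  have im: "?\<psi> ` {0..1} \<subseteq> {0..1}" by auto
  have "path_homotopic X (\<gamma> \<circ> (\<lambda>s. 0)) (\<gamma> \<circ> ?\<psi>)"
    by (rule path_homotopic_reparam[OF assms _ _ c im]) auto
  also have "path_homotopic X (\<gamma> \<circ> ?\<psi>) (\<gamma> \<star> path_rev \<gamma>)"
    by (rule path_homotopic_eqI[OF path_between_reparam[OF assms c im]])
       (use assms in \<open>auto simp: path_join_def path_rev_def path_between_def min_def\<close>)
  finally show ?thesis using path_homotopic_sym assms by (simp add: o_def path_between_def)
qed

lemma path_homotopic_cong_right:
  assumes "path_between X a b \<gamma>" "path_between X b c \<delta>" "path_homotopic X \<delta> \<delta>'"
  shows "path_homotopic X (\<gamma> \<star> \<delta>) (\<gamma> \<star> \<delta>')"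
  using path_homotopic_join[OF path_homotopic_refl[OF assms(1)] assms(3)] assms path_betweenD by metis

lemma path_homotopic_cong_left:
  assumes "path_between X a b \<gamma>" "path_between X b c \<delta>" "path_homotopic X \<gamma> \<gamma>'"
  shows "path_homotopic X (\<gamma> \<star> \<delta>) (\<gamma>' \<star> \<delta>)"
  using path_homotopic_join[OF assms(3) path_homotopic_refl[OF assms(2)]] assms path_betweenD by metis

lemma path_homotopic_cancel:
  assumes "path_between X a b \<gamma>" "path_between X a c \<delta>"
  shows "path_homotopic X (\<gamma> \<star> (path_rev \<gamma> \<star> \<delta>)) \<delta>"
proof -
  note r = path_between_rev[OF assms(1)]
  have "path_homotopic X (\<gamma> \<star> (path_rev \<gamma> \<star> \<delta>)) ((\<gamma> \<star> path_rev \<gamma>) \<star> \<delta>)"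
    by (rule path_homotopic_sym[OF path_homotopic_assoc[OF assms(1) r assms(2)]])
  also have "path_homotopic X ((\<gamma> \<star> path_rev \<gamma>) \<star> \<delta>) ((\<lambda>s. a) \<star> \<delta>)"
    by (rule path_homotopic_cong_left[OF path_between_join[OF assms(1) r] assms(2) path_homotopic_rev_right[OF assms(1)]])
  also have "path_homotopic X ((\<lambda>s. a) \<star> \<delta>) \<delta>" by (rule path_homotopic_const_left[OF assms(2)])
  finally show ?thesis .
qed

section \<open>The fundamental group\<close>

locale pointed_space =
  fixes X :: "'a topology" and x0 :: 'a
  assumes x0: "x0 \<in> topspace X"
begin

abbreviation loop where "loop \<equiv> path_between X x0 x0"
abbreviation pi1 where "pi1 \<equiv> fundamental_group X x0"
definition cls where "cls \<gamma> = loop_homotopy X x0 `` {\<gamma>}"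

lemma based_loops_iff: "\<gamma> \<in> based_loops X x0 \<longleftrightarrow> loop \<gamma>"
  by (auto simp: based_loops_def path_between_def)

lemma loop_homotopy_iff: "(\<gamma>, \<delta>) \<in> loop_homotopy X x0 \<longleftrightarrow> loop \<gamma> \<and> path_homotopic X \<gamma> \<delta>"
proof
  assume *: "(\<gamma>, \<delta>) \<in> loop_homotopy X x0"
  then have h: "homotopic_with (\<lambda>\<eta>. \<eta> 0 = x0 \<and> \<eta> 1 = x0) unit_interval X \<gamma> \<delta>"
    by (simp add: loop_homotopy_def)
  then have "loop \<gamma>"
    using homotopic_with_imp_property[OF h] homotopic_with_imp_continuous_maps[OF h]
    by (simp add: path_between_def pathin_def)
  then show "loop \<gamma> \<and> path_homotopic X \<gamma> \<delta>"
    using * unfolding loop_homotopy_def path_homotopic_def by (simp add: path_between_def)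
next
  assume "loop \<gamma> \<and> path_homotopic X \<gamma> \<delta>"
  then show "(\<gamma>, \<delta>) \<in> loop_homotopy X x0"
    unfolding loop_homotopy_def path_homotopic_def by (auto simp: path_between_def)
qed

lemma in_cls_iff: "\<delta> \<in> cls \<gamma> \<longleftrightarrow> loop \<gamma> \<and> path_homotopic X \<gamma> \<delta>"
  by (simp add: cls_def loop_homotopy_iff)

lemma cls_eq_iff: "loop \<gamma> \<Longrightarrow> loop \<delta> \<Longrightarrow> cls \<gamma> = cls \<delta> \<longleftrightarrow> path_homotopic X \<gamma> \<delta>"
  unfolding set_eq_iff in_cls_iff
  using path_homotopic_refl path_homotopic_sym path_homotopic_trans by metis

lemma carrier_pi1: "carrier pi1 = {cls \<gamma> |\<gamma>. loop \<gamma>}"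
  by (auto simp: fundamental_group_def quotient_def based_loops_iff cls_def)

lemma cls_closed: "loop \<gamma> \<Longrightarrow> cls \<gamma> \<in> carrier pi1"
  unfolding carrier_pi1 by blast

lemma one_pi1: "\<one>\<^bsub>pi1\<^esub> = cls (\<lambda>s. x0)"
  by (simp add: fundamental_group_def cls_def)

lemma mult_pi1:
  assumes "loop \<alpha>" "loop \<beta>"
  shows "cls \<alpha> \<otimes>\<^bsub>pi1\<^esub> cls \<beta> = cls (\<beta> \<star> \<alpha>)"
proof -
  have "cls (\<beta>' \<star> \<alpha>') = cls (\<beta> \<star> \<alpha>)" if "\<alpha>' \<in> cls \<alpha>" "\<beta>' \<in> cls \<beta>" for \<alpha>' \<beta>'
  proof -
    have h: "path_homotopic X \<alpha> \<alpha>'" "path_homotopic X \<beta> \<beta>'" using that by (auto simp: in_cls_iff)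
    then have l: "loop \<alpha>'" "loop \<beta>'" using assms path_homotopic_between by metis+
    have "path_homotopic X (\<beta> \<star> \<alpha>) (\<beta>' \<star> \<alpha>')"
      using path_homotopic_join[OF h(2,1)] assms by (simp add: path_between_def)
    then show ?thesis
      using cls_eq_iff[OF path_between_join[OF assms(2,1)] path_between_join[OF l(2,1)]] by simp
  qed
  then have "(\<Union>\<beta>'\<in>cls \<beta>. cls (\<beta>' \<star> \<alpha>')) = (\<Union>\<beta>'\<in>cls \<beta>. cls (\<beta> \<star> \<alpha>))" if "\<alpha>' \<in> cls \<alpha>" for \<alpha>'
    using that by (intro SUP_cong refl)
  moreover have "\<alpha> \<in> cls \<alpha>" "\<beta> \<in> cls \<beta>"
    using assms path_homotopic_refl by (auto simp: in_cls_iff)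
  ultimately have "(\<Union>\<alpha>'\<in>cls \<alpha>. \<Union>\<beta>'\<in>cls \<beta>. cls (\<beta>' \<star> \<alpha>')) = cls (\<beta> \<star> \<alpha>)"
    by (simp add: ex_in_conv[symmetric]) blast
  then show ?thesis by (simp add: fundamental_group_def cls_def)
qed

lemma group_pi1: "group pi1"
proof (rule groupI)
  note c = path_between_const[OF x0]
  show "\<one>\<^bsub>pi1\<^esub> \<in> carrier pi1" unfolding one_pi1 by (rule cls_closed[OF c])
  fix x assume "x \<in> carrier pi1"
  then obtain \<alpha> where a: "loop \<alpha>" "x = cls \<alpha>" by (auto simp: carrier_pi1)
  show "\<one>\<^bsub>pi1\<^esub> \<otimes>\<^bsub>pi1\<^esub> x = x"
    unfolding one_pi1 a(2) mult_pi1[OF c a(1)]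
    using cls_eq_iff[OF path_between_join[OF a(1) c] a(1)] path_homotopic_const_right[OF a(1)] by simp
  show "\<exists>y\<in>carrier pi1. y \<otimes>\<^bsub>pi1\<^esub> x = \<one>\<^bsub>pi1\<^esub>"
  proof
    note r = path_between_rev[OF a(1)]
    show "cls (path_rev \<alpha>) \<in> carrier pi1" by (rule cls_closed[OF r])
    show "cls (path_rev \<alpha>) \<otimes>\<^bsub>pi1\<^esub> x = \<one>\<^bsub>pi1\<^esub>"
      unfolding one_pi1 a(2) mult_pi1[OF r a(1)]
      using cls_eq_iff[OF path_between_join[OF a(1) r] c] path_homotopic_rev_right[OF a(1)] by simp
  qed
  fix y assume "y \<in> carrier pi1"
  then obtain \<beta> where b: "loop \<beta>" "y = cls \<beta>" by (auto simp: carrier_pi1)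
  show "x \<otimes>\<^bsub>pi1\<^esub> y \<in> carrier pi1"
    unfolding a(2) b(2) mult_pi1[OF a(1) b(1)] by (rule cls_closed[OF path_between_join[OF b(1) a(1)]])
  fix z assume "z \<in> carrier pi1"
  then obtain \<gamma> where g: "loop \<gamma>" "z = cls \<gamma>" by (auto simp: carrier_pi1)
  show "x \<otimes>\<^bsub>pi1\<^esub> y \<otimes>\<^bsub>pi1\<^esub> z = x \<otimes>\<^bsub>pi1\<^esub> (y \<otimes>\<^bsub>pi1\<^esub> z)"
  proof -
    note ba = path_between_join[OF b(1) a(1)] and gb = path_between_join[OF g(1) b(1)]
    have "cls (\<gamma> \<star> (\<beta> \<star> \<alpha>)) = cls ((\<gamma> \<star> \<beta>) \<star> \<alpha>)"
      unfolding cls_eq_iff[OF path_between_join[OF g(1) ba] path_between_join[OF gb a(1)]]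
      by (rule path_homotopic_sym[OF path_homotopic_assoc[OF g(1) b(1) a(1)]])
    then show ?thesis
      unfolding a(2) b(2) g(2) mult_pi1[OF a(1) b(1)] mult_pi1[OF b(1) g(1)]
        mult_pi1[OF ba g(1)] mult_pi1[OF a(1) gb] .
  qed
qed

sublocale pi1: group pi1 by (rule group_pi1)

definition joined where "joined y \<longleftrightarrow> (\<exists>\<gamma>. path_between X y x0 \<gamma>)"

text \<open>A chosen path to the base point. The constant path is chosen at the base point itself, so that
  closing up a loop does not change its class.\<close>

definition tail where
  "tail y = (if y = x0 then (\<lambda>s. x0) else (SOME \<gamma>. path_between X y x0 \<gamma>))"

lemma tail: "joined y \<Longrightarrow> path_between X y x0 (tail y)"
  unfolding tail_def joined_def using path_between_const[OF x0] someI_ex[of "path_between X y x0"]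
  by (cases "y = x0") auto

lemma joined_base: "joined x0"
  unfolding joined_def using path_between_const[OF x0] by blast

lemma joined_path: "path_between X a b \<gamma> \<Longrightarrow> joined a \<longleftrightarrow> joined b"
  unfolding joined_def using path_between_join path_between_rev by metis

text \<open>Closing up paths with the chosen tails represents the fundamental groupoid in the fundamental
  group: concatenation becomes multiplication, in the opposite order.\<close>

definition path_class :: "(real \<Rightarrow> 'a) \<Rightarrow> (real \<Rightarrow> 'a) set" where
  "path_class \<gamma> = cls (path_rev (tail (\<gamma> 0)) \<star> (\<gamma> \<star> tail (\<gamma> 1)))"

lemma path_class_loop_aux:
  assumes "path_between X a b \<gamma>" "joined a"
  shows "loop (path_rev (tail a) \<star> (\<gamma> \<star> tail b))"
  using assms joined_path tail path_between_rev path_between_join by metis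

lemma path_class_closed: "path_between X a b \<gamma> \<Longrightarrow> joined a \<Longrightarrow> path_class \<gamma> \<in> carrier pi1"
  unfolding path_class_def using cls_closed path_class_loop_aux path_betweenD by metis

lemma path_class_homotopic:
  assumes "path_homotopic X \<gamma> \<delta>" "path_between X a b \<gamma>" "joined a"
  shows "path_class \<gamma> = path_class \<delta>"
proof -
  have d: "path_between X a b \<delta>" using assms path_homotopic_between by metis
  have t: "path_between X x0 a (path_rev (tail a))" "path_between X b x0 (tail b)"
    using assms joined_path tail path_between_rev by metis+
  have "path_homotopic X (path_rev (tail a) \<star> (\<gamma> \<star> tail b)) (path_rev (tail a) \<star> (\<delta> \<star> tail b))"
    by (rule path_homotopic_cong_right[OF t(1) path_between_join[OF assms(2) t(2)]
          path_homotopic_cong_left[OF assms(2) t(2) assms(1)]])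
  then show ?thesis
    unfolding path_class_def path_betweenD(2,3)[OF assms(2)] path_betweenD(2,3)[OF d]
    using cls_eq_iff[OF path_class_loop_aux[OF assms(2,3)] path_class_loop_aux[OF d assms(3)]] by simp
qed

text \<open>In the product the tail at \<open>b\<close> is run through and immediately back.\<close>

lemma path_class_join:
  assumes g: "path_between X a b \<gamma>" and d: "path_between X b c \<delta>" and a: "joined a"
  shows "path_class (\<gamma> \<star> \<delta>) = path_class \<delta> \<otimes>\<^bsub>pi1\<^esub> path_class \<gamma>"
proof -
  have jb: "joined b" and jc: "joined c" using joined_path g d a by blast+
  note ta = path_between_rev[OF tail[OF a]] and tb = tail[OF jb] and tc = tail[OF jc]
  note dc = path_between_join[OF d tc] and gb = path_between_join[OF g tb] and rb = path_between_rev[OF tb]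
  let ?L = "(path_rev (tail a) \<star> (\<gamma> \<star> tail b)) \<star> (path_rev (tail b) \<star> (\<delta> \<star> tail c))"
  have "path_homotopic X ?L (path_rev (tail a) \<star> ((\<gamma> \<star> tail b) \<star> (path_rev (tail b) \<star> (\<delta> \<star> tail c))))"
    by (rule path_homotopic_assoc[OF ta gb path_between_join[OF rb dc]])
  also have "path_homotopic X \<dots> (path_rev (tail a) \<star> (\<gamma> \<star> (tail b \<star> (path_rev (tail b) \<star> (\<delta> \<star> tail c)))))"
    by (rule path_homotopic_cong_right[OF ta path_between_join[OF gb path_between_join[OF rb dc]]
          path_homotopic_assoc[OF g tb path_between_join[OF rb dc]]])
  also have "path_homotopic X \<dots> (path_rev (tail a) \<star> (\<gamma> \<star> (\<delta> \<star> tail c)))"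
    by (rule path_homotopic_cong_right[OF ta path_between_join[OF g path_between_join[OF tb path_between_join[OF rb dc]]]
          path_homotopic_cong_right[OF g path_between_join[OF tb path_between_join[OF rb dc]]
            path_homotopic_cancel[OF tb dc]]])
  also have "path_homotopic X \<dots> (path_rev (tail a) \<star> ((\<gamma> \<star> \<delta>) \<star> tail c))"
    by (rule path_homotopic_cong_right[OF ta path_between_join[OF g dc] path_homotopic_sym[OF path_homotopic_assoc[OF g d tc]]])
  finally have h: "path_homotopic X ?L (path_rev (tail a) \<star> ((\<gamma> \<star> \<delta>) \<star> tail c))" .
  note l1 = path_class_loop_aux[OF g a] and l2 = path_class_loop_aux[OF d jb]
    and l3 = path_class_loop_aux[OF path_between_join[OF g d] a]
  have "path_class \<delta> \<otimes>\<^bsub>pi1\<^esub> path_class \<gamma> = cls ?L"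
    unfolding path_class_def path_betweenD[OF g] path_betweenD[OF d] by (rule mult_pi1[OF l2 l1])
  also have "\<dots> = cls (path_rev (tail a) \<star> ((\<gamma> \<star> \<delta>) \<star> tail c))"
    using h cls_eq_iff[OF path_between_join[OF l1 l2] l3] by blast
  also have "\<dots> = path_class (\<gamma> \<star> \<delta>)"
    unfolding path_class_def path_betweenD[OF path_between_join[OF g d]] ..
  finally show ?thesis ..
qed

lemma path_class_loop:
  assumes "loop \<gamma>"
  shows "path_class \<gamma> = cls \<gamma>"
proof -
  note c = path_between_const[OF x0]
  have "path_rev (tail x0) = (\<lambda>s. x0)" "tail x0 = (\<lambda>s. x0)" by (auto simp: tail_def path_rev_def)
  moreover have "path_homotopic X ((\<lambda>s. x0) \<star> (\<gamma> \<star> (\<lambda>s. x0))) \<gamma>"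
    using path_homotopic_trans[OF path_homotopic_const_left[OF path_between_join[OF assms c]]
        path_homotopic_const_right[OF assms]] .
  ultimately show ?thesis
    unfolding path_class_def path_betweenD[OF assms]
    using cls_eq_iff[OF path_between_join[OF c path_between_join[OF assms c]] assms] by simp
qed

lemma path_class_const: "joined a \<Longrightarrow> path_class (\<lambda>s. a) = \<one>\<^bsub>pi1\<^esub>"
proof -
  assume a: "joined a"
  then have c: "path_between X a a (\<lambda>s. a)"
    unfolding joined_def using path_between_topspace(1) path_between_const by metis
  have "path_class (\<lambda>s. a) \<otimes>\<^bsub>pi1\<^esub> path_class (\<lambda>s. a) = path_class (\<lambda>s. a)"
    using path_class_join[OF c c a] path_class_homotopic[OF path_homotopic_const_left[OF c] path_between_join[OF c c] a] by simp
  then show ?thesis using path_class_closed[OF c a] pi1.l_cancel_one by blast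
qed

end

section \<open>Realizations\<close>

lemma equiv_realization_equiv: "equiv UNIV (realization_equiv X)"
  unfolding realization_equiv_def
  by (rule equivI) (auto intro: refl_rtrancl trans_rtrancl sym_rtrancl sym_Un_converse)

definition glue_map where "glue_map X y = realization_equiv X `` {y}"

lemma realization_point_glue: "realization_point X n x t = glue_map X ((n, x), t)"
  by (simp add: realization_point_def glue_map_def)

lemma glue_map_eq_iff: "glue_map X y = glue_map X z \<longleftrightarrow> (y, z) \<in> realization_equiv X"
  unfolding glue_map_def using eq_equiv_class_iff[OF equiv_realization_equiv] by blast

lemma quotient_map_glue: "quotient_map (simplex_sum X) (realization X) (glue_map X)"
  unfolding realization_def glue_map_def by (rule quotient_map_quot_topology)

lemma topspace_simplex_topology [simp]: "topspace (simplex_topology n) = standard_simplex n"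
  by (simp add: simplex_topology_def)

lemma topspace_simplex_sum: "topspace (simplex_sum X) = {((n, x), t). x \<in> simps_of X n \<and> t \<in> standard_simplex n}"
  by (auto simp: simplex_sum_def)

lemma continuous_realization_point:
  assumes "x \<in> simps_of X n"
  shows "continuous_map (simplex_topology n) (realization X) (realization_point X n x)"
proof -
  have "continuous_map (simplex_topology n) (simplex_sum X) (\<lambda>t. ((n, x), t))"
    unfolding simplex_sum_def
    using continuous_map_component_injection[of "(n, x)" "SIGMA n:UNIV. simps_of X n" "\<lambda>(n, x). simplex_topology n"]
      assms by simp
  from continuous_map_compose[OF this quotient_imp_continuous_map[OF quotient_map_glue]]
  show ?thesis by (simp add: o_def realization_point_glue[abs_def])
qed

lemma simplex_push_in_simplex:
  assumes "\<theta> \<in> simplex_ops m n" "t \<in> standard_simplex m"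
  shows "simplex_push m \<theta> t \<in> standard_simplex n"
proof -
  have \<theta>: "\<theta> i \<le> n" if "i \<le> m" for i using assms that by (auto simp: simplex_ops_def)
  have t: "0 \<le> t i" "(\<Sum>i\<le>m. t i) = 1" for i using assms by (auto simp: standard_simplex_def)
  have "simplex_push m \<theta> t j \<le> (\<Sum>i\<le>m. t i)" for j
    unfolding simplex_push_def by (rule sum_mono2) (use t in auto)
  moreover have "(\<Sum>j\<le>n. simplex_push m \<theta> t j) = (\<Sum>i\<le>m. t i)"
    unfolding simplex_push_def
    using sum.group[of "{..m}" "{..n}" \<theta> t] \<theta> by (simp add: image_subset_iff conj_commute)
  moreover have "simplex_push m \<theta> t j = 0" if "j > n" for j
  proof -
    have e: "{i. i \<le> m \<and> \<theta> i = j} = {}" using \<theta> that by fastforce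
    show ?thesis unfolding simplex_push_def e by simp
  qed
  ultimately show ?thesis using t
    by (auto simp: standard_simplex_def simplex_push_def intro!: sum_nonneg)
qed

lemma glue_map_face:
  assumes "x \<in> simps_of X n" "\<theta> \<in> simplex_ops m n" "t \<in> standard_simplex m"
  shows "glue_map X ((m, simp_act X m n \<theta> x), t) = glue_map X ((n, x), simplex_push m \<theta> t)"
  unfolding glue_map_eq_iff realization_equiv_def realization_gluing_def
  using assms by (intro r_into_rtrancl UnI1) blast

text \<open>The induction principle for points of the realization: an equivalence relation that holds across
  every elementary gluing holds between all representatives of a point.\<close>

lemma realization_equiv_invariant:
  assumes "(y, z) \<in> realization_equiv X"
    and "\<And>m n \<theta> x t. x \<in> simps_of X n \<Longrightarrow> \<theta> \<in> simplex_ops m n \<Longrightarrow> t \<in> standard_simplex m \<Longrightarrow>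
      P ((m, simp_act X m n \<theta> x), t) ((n, x), simplex_push m \<theta> t)"
    and "\<And>y. P y y" "\<And>y z. P y z \<Longrightarrow> P z y" "\<And>y z w. P y z \<Longrightarrow> P z w \<Longrightarrow> P y w"
  shows "P y z"
  using assms(1) unfolding realization_equiv_def
proof (induction rule: rtrancl_induct)
  case base
  show ?case by (rule assms(3))
next
  case (step z w)
  then have "P z w \<or> P w z" unfolding realization_gluing_def using assms(2) by auto
  then show ?case using step.IH assms(4,5) by blast
qed

section \<open>Paths in simplices\<close>

definition segment :: "(nat \<Rightarrow> real) \<Rightarrow> (nat \<Rightarrow> real) \<Rightarrow> real \<Rightarrow> nat \<Rightarrow> real" where
  "segment t u = (\<lambda>s i. (1 - s) * t i + s * u i)"

definition corner :: "nat \<Rightarrow> nat \<Rightarrow> real" where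
  "corner i = (\<lambda>j. if j = i then 1 else 0)"

lemma corner_in_simplex: "i \<le> n \<Longrightarrow> corner i \<in> standard_simplex n"
  by (auto simp: corner_def standard_simplex_def)

lemma segment_in_simplex:
  "t \<in> standard_simplex n \<Longrightarrow> u \<in> standard_simplex n \<Longrightarrow> s \<in> {0..1} \<Longrightarrow> segment t u s \<in> standard_simplex n"
  unfolding segment_def using convex_standard_simplex by auto

lemma continuous_map_simplex_topology:
  "continuous_map Z (simplex_topology n) f \<longleftrightarrow>
     (\<forall>k. continuous_map Z euclideanreal (\<lambda>z. f z k)) \<and> f ` topspace Z \<subseteq> standard_simplex n"
  unfolding simplex_topology_def continuous_map_in_subtopology continuous_map_componentwise_UNIV
  by (auto simp: image_subset_iff_funcset)

lemma path_between_segment: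
  assumes "t \<in> standard_simplex n" "u \<in> standard_simplex n"
  shows "path_between (simplex_topology n) t u (segment t u)"
proof -
  have "continuous_map unit_interval (simplex_topology n) (segment t u)"
    unfolding continuous_map_simplex_topology
    using segment_in_simplex[OF assms]
    by (auto simp: segment_def intro!: continuous_intros)
  then show ?thesis by (simp add: path_between_def pathin_def segment_def)
qed

text \<open>The straight-line homotopy, written out because the simplex carries a product topology and its
  ambient space of functions is not a normed space.\<close>

lemma simplex_paths_homotopic:
  assumes "path_between (simplex_topology n) t u p" "path_between (simplex_topology n) t u q"
  shows "path_homotopic (simplex_topology n) p q"
proof -
  let ?Z = "prod_topology unit_interval unit_interval"
  define h where "h = (\<lambda>x :: real \<times> real. segment (p (snd x)) (q (snd x)) (fst x))"
  have in01: "continuous_map ?Z euclideanreal fst" "continuous_map ?Z euclideanreal snd"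
    using continuous_map_fst[of unit_interval unit_interval] continuous_map_snd[of unit_interval unit_interval]
    by (auto simp: continuous_map_in_subtopology)
  have ck: "continuous_map ?Z euclideanreal (\<lambda>x. r (snd x) k)"
    if r: "path_between (simplex_topology n) t u r" for r k
  proof -
    have "continuous_map unit_interval euclideanreal (\<lambda>s. r s k)"
      using path_betweenD(1)[OF r] unfolding continuous_map_simplex_topology by blast
    from continuous_map_compose[OF continuous_map_snd[of unit_interval] this]
    show ?thesis by (simp only: o_def)
  qed
  note pk = ck[OF assms(1)] ck[OF assms(2)]
  have "continuous_map ?Z (simplex_topology n) h"
    unfolding continuous_map_simplex_topology
  proof (intro conjI allI)
    show "continuous_map ?Z euclideanreal (\<lambda>z. h z k)" for k
      unfolding h_def segment_def
      by (intro continuous_map_add continuous_map_real_mult continuous_map_diff in01 pk) auto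
    show "h ` topspace ?Z \<subseteq> standard_simplex n"
      using path_between_topspace(3)[OF assms(1)] path_between_topspace(3)[OF assms(2)]
      by (auto simp: h_def intro!: segment_in_simplex)
  qed
  moreover have "p 0 = q 0" "p 1 = q 1" using assms by (simp_all add: path_between_def)
  ultimately show ?thesis
    unfolding path_homotopic_def homotopic_with_def
    by (intro exI[of _ h]) (auto simp: h_def segment_def fun_eq_iff algebra_simps)
qed

lemma path_in_simplex:
  assumes "x \<in> simps_of X n" "path_between (simplex_topology n) t u p"
  shows "path_between (realization X) (realization_point X n x t) (realization_point X n x u)
    (\<lambda>s. realization_point X n x (p s))"
  using continuous_map_compose[OF path_betweenD(1)[OF assms(2)] continuous_realization_point[OF assms(1)]] assms(2)
  by (simp add: path_between_def pathin_def o_def)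

lemma paths_in_simplex_homotopic:
  assumes "x \<in> simps_of X n" "path_between (simplex_topology n) t u p" "path_between (simplex_topology n) t u q"
  shows "path_homotopic (realization X) (\<lambda>s. realization_point X n x (p s)) (\<lambda>s. realization_point X n x (q s))"
  using path_homotopic_compose[OF simplex_paths_homotopic[OF assms(2,3)] continuous_realization_point[OF assms(1)]]
  by (simp add: o_def)

section \<open>Nerves\<close>

locale small_category =
  fixes C :: "('o, 'm) small_cat"
  assumes Id_in: "c \<in> Obj C \<Longrightarrow> Id C c \<in> Hom C c c"
    and Comp_in: "\<lbrakk>a \<in> Obj C; b \<in> Obj C; c \<in> Obj C; f \<in> Hom C a b; g \<in> Hom C b c\<rbrakk> \<Longrightarrow> Comp C a b c g f \<in> Hom C a c"
    and Comp_Id_right: "\<lbrakk>a \<in> Obj C; b \<in> Obj C; f \<in> Hom C a b\<rbrakk> \<Longrightarrow> Comp C a a b f (Id C a) = f"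
    and Comp_Id_left: "\<lbrakk>a \<in> Obj C; b \<in> Obj C; f \<in> Hom C a b\<rbrakk> \<Longrightarrow> Comp C a b b (Id C b) f = f"
    and Comp_assoc: "\<lbrakk>a \<in> Obj C; b \<in> Obj C; c \<in> Obj C; d \<in> Obj C; f \<in> Hom C a b; g \<in> Hom C b c; h \<in> Hom C c d\<rbrakk> \<Longrightarrow>
      Comp C a c d h (Comp C a b c g f) = Comp C a b d (Comp C b c d h g) f"
begin

abbreviation NC where "NC \<equiv> nerve C"
abbreviation RC where "RC \<equiv> realization NC"
definition vert where "vert c = vertex_point NC (nerve_vertex C c)"
definition edge where "edge c d f = edge_path NC (nerve_edge C c d f)"

lemma simps_of_nerve [simp]: "simps_of NC n = nerve_simplices C n"
  and simp_act_nerve [simp]: "simp_act NC m n \<theta> = nerve_act m \<theta>"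
  by (simp_all add: nerve_def)

lemma nerve_simplexD:
  assumes "(a, f) \<in> nerve_simplices C n"
  shows "i \<le> n \<Longrightarrow> a i \<in> Obj C" "i \<le> j \<Longrightarrow> j \<le> n \<Longrightarrow> f (i, j) \<in> Hom C (a i) (a j)"
    "i \<le> n \<Longrightarrow> f (i, i) = Id C (a i)"
    "i \<le> j \<Longrightarrow> j \<le> k \<Longrightarrow> k \<le> n \<Longrightarrow> f (i, k) = Comp C (a i) (a j) (a k) (f (j, k)) (f (i, j))"
proof -
  have f: "f \<in> (\<Pi>\<^sub>E (i, j) \<in> le_pairs n. Hom C (a i) (a j))" using assms by (simp add: nerve_simplices_def)
  show "i \<le> j \<Longrightarrow> j \<le> n \<Longrightarrow> f (i, j) \<in> Hom C (a i) (a j)"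
    using PiE_mem[OF f, of "(i, j)"] by (simp add: le_pairs_def)
qed (use assms in \<open>auto simp: nerve_simplices_def\<close>)

lemma nerve_vertex_simplex: "c \<in> Obj C \<Longrightarrow> nerve_vertex C c \<in> nerve_simplices C 0"
  using Id_in Comp_Id_left[of c c "Id C c"]
  by (auto simp: nerve_vertex_def nerve_simplices_def le_pairs_def)

text \<open>The 2-simplex of a composable pair of morphisms.\<close>

definition nerve_triangle where
  "nerve_triangle a b c f g =
     (restrict (\<lambda>i::nat. if i = 0 then a else if i = 1 then b else c) {..2},
      restrict (\<lambda>(i, j). if j = 0 then Id C a else if i = 2 then Id C c else if i = 1 then (if j = 1 then Id C b else g)
         else if j = 1 then f else Comp C a b c g f) (le_pairs 2))"

lemma nerve_triangle_simplex:
  assumes "a \<in> Obj C" "b \<in> Obj C" "c \<in> Obj C" "f \<in> Hom C a b" "g \<in> Hom C b c"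
  shows "nerve_triangle a b c f g \<in> nerve_simplices C 2"
proof -
  have le2: "i \<le> 2 \<longleftrightarrow> i = 0 \<or> i = 1 \<or> i = (2::nat)" for i by auto
  show ?thesis
    using assms Id_in Comp_in[OF assms] Comp_Id_left Comp_Id_right
    by (auto simp: nerve_triangle_def nerve_simplices_def le_pairs_def le2)
qed

lemma nerve_act_simplex:
  assumes "x \<in> nerve_simplices C n" "\<theta> \<in> simplex_ops m n"
  shows "nerve_act m \<theta> x \<in> nerve_simplices C m"
proof -
  obtain a f where x: "x = (a, f)" by (cases x)
  note D = nerve_simplexD[OF assms(1)[unfolded x]]
  have \<theta>: "\<theta> i \<le> n" if "i \<le> m" for i using assms(2) that by (auto simp: simplex_ops_def)
  have mono: "\<theta> i \<le> \<theta> j" if "i \<le> j" "j \<le> m" for i j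
    using assms(2) that by (auto simp: simplex_ops_def mono_on_def)
  have comp: "f (\<theta> i, \<theta> k) = Comp C (a (\<theta> i)) (a (\<theta> j)) (a (\<theta> k)) (f (\<theta> j, \<theta> k)) (f (\<theta> i, \<theta> j))"
    if "i \<le> j" "j \<le> k" "k \<le> m" for i j k
    by (rule D(4)) (use mono \<theta> that in auto)
  have pairs: "restrict (\<lambda>(i, j). f (\<theta> i, \<theta> j)) (le_pairs m) (i, j) = f (\<theta> i, \<theta> j)" if "i \<le> j" "j \<le> m" for i j
    using that by (simp add: le_pairs_def)
  show ?thesis
    unfolding x nerve_act_def nerve_simplices_def mem_Collect_eq prod.case fst_conv snd_conv
  proof (intro conjI allI impI)
    show "restrict (\<lambda>i. a (\<theta> i)) {..m} \<in> {..m} \<rightarrow>\<^sub>E Obj C"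
      using D(1) \<theta> by simp
    show "restrict (\<lambda>(i, j). f (\<theta> i, \<theta> j)) (le_pairs m) \<in>
      (\<Pi>\<^sub>E (i, j) \<in> le_pairs m. Hom C (restrict (\<lambda>i. a (\<theta> i)) {..m} i) (restrict (\<lambda>i. a (\<theta> i)) {..m} j))"
      using D(2)[OF mono \<theta>] by (auto simp: le_pairs_def)
    show "restrict (\<lambda>(i, j). f (\<theta> i, \<theta> j)) (le_pairs m) (i, i) = Id C (restrict (\<lambda>i. a (\<theta> i)) {..m} i)"
      if "i \<le> m" for i using that pairs D(3)[OF \<theta>] by simp
    show "restrict (\<lambda>(i, j). f (\<theta> i, \<theta> j)) (le_pairs m) (i, k) =
      Comp C (restrict (\<lambda>i. a (\<theta> i)) {..m} i) (restrict (\<lambda>i. a (\<theta> i)) {..m} j) (restrict (\<lambda>i. a (\<theta> i)) {..m} k)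
        (restrict (\<lambda>(i, j). f (\<theta> i, \<theta> j)) (le_pairs m) (j, k))
        (restrict (\<lambda>(i, j). f (\<theta> i, \<theta> j)) (le_pairs m) (i, j))"
      if "i \<le> j \<and> j \<le> k \<and> k \<le> m" for i j k
      using that pairs[of i k] pairs[of i j] pairs[of j k] comp[of i j k] by simp
  qed
qed

lemma nerve_act_edge:
  assumes "(a, f) \<in> nerve_simplices C n" "i \<le> j" "j \<le> n"
  shows "nerve_act 1 (\<lambda>k. if k = 0 then i else j) (a, f) = nerve_edge C (a i) (a j) (f (i, j))"
  using nerve_simplexD(3)[OF assms(1)] assms(2,3)
  by (auto simp: nerve_act_def nerve_edge_def le_pairs_def fun_eq_iff restrict_def)

text \<open>If all the weight of a point sits on a set \<open>A\<close> of vertices that are joined to each other by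
  identities, then a monotone retraction of the indices onto \<open>A\<close> pulls the simplex back to a
  degenerate one and fixes the point.\<close>

lemma realization_point_on_identities:
  assumes x: "(a, f) \<in> nerve_simplices C n" and t: "t \<in> standard_simplex n"
    and A: "A \<subseteq> {..n}" "A \<noteq> {}" "\<And>i. i \<notin> A \<Longrightarrow> t i = 0"
    and obj: "\<And>i. i \<in> A \<Longrightarrow> a i = c"
    and ids: "\<And>i j. i \<in> A \<Longrightarrow> j \<in> A \<Longrightarrow> i \<le> j \<Longrightarrow> f (i, j) = Id C c"
  shows "realization_point NC n (a, f) t = vert c"
proof -
  have finA: "finite A" using A(1) finite_subset by blast
  \<comment> \<open>Each index is rounded down to \<open>A\<close>; the indices below all of \<open>A\<close> go to its least element.\<close>
  define \<theta> where "\<theta> i = (if \<exists>k\<in>A. k \<le> i then Max {k\<in>A. k \<le> i} else Min A)" for i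
  have \<theta>A: "\<theta> i \<in> A" for i
  proof (cases "\<exists>k\<in>A. k \<le> i")
    case True
    then have "Max {k\<in>A. k \<le> i} \<in> {k\<in>A. k \<le> i}" using finA by (intro Max_in) auto
    then show ?thesis using True by (simp add: \<theta>_def)
  next
    case False
    then have "\<theta> i = Min A" by (auto simp: \<theta>_def)
    then show ?thesis using finA A(2) by simp
  qed
  have \<theta>id: "\<theta> i = i" if "i \<in> A" for i
  proof -
    have "Max {k\<in>A. k \<le> i} = i" using that finA by (intro Max_eqI) auto
    then show ?thesis using that by (auto simp: \<theta>_def)
  qed
  have mono: "\<theta> i \<le> \<theta> j" if "i \<le> j" for i j
  proof (cases "\<exists>k\<in>A. k \<le> i")
    case True
    then have "Max {k\<in>A. k \<le> i} \<le> Max {k\<in>A. k \<le> j}"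
      using finA that by (intro Max_mono) auto
    then show ?thesis using True that by (auto simp: \<theta>_def)
  next
    case False
    then show ?thesis using \<theta>A[of j] finA by (auto simp: \<theta>_def)
  qed
  have ops: "\<theta> \<in> simplex_ops n n"
    using \<theta>A A(1) mono by (auto simp: simplex_ops_def mono_on_def)
  have push: "simplex_push n \<theta> t = t"
  proof
    fix j
    have "simplex_push n \<theta> t j = (\<Sum>i | i \<le> n \<and> \<theta> i = j. if i = j then t i else 0)"
      unfolding simplex_push_def
    proof (intro sum.cong refl)
      fix i assume "i \<in> {i. i \<le> n \<and> \<theta> i = j}"
      then show "t i = (if i = j then t i else 0)" using \<theta>id[of i] A(3)[of i] by (cases "i \<in> A") auto
    qed
    also have "\<dots> = t j"
      using \<theta>id[of j] A(1,3) by (cases "j \<in> A") auto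
    finally show "simplex_push n \<theta> t j = t j" .
  qed
  have deg: "nerve_act n \<theta> (a, f) = nerve_act n (\<lambda>_. 0) (nerve_vertex C c)"
    using obj ids \<theta>A mono by (auto simp: nerve_act_def nerve_vertex_def le_pairs_def fun_eq_iff restrict_def)
  obtain i where "i \<in> A" using A(2) by blast
  then have c: "c \<in> Obj C" using obj A(1) nerve_simplexD(1)[OF x] by fastforce
  have ops0: "(\<lambda>_. 0) \<in> simplex_ops n 0" by (auto simp: simplex_ops_def mono_on_def)
  have push0: "simplex_push n (\<lambda>_. 0) t = (\<lambda>i. if i = 0 then 1 else 0)"
    using t by (auto simp: simplex_push_def standard_simplex_def atMost_def fun_eq_iff)
  have "realization_point NC n (a, f) t = realization_point NC n (nerve_act n \<theta> (a, f)) t"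
    using glue_map_face[of "(a, f)" NC n \<theta> n t] x ops t push by (simp add: realization_point_glue)
  also have "\<dots> = realization_point NC 0 (nerve_vertex C c) (simplex_push n (\<lambda>_. 0) t)"
    unfolding deg using glue_map_face[of "nerve_vertex C c" NC 0 "\<lambda>_. 0" n t] nerve_vertex_simplex[OF c] ops0 t
    by (simp add: realization_point_glue)
  also have "\<dots> = vert c" unfolding push0 vert_def vertex_point_def ..
  finally show ?thesis .
qed

lemma realization_point_corner:
  assumes "(a, f) \<in> nerve_simplices C n" "i \<le> n"
  shows "realization_point NC n (a, f) (corner i) = vert (a i)"
  by (rule realization_point_on_identities[OF assms(1) corner_in_simplex[OF assms(2)], of "{i}"])
     (use assms nerve_simplexD(3)[OF assms(1)] in \<open>auto simp: corner_def\<close>)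

lemma edge_eq_segment:
  assumes x: "(a, f) \<in> nerve_simplices C n" and ij: "i \<le> j" "j \<le> n" and s: "s \<in> {0..1}"
  shows "edge (a i) (a j) (f (i, j)) s = realization_point NC n (a, f) (segment (corner i) (corner j) s)"
proof -
  let ?\<theta> = "\<lambda>k::nat. if k = 0 then i else j"
  let ?t = "\<lambda>k::nat. if k = 0 then 1 - s else if k = 1 then s else 0"
  have ops: "?\<theta> \<in> simplex_ops 1 n" using ij by (auto simp: simplex_ops_def mono_on_def)
  have t: "?t \<in> standard_simplex 1" using s by (auto simp: standard_simplex_def)
  have push: "simplex_push 1 ?\<theta> ?t = segment (corner i) (corner j) s"
  proof
    fix k
    have "simplex_push 1 ?\<theta> ?t k = (\<Sum>l\<le>1. if ?\<theta> l = k then ?t l else 0)"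
      unfolding simplex_push_def by (subst sum.inter_filter[symmetric]) (auto simp: atMost_def)
    then show "simplex_push 1 ?\<theta> ?t k = segment (corner i) (corner j) s k"
      by (auto simp: segment_def corner_def)
  qed
  show ?thesis
    unfolding edge_def edge_path_def
    using glue_map_face[of "(a, f)" NC n ?\<theta> 1 ?t] x ops t push nerve_act_edge[OF x ij]
    by (simp add: realization_point_glue)
qed

lemma path_homotopic_edge:
  assumes x: "(a, f) \<in> nerve_simplices C n" and ij: "i \<le> j" "j \<le> n"
    and p: "path_between (simplex_topology n) (corner i) (corner j) p"
  shows "path_homotopic RC (\<lambda>s. realization_point NC n (a, f) (p s)) (edge (a i) (a j) (f (i, j)))"
proof -
  have ci: "corner i \<in> standard_simplex n" "corner j \<in> standard_simplex n"
    using ij by (auto intro: corner_in_simplex)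
  note seg = path_between_segment[OF ci]
  have x': "(a, f) \<in> simps_of NC n" using x by simp
  have "path_homotopic RC (\<lambda>s. realization_point NC n (a, f) (p s))
      (\<lambda>s. realization_point NC n (a, f) (segment (corner i) (corner j) s))"
    by (rule paths_in_simplex_homotopic[OF x' p seg])
  also have "path_homotopic RC \<dots> (edge (a i) (a j) (f (i, j)))"
    by (rule path_homotopic_eqI[OF path_in_simplex[OF x' seg]]) (use edge_eq_segment[OF x ij] in auto)
  finally show ?thesis .
qed

lemma nerve_triangle_faces:
  "fst (nerve_triangle a b c f g) 0 = a" "fst (nerve_triangle a b c f g) 1 = b" "fst (nerve_triangle a b c f g) 2 = c"
  "snd (nerve_triangle a b c f g) (0, 1) = f" "snd (nerve_triangle a b c f g) (1, 2) = g"
  "snd (nerve_triangle a b c f g) (0, 2) = Comp C a b c g f"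
  by (simp_all add: nerve_triangle_def le_pairs_def)

text \<open>Both paths are images of paths in the triangle of the pair \<open>f\<close>, \<open>g\<close>, where paths with equal ends
  are homotopic.\<close>

lemma edge_comp:
  assumes "a \<in> Obj C" "b \<in> Obj C" "c \<in> Obj C" "f \<in> Hom C a b" "g \<in> Hom C b c"
  shows "path_homotopic RC (edge a b f \<star> edge b c g) (edge a c (Comp C a b c g f))"
proof -
  obtain o' m where T: "nerve_triangle a b c f g = (o', m)" by fastforce
  have x: "(o', m) \<in> nerve_simplices C 2" using nerve_triangle_simplex[OF assms] T by simp
  note F = nerve_triangle_faces[of a b c f g, unfolded T fst_conv snd_conv]
  let ?r = "realization_point NC 2 (o', m)"
  let ?p = "segment (corner 0) (corner 1)" and ?q = "segment (corner 1) (corner 2)"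
  have ci: "corner 0 \<in> standard_simplex 2" "corner 1 \<in> standard_simplex 2" "corner 2 \<in> standard_simplex 2"
    by (auto intro: corner_in_simplex)
  note p = path_between_segment[OF ci(1,2)] and q = path_between_segment[OF ci(2,3)]
  have e: "(\<lambda>s. ?r ((?p \<star> ?q) s)) = (\<lambda>s. ?r (?p s)) \<star> (\<lambda>s. ?r (?q s))"
    by (auto simp: path_join_def fun_eq_iff)
  have h1: "path_homotopic RC ((\<lambda>s. ?r (?p s)) \<star> (\<lambda>s. ?r (?q s))) (edge a b f \<star> edge b c g)"
    using path_homotopic_edge[OF x _ _ p] path_homotopic_edge[OF x _ _ q] F
    by (intro path_homotopic_join) (auto simp: segment_def)
  have h2: "path_homotopic RC (\<lambda>s. ?r ((?p \<star> ?q) s)) (edge a c (Comp C a b c g f))"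
    using path_homotopic_edge[OF x _ _ path_between_join[OF p q]] F by simp
  show ?thesis by (rule path_homotopic_trans[OF path_homotopic_sym[OF h1] h2[unfolded e]])
qed

text \<open>A morphism as an edge of a degenerate triangle, so that the statements about faces of simplices
  apply to single edges.\<close>

lemma edge_simplex:
  assumes "c \<in> Obj C" "d \<in> Obj C" "f \<in> Hom C c d"
  obtains a m where "(a, m) \<in> nerve_simplices C 2" "a 0 = c" "a 1 = d" "m (0, 1) = f"
proof -
  let ?T = "nerve_triangle c d d f (Id C d)"
  show thesis
    by (rule that[of "fst ?T" "snd ?T"])
       (simp_all only: prod.collapse nerve_triangle_faces
          nerve_triangle_simplex[OF assms(1,2,2,3) Id_in[OF assms(2)]])
qed

lemma path_between_edge:
  assumes "c \<in> Obj C" "d \<in> Obj C" "f \<in> Hom C c d"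
  shows "path_between RC (vert c) (vert d) (edge c d f)"
proof -
  obtain a m where x: "(a, m) \<in> nerve_simplices C 2" "a 0 = c" "a 1 = d" "m (0, 1) = f"
    using edge_simplex[OF assms] by blast
  have p: "path_between (simplex_topology 2) (corner 0) (corner 1) (segment (corner 0) (corner 1))"
    by (intro path_between_segment corner_in_simplex) auto
  have "path_between RC (vert c) (vert d) (\<lambda>s. realization_point NC 2 (a, m) (segment (corner 0) (corner 1) s))"
    using path_in_simplex[OF _ p, of "(a, m)" NC] realization_point_corner[OF x(1), of 0]
      realization_point_corner[OF x(1), of 1] x by simp
  then show ?thesis
    using path_homotopic_between path_homotopic_edge[OF x(1) _ _ p] x by force
qed

lemma vert_in_topspace: "c \<in> Obj C \<Longrightarrow> vert c \<in> topspace RC"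
  by (rule path_between_topspace(1)[OF path_between_edge[OF _ _ Id_in]])

end

section \<open>Truncated weights\<close>

definition partial_weight :: "(nat \<Rightarrow> real) \<Rightarrow> nat \<Rightarrow> real" where
  "partial_weight t i = (\<Sum>k<i. t k)"

text \<open>Lay the weights \<open>t\<^sub>0, t\<^sub>1, \<dots>\<close> end to end from \<open>0\<close>; \<open>wt b t i\<close> is the part of the \<open>i\<close>-th one below \<open>b\<close>.
  Looking only below \<open>b\<close> produces a majority: many vertices may have equal weights, but for small
  \<open>b\<close> the first vertex of positive weight owns everything below \<open>b\<close>.\<close>

definition wt :: "real \<Rightarrow> (nat \<Rightarrow> real) \<Rightarrow> nat \<Rightarrow> real" where
  "wt b t i = min (partial_weight t (Suc i)) b - min (partial_weight t i) b"

lemma partial_weight_Suc: "partial_weight t (Suc i) = partial_weight t i + t i"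
  by (simp add: partial_weight_def)

lemma wt_bounds: 
  assumes "t \<in> standard_simplex n"
  shows "0 \<le> wt b t i" "wt b t i \<le> t i"
proof -
  have "0 \<le> t i" using assms by (simp add: standard_simplex_def)
  then show "0 \<le> wt b t i" "wt b t i \<le> t i" by (auto simp: wt_def partial_weight_Suc min_def)
qed

lemma sum_wt_initial: "0 \<le> b \<Longrightarrow> (\<Sum>i<j. wt b t i) = min (partial_weight t j) b"
  unfolding wt_def by (subst sum_lessThan_telescope) (simp add: partial_weight_def)

lemma sum_wt:
  assumes "t \<in> standard_simplex n" "0 \<le> b" "b \<le> 1"
  shows "(\<Sum>i\<le>n. wt b t i) = b"
proof -
  have "partial_weight t (Suc n) = 1"
    using assms(1) by (simp add: partial_weight_def standard_simplex_def lessThan_Suc_atMost)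
  then show ?thesis using sum_wt_initial[OF assms(2), of t "Suc n"] assms(3) by (simp add: lessThan_Suc_atMost)
qed

lemma sum_preimage_push:
  assumes "\<theta> \<in> simplex_ops m n" "B \<subseteq> {..n}"
  shows "(\<Sum>j\<in>B. \<Sum>i | i \<le> m \<and> \<theta> i = j. g i) = (\<Sum>i | i \<le> m \<and> \<theta> i \<in> B. (g i :: real))"
proof -
  have "(\<Sum>i | i \<le> m \<and> \<theta> i \<in> B. g i) = (\<Sum>j\<in>B. \<Sum>i | i \<in> {i. i \<le> m \<and> \<theta> i \<in> B} \<and> \<theta> i = j. g i)"
    by (rule sum.group[symmetric]) (use assms(2) finite_subset in auto)
  also have "\<dots> = (\<Sum>j\<in>B. \<Sum>i | i \<le> m \<and> \<theta> i = j. g i)"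
    by (intro sum.cong refl) auto
  finally show ?thesis ..
qed

lemma partial_weight_push:
  assumes "\<theta> \<in> simplex_ops m n" "l \<le> Suc n"
  shows "partial_weight (simplex_push m \<theta> t) l = (\<Sum>i | i \<le> m \<and> \<theta> i < l. t i)"
  using sum_preimage_push[OF assms(1), of "{..<l}" t] assms(2)
  by (simp add: partial_weight_def simplex_push_def subset_iff)

text \<open>A monotone map of vertices keeps the order in which weights are laid out, so truncation commutes
  with pushing forward. This is the reason for truncating an ordered sum instead of comparing single
  weights.\<close>

lemma wt_push:
  assumes \<theta>: "\<theta> \<in> simplex_ops m n" and b: "0 \<le> b" and j: "j \<le> n"
  shows "wt b (simplex_push m \<theta> t) j = (\<Sum>i | i \<le> m \<and> \<theta> i = j. wt b t i)"
proof -
  \<comment> \<open>By monotonicity the preimage of an initial segment is an initial segment.\<close>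
  have initial: "\<exists>k\<le>Suc m. {i. i \<le> m \<and> \<theta> i < l} = {..<k}" for l
  proof -
    let ?A = "{i. i \<le> m \<and> \<theta> i < l}"
    have down: "i' \<in> ?A" if "i \<in> ?A" "i' \<le> i" for i i'
    proof -
      have "\<theta> i' \<le> \<theta> i" using that \<theta> by (auto simp: simplex_ops_def mono_on_def)
      then show ?thesis using that by auto
    qed
    show ?thesis
    proof (cases "?A = {}")
      case True
      then show ?thesis by (intro exI[of _ 0]) auto
    next
      case False
      have fin: "finite ?A" by simp
      have M: "Max ?A \<in> ?A" using Max_in[OF fin False] .
      have "?A = {..<Suc (Max ?A)}"
      proof (intro equalityI subsetI)
        fix i assume "i \<in> ?A"
        then show "i \<in> {..<Suc (Max ?A)}" using Max_ge[OF fin] by (simp add: less_Suc_eq_le)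
      next
        fix i assume "i \<in> {..<Suc (Max ?A)}"
        then show "i \<in> ?A" using down[OF M, of i] by (simp add: less_Suc_eq_le)
      qed
      moreover have "Suc (Max ?A) \<le> Suc m" using M by simp
      ultimately show ?thesis by blast
    qed
  qed
  have trunc: "min (partial_weight (simplex_push m \<theta> t) l) b = (\<Sum>i | i \<le> m \<and> \<theta> i < l. wt b t i)"
    if l: "l \<le> Suc n" for l
  proof -
    obtain k where k: "{i. i \<le> m \<and> \<theta> i < l} = {..<k}" using initial by blast
    have "partial_weight (simplex_push m \<theta> t) l = (\<Sum>i | i \<le> m \<and> \<theta> i < l. t i)"
      by (rule partial_weight_push[OF \<theta> l])
    also have "\<dots> = partial_weight t k" unfolding k partial_weight_def ..
    finally show ?thesis using sum_wt_initial[OF b] k by simp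
  qed
  have "{i. i \<le> m \<and> \<theta> i < Suc j} = {i. i \<le> m \<and> \<theta> i < j} \<union> {i. i \<le> m \<and> \<theta> i = j}" by auto
  then have "(\<Sum>i | i \<le> m \<and> \<theta> i < Suc j. wt b t i) =
      (\<Sum>i | i \<le> m \<and> \<theta> i < j. wt b t i) + (\<Sum>i | i \<le> m \<and> \<theta> i = j. wt b t i)"
    by (subst sum.union_disjoint[symmetric]) auto
  then show ?thesis unfolding wt_def[of b "simplex_push m \<theta> t"] using trunc[of j] trunc[of "Suc j"] j by simp
qed

context small_category
begin

section \<open>Majority classes\<close>

fun id_joined :: "(nat \<Rightarrow> 'o) \<times> (nat \<times> nat \<Rightarrow> 'm) \<Rightarrow> nat \<Rightarrow> nat \<Rightarrow> bool" where
  "id_joined (a, f) i j \<longleftrightarrow> a i = a j \<and> f (min i j, max i j) = Id C (a i)"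

lemma id_joined_sym: "id_joined x i j \<Longrightarrow> id_joined x j i"
  by (cases x) (simp add: min.commute max.commute)

lemma id_joined_refl: "x \<in> nerve_simplices C n \<Longrightarrow> i \<le> n \<Longrightarrow> id_joined x i i"
  using nerve_simplexD(3) by (cases x) auto

lemma id_joined_id: "id_joined (a, f) i j \<Longrightarrow> i \<le> j \<Longrightarrow> f (i, j) = Id C (a i)"
  by simp

text \<open>In a commuting triangle whose three objects agree, two identities force the third morphism to be an
  identity. The cases are the possible orders of \<open>i\<close>, \<open>j\<close>, \<open>k\<close>.\<close>

lemma id_joined_trans:
  assumes x: "x \<in> nerve_simplices C n" and le: "i \<le> n" "j \<le> n" "k \<le> n"
    and ij: "id_joined x i j" and jk: "id_joined x j k"
  shows "id_joined x i k"
proof -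
  obtain a f where af: "x = (a, f)" by (cases x)
  note D = nerve_simplexD[OF x[unfolded af]]
  define c where "c = a i"
  have obj: "a i = c" "a j = c" "a k = c" and c: "c \<in> Obj C"
    using ij jk D(1) le af by (auto simp: c_def)
  have *: "f (u, w) = Id C c \<and> f (v, w) = Id C c \<and> f (u, v) = Id C c"
    if "u \<le> v" "v \<le> w" "w \<le> n" "a u = c" "a v = c" "a w = c"
      "f (u, v) = Id C c \<and> f (v, w) = Id C c \<or> f (u, v) = Id C c \<and> f (u, w) = Id C c \<or> f (v, w) = Id C c \<and> f (u, w) = Id C c"
    for u v w
  proof -
    have h: "f (u, v) \<in> Hom C c c" "f (v, w) \<in> Hom C c c"
      using D(2)[of u v] D(2)[of v w] that by simp_all
    have e: "f (u, w) = Comp C c c c (f (v, w)) (f (u, v))"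
      using D(4)[OF that(1-3)] that(4-6) by simp
    show ?thesis
      using that(7) Comp_Id_left[OF c c h(1)] Comp_Id_right[OF c c h(2)] e by (elim disjE conjE) simp_all
  qed
  have ij': "f (min i j, max i j) = Id C c" and jk': "f (min j k, max j k) = Id C c"
    using ij jk af obj by auto
  have "f (min i k, max i k) = Id C c"
  proof -
    consider "i \<le> j" "j \<le> k" | "i \<le> k" "k \<le> j" | "j \<le> i" "i \<le> k"
      | "j \<le> k" "k \<le> i" | "k \<le> i" "i \<le> j" | "k \<le> j" "j \<le> i" by linarith
    then show ?thesis
    proof cases
      case 1
      have ge: "i \<le> j" "j \<le> k" "i \<le> k" using 1 by linarith+
      have "f (i, j) = Id C c" "f (j, k) = Id C c"
        using ij' jk' ge unfolding min_def max_def by (metis order_antisym)+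
      then show ?thesis
        unfolding min_def max_def using ge *[OF ge(1,2) le(3) obj(1) obj(2) obj(3)] by (metis order_antisym)
    next
      case 2
      have ge: "i \<le> k" "k \<le> j" "i \<le> j" using 2 by linarith+
      have "f (i, j) = Id C c" "f (k, j) = Id C c"
        using ij' jk' ge unfolding min_def max_def by (metis order_antisym)+
      then show ?thesis
        unfolding min_def max_def using ge *[OF ge(1,2) le(2) obj(1) obj(3) obj(2)] by (metis order_antisym)
    next
      case 3
      have ge: "j \<le> i" "i \<le> k" "j \<le> k" using 3 by linarith+
      have "f (j, i) = Id C c" "f (j, k) = Id C c"
        using ij' jk' ge unfolding min_def max_def by (metis order_antisym)+
      then show ?thesis
        unfolding min_def max_def using ge *[OF ge(1,2) le(3) obj(2) obj(1) obj(3)] by (metis order_antisym)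
    next
      case 4
      have ge: "j \<le> k" "k \<le> i" "j \<le> i" using 4 by linarith+
      have "f (j, i) = Id C c" "f (j, k) = Id C c"
        using ij' jk' ge unfolding min_def max_def by (metis order_antisym)+
      then show ?thesis
        unfolding min_def max_def using ge *[OF ge(1,2) le(1) obj(2) obj(3) obj(1)] by (metis order_antisym)
    next
      case 5
      have ge: "k \<le> i" "i \<le> j" "k \<le> j" using 5 by linarith+
      have "f (i, j) = Id C c" "f (k, j) = Id C c"
        using ij' jk' ge unfolding min_def max_def by (metis order_antisym)+
      then show ?thesis
        unfolding min_def max_def using ge *[OF ge(1,2) le(2) obj(3) obj(1) obj(2)] by (metis order_antisym)
    next
      case 6
      have ge: "k \<le> j" "j \<le> i" "k \<le> i" using 6 by linarith+
      have "f (j, i) = Id C c" "f (k, j) = Id C c"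
        using ij' jk' ge unfolding min_def max_def by (metis order_antisym)+
      then show ?thesis
        unfolding min_def max_def using ge *[OF ge(1,2) le(1) obj(3) obj(2) obj(1)] by (metis order_antisym)
    qed
  qed
  then show ?thesis using obj af by simp
qed

text \<open>A degeneracy repeats a vertex, with identities between the copies, so such copies have to be treated
  as one vertex.\<close>

definition id_class :: "nat \<Rightarrow> (nat \<Rightarrow> 'o) \<times> (nat \<times> nat \<Rightarrow> 'm) \<Rightarrow> nat \<Rightarrow> nat set" where
  "id_class n x i = {j. j \<le> n \<and> id_joined x i j}"

lemma id_class_subset: "id_class n x i \<subseteq> {..n}" "finite (id_class n x i)"
  using finite_subset[of "id_class n x i" "{..n}"] by (auto simp: id_class_def)

lemma id_class_self: "x \<in> nerve_simplices C n \<Longrightarrow> i \<le> n \<Longrightarrow> i \<in> id_class n x i"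
  by (simp add: id_class_def id_joined_refl)

lemma id_class_eq: "x \<in> nerve_simplices C n \<Longrightarrow> i \<le> n \<Longrightarrow> j \<in> id_class n x i \<Longrightarrow> id_class n x j = id_class n x i"
  unfolding id_class_def using id_joined_trans id_joined_sym by blast

lemma id_class_obj: "j \<in> id_class n (a, f) i \<Longrightarrow> a j = a i"
  by (auto simp: id_class_def)

lemma id_class_ids:
  assumes "(a, f) \<in> nerve_simplices C n" "i \<le> n" "j \<in> id_class n (a, f) i" "k \<in> id_class n (a, f) i" "j \<le> k"
  shows "f (j, k) = Id C (a i)"
proof -
  have "id_joined (a, f) j k"
    using id_joined_trans[OF assms(1), of j i k] id_joined_sym assms by (auto simp: id_class_def simp del: id_joined.simps)
  then show ?thesis using id_joined_id assms id_class_obj by metis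
qed

definition majority :: "real \<Rightarrow> 'o \<Rightarrow> (nat \<times> ((nat \<Rightarrow> 'o) \<times> (nat \<times> nat \<Rightarrow> 'm))) \<times> (nat \<Rightarrow> real) \<Rightarrow> nat \<Rightarrow> bool" where
  "majority b c y i \<longleftrightarrow> (case y of ((n, x), t) \<Rightarrow>
     x \<in> nerve_simplices C n \<and> t \<in> standard_simplex n \<and> i \<le> n \<and> fst x i = c \<and> (\<Sum>j\<in>id_class n x i. wt b t j) > b / 2)"

text \<open>Two disjoint classes cannot both own more than half of the total \<open>b\<close>.\<close>

lemma majority_unique:
  assumes b: "0 < b" "b \<le> 1" and i: "majority b c ((n, x), t) i" and j: "majority b c' ((n, x), t) j"
  shows "id_class n x i = id_class n x j"
proof -
  have x: "x \<in> nerve_simplices C n" "t \<in> standard_simplex n" "i \<le> n" "j \<le> n"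
    and si: "(\<Sum>j\<in>id_class n x i. wt b t j) > b / 2" and sj: "(\<Sum>j\<in>id_class n x j. wt b t j) > b / 2"
    using i j by (auto simp: majority_def)
  have "id_class n x i \<inter> id_class n x j \<noteq> {}"
  proof
    assume "id_class n x i \<inter> id_class n x j = {}"
    then have "(\<Sum>j\<in>id_class n x i. wt b t j) + (\<Sum>j\<in>id_class n x j. wt b t j) = (\<Sum>j\<in>id_class n x i \<union> id_class n x j. wt b t j)"
      using id_class_subset by (subst sum.union_disjoint) auto
    also have "\<dots> \<le> (\<Sum>j\<le>n. wt b t j)"
      using id_class_subset wt_bounds[OF x(2)] by (intro sum_mono2) auto
    also have "\<dots> = b" using sum_wt[OF x(2)] b by simp
    finally show False using si sj by simp
  qed
  then obtain k where "k \<in> id_class n x i" "k \<in> id_class n x j" by blast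
  then show ?thesis using id_class_eq x by metis
qed

lemma id_joined_face:
  assumes "\<theta> \<in> simplex_ops m n" "i \<le> m" "j \<le> m"
  shows "id_joined (nerve_act m \<theta> x) i j \<longleftrightarrow> id_joined x (\<theta> i) (\<theta> j)"
proof -
  have mono: "\<theta> k \<le> \<theta> l" if "k \<le> l" "l \<le> m" for k l
    using assms(1) that by (auto simp: simplex_ops_def mono_on_def)
  have "\<theta> (min i j) = min (\<theta> i) (\<theta> j)" "\<theta> (max i j) = max (\<theta> i) (\<theta> j)"
    using mono[of i j] mono[of j i] assms by (auto simp: min_def max_def)
  then show ?thesis
    using assms by (cases x) (auto simp: nerve_act_def le_pairs_def)
qed

lemma id_class_face:
  assumes "\<theta> \<in> simplex_ops m n" "i \<le> m"
  shows "id_class m (nerve_act m \<theta> x) i = {j. j \<le> m \<and> \<theta> j \<in> id_class n x (\<theta> i)}"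
proof -
  have "id_joined (nerve_act m \<theta> x) i j \<longleftrightarrow> id_joined x (\<theta> i) (\<theta> j)" if "j \<le> m" for j
    by (rule id_joined_face[OF assms that])
  then show ?thesis using assms by (auto simp: id_class_def simplex_ops_def Pi_def)
qed

lemma sum_id_class_face:
  assumes \<theta>: "\<theta> \<in> simplex_ops m n" and i: "i \<le> m" and b: "0 \<le> b"
  shows "(\<Sum>j\<in>id_class n x (\<theta> i). wt b (simplex_push m \<theta> t) j) = (\<Sum>j\<in>id_class m (nerve_act m \<theta> x) i. wt b t j)"
proof -
  have "(\<Sum>j\<in>id_class n x (\<theta> i). wt b (simplex_push m \<theta> t) j) = (\<Sum>j\<in>id_class n x (\<theta> i). \<Sum>i | i \<le> m \<and> \<theta> i = j. wt b t i)"
    by (intro sum.cong refl wt_push[OF \<theta> b]) (use id_class_subset(1)[of n x "\<theta> i"] in auto)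
  also have "\<dots> = (\<Sum>j | j \<le> m \<and> \<theta> j \<in> id_class n x (\<theta> i). wt b t j)"
    by (rule sum_preimage_push[OF \<theta> id_class_subset(1)])
  finally show ?thesis unfolding id_class_face[OF \<theta> i] .
qed

text \<open>Together with \<open>majority_push_preimage\<close>, which finds an index over a given majority class, this makes
  the existence of a majority a condition on points of the realization.\<close>

lemma majority_face:
  assumes x: "x \<in> nerve_simplices C n" and \<theta>: "\<theta> \<in> simplex_ops m n" and t: "t \<in> standard_simplex m"
    and i: "i \<le> m" and b: "0 \<le> b"
  shows "majority b c ((m, nerve_act m \<theta> x), t) i \<longleftrightarrow> majority b c ((n, x), simplex_push m \<theta> t) (\<theta> i)"
proof -
  have "\<theta> i \<le> n" using \<theta> i by (auto simp: simplex_ops_def)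
  moreover have "fst (nerve_act m \<theta> x) i = fst x (\<theta> i)" using i by (simp add: nerve_act_def)
  ultimately show ?thesis
    using nerve_act_simplex[OF x \<theta>] simplex_push_in_simplex[OF \<theta> t] x t i sum_id_class_face[OF \<theta> i b]
    by (simp add: majority_def)
qed

lemma majority_id_class:
  assumes "majority b c ((n, x), t) i" "j \<in> id_class n x i"
  shows "majority b c ((n, x), t) j"
proof -
  have x: "x \<in> nerve_simplices C n" "i \<le> n" using assms by (auto simp: majority_def)
  obtain a f where af: "x = (a, f)" by (cases x)
  have "id_class n x j = id_class n x i" using id_class_eq[OF x assms(2)] .
  moreover have "j \<le> n" using assms(2) id_class_subset(1)[of n x i] by auto
  moreover have "fst x j = fst x i" using id_class_obj assms(2) af by fastforce
  ultimately show ?thesis using assms(1) by (simp add: majority_def)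
qed

text \<open>The majority class has positive weight after pushing forward, and this weight comes from indices that
  \<open>\<theta>\<close> maps into it.\<close>

lemma majority_push_preimage:
  assumes x: "x \<in> nerve_simplices C n" and \<theta>: "\<theta> \<in> simplex_ops m n" and t: "t \<in> standard_simplex m" and b: "0 < b"
    and k: "majority b c ((n, x), simplex_push m \<theta> t) k"
  shows "\<exists>i\<le>m. majority b c ((m, nerve_act m \<theta> x), t) i \<and> \<theta> i \<in> id_class n x k"
proof -
  have kn: "k \<le> n" "(\<Sum>j\<in>id_class n x k. wt b (simplex_push m \<theta> t) j) > b / 2" using k by (auto simp: majority_def)
  have "(\<Sum>j\<in>id_class n x k. wt b (simplex_push m \<theta> t) j) = (\<Sum>j\<in>id_class n x k. \<Sum>i | i \<le> m \<and> \<theta> i = j. wt b t i)"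
    by (intro sum.cong refl wt_push[OF \<theta>]) (use b id_class_subset(1)[of n x k] in auto)
  also have "\<dots> = (\<Sum>j | j \<le> m \<and> \<theta> j \<in> id_class n x k. wt b t j)"
    by (rule sum_preimage_push[OF \<theta> id_class_subset(1)])
  finally have "(\<Sum>j | j \<le> m \<and> \<theta> j \<in> id_class n x k. wt b t j) \<noteq> 0" using kn b by simp
  then obtain i where i: "i \<le> m" "\<theta> i \<in> id_class n x k" using sum.neutral[of "{j. j \<le> m \<and> \<theta> j \<in> id_class n x k}"] by blast
  have "majority b c ((m, nerve_act m \<theta> x), t) i"
    using majority_face[OF x \<theta> t i(1)] majority_id_class[OF k i(2)] b by simp
  then show ?thesis using i by blast
qed

section \<open>The contraction to a vertex\<close>

text \<open>The projection of the simplex to the face spanned by \<open>A\<close>, away from the opposite face.\<close>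

definition squash :: "nat set \<Rightarrow> (nat \<Rightarrow> real) \<Rightarrow> nat \<Rightarrow> real" where
  "squash A t = (\<lambda>j. if j \<in> A then t j / (\<Sum>k\<in>A. t k) else 0)"

lemma squash_in_simplex:
  assumes "t \<in> standard_simplex n" "A \<subseteq> {..n}" "(\<Sum>k\<in>A. t k) > 0"
  shows "squash A t \<in> standard_simplex n"
proof -
  have finA: "finite A" using assms(2) finite_subset by blast
  have t: "0 \<le> t j" for j using assms(1) by (simp add: standard_simplex_def)
  have "(\<Sum>j\<le>n. squash A t j) = (\<Sum>j\<in>A. t j / (\<Sum>k\<in>A. t k))"
    unfolding squash_def using assms(2) by (subst sum.inter_restrict[symmetric]) (auto simp: Int_absorb1)
  also have "\<dots> = 1" using assms(3) by (simp flip: sum_divide_distrib)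
  finally have "(\<Sum>j\<le>n. squash A t j) = 1" .
  moreover have "squash A t j \<le> 1" for j
    using member_le_sum[of j A t] finA t assms(3) by (auto simp: squash_def)
  ultimately show ?thesis
    using assms t by (auto simp: standard_simplex_def squash_def)
qed

lemma majority_weight_pos:
  assumes "majority b c ((n, x), t) i" "0 < b"
  shows "(\<Sum>k\<in>id_class n x i. t k) > 0"
proof -
  have "t \<in> standard_simplex n" using assms by (simp add: majority_def)
  then have "(\<Sum>k\<in>id_class n x i. wt b t k) \<le> (\<Sum>k\<in>id_class n x i. t k)" by (intro sum_mono wt_bounds)
  then show ?thesis using assms by (simp add: majority_def)
qed

definition center :: "real \<Rightarrow> 'o \<Rightarrow> (nat \<times> ((nat \<Rightarrow> 'o) \<times> (nat \<times> nat \<Rightarrow> 'm))) \<times> (nat \<Rightarrow> real) \<Rightarrow> nat \<Rightarrow> real" where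
  "center b c y = squash (id_class (fst (fst y)) (snd (fst y)) (SOME i. majority b c y i)) (snd y)"

lemma center_eq:
  assumes "0 < b" "b \<le> 1" "majority b c ((n, x), t) i"
  shows "center b c ((n, x), t) = squash (id_class n x i) t"
proof -
  have "majority b c ((n, x), t) (SOME i. majority b c ((n, x), t) i)"
    using assms(3) by (rule someI)
  from majority_unique[OF assms(1,2) this assms(3)] show ?thesis
    unfolding center_def fst_conv snd_conv by (rule arg_cong[where f = "\<lambda>A. squash A t"])
qed

lemma center_in_simplex:
  assumes "0 < b" "b \<le> 1" "majority b c ((n, x), t) i"
  shows "center b c ((n, x), t) \<in> standard_simplex n"
  unfolding center_eq[OF assms]
  by (rule squash_in_simplex[OF _ id_class_subset(1) majority_weight_pos[OF assms(3,1)]])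
     (use assms(3) in \<open>simp add: majority_def\<close>)

text \<open>The straight path from a point to the point that has all its weight on the majority class; the
  latter point of the realization is the vertex \<open>c\<close>.\<close>

definition track :: "real \<Rightarrow> 'o \<Rightarrow> (nat \<times> ((nat \<Rightarrow> 'o) \<times> (nat \<times> nat \<Rightarrow> 'm))) \<times> (nat \<Rightarrow> real) \<Rightarrow> real \<Rightarrow> _" where
  "track b c y r = glue_map NC (fst y, segment (snd y) (center b c y) r)"

definition majority_points :: "real \<Rightarrow> 'o \<Rightarrow> _" where
  "majority_points b c = {y. \<exists>i. majority b c y i}"

lemma simplex_push_segment: "simplex_push m \<theta> (segment t u r) = segment (simplex_push m \<theta> t) (simplex_push m \<theta> u) r"
  by (simp add: simplex_push_def segment_def sum.distrib sum_distrib_left fun_eq_iff)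

lemma center_push:
  assumes b: "0 < b" "b \<le> 1" and x: "x \<in> nerve_simplices C n" and \<theta>: "\<theta> \<in> simplex_ops m n" and t: "t \<in> standard_simplex m"
    and i: "majority b c ((m, nerve_act m \<theta> x), t) i"
  shows "simplex_push m \<theta> (center b c ((m, nerve_act m \<theta> x), t)) = center b c ((n, x), simplex_push m \<theta> t)"
proof
  fix j
  have im: "i \<le> m" using i by (simp add: majority_def)
  have i': "majority b c ((n, x), simplex_push m \<theta> t) (\<theta> i)" using majority_face[OF x \<theta> t im] i b by simp
  let ?A = "id_class n x (\<theta> i)" and ?B = "id_class m (nerve_act m \<theta> x) i"
  have tot: "(\<Sum>k\<in>?A. simplex_push m \<theta> t k) = (\<Sum>k\<in>?B. t k)"
    unfolding simplex_push_def sum_preimage_push[OF \<theta> id_class_subset(1)] id_class_face[OF \<theta> im] ..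
  have B: "k \<in> ?B \<longleftrightarrow> k \<le> m \<and> \<theta> k \<in> ?A" for k unfolding id_class_face[OF \<theta> im] by simp
  have "simplex_push m \<theta> (squash ?B t) j = (\<Sum>k | k \<le> m \<and> \<theta> k = j. if j \<in> ?A then t k / (\<Sum>k\<in>?B. t k) else 0)"
    unfolding simplex_push_def squash_def by (intro sum.cong refl) (use B in auto)
  also have "\<dots> = squash ?A (simplex_push m \<theta> t) j"
    unfolding squash_def tot by (simp add: simplex_push_def sum_divide_distrib)
  finally show "simplex_push m \<theta> (center b c ((m, nerve_act m \<theta> x), t)) j = center b c ((n, x), simplex_push m \<theta> t) j"
    unfolding center_eq[OF b i] center_eq[OF b i'] .
qed

text \<open>Pushing forward is affine and commutes with \<open>center\<close>, so the tracks of two representatives of a point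
  are equal in the realization.\<close>

lemma track_glue:
  assumes b: "0 < b" "b \<le> 1" and eq: "glue_map NC y = glue_map NC z"
  shows "(y \<in> majority_points b c \<longleftrightarrow> z \<in> majority_points b c) \<and>
    (y \<in> majority_points b c \<longrightarrow> (\<forall>r\<in>{0..1}. track b c y r = track b c z r))"
proof -
  have "(y, z) \<in> realization_equiv NC" using eq glue_map_eq_iff by blast
  then show ?thesis
  proof (rule realization_equiv_invariant)
    fix m n \<theta> x and t :: "nat \<Rightarrow> real"
    assume x: "x \<in> simps_of NC n" and \<theta>: "\<theta> \<in> simplex_ops m n" and t: "t \<in> standard_simplex m"
    let ?y = "((m, simp_act NC m n \<theta> x), t)" and ?z = "((n, x), simplex_push m \<theta> t)"
    have x': "x \<in> nerve_simplices C n" using x by simp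
    have "?y \<in> majority_points b c \<longleftrightarrow> ?z \<in> majority_points b c"
    proof
      assume "?y \<in> majority_points b c"
      then obtain i where i: "majority b c ?y i" by (auto simp: majority_points_def)
      then have "i \<le> m" by (simp add: majority_def)
      then show "?z \<in> majority_points b c"
        using majority_face[OF x' \<theta> t] i b by (auto simp: majority_points_def)
    next
      assume "?z \<in> majority_points b c"
      then show "?y \<in> majority_points b c"
        using majority_push_preimage[OF x' \<theta> t b(1)] by (auto simp: majority_points_def)
    qed
    moreover have "track b c ?y r = track b c ?z r" if y: "?y \<in> majority_points b c" and r: "r \<in> {0..1}" for r
    proof -
      obtain i where i: "majority b c ((m, nerve_act m \<theta> x), t) i" using y by (auto simp: majority_points_def)
      have "segment t (center b c ((m, nerve_act m \<theta> x), t)) r \<in> standard_simplex m"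
        by (rule segment_in_simplex[OF t center_in_simplex[OF b i] r])
      from glue_map_face[OF x \<theta> this] show ?thesis
        unfolding track_def simplex_push_segment center_push[OF b x' \<theta> t i] by simp
    qed
    ultimately show "(?y \<in> majority_points b c \<longleftrightarrow> ?z \<in> majority_points b c) \<and>
       (?y \<in> majority_points b c \<longrightarrow> (\<forall>r\<in>{0..1}. track b c ?y r = track b c ?z r))" by blast
  qed blast+
qed

definition majority_open :: "real \<Rightarrow> 'o \<Rightarrow> _" where
  "majority_open b c = glue_map NC ` majority_points b c"

text \<open>A contraction of \<open>majority_open b c\<close> to the vertex \<open>c\<close>, through points of the whole realization.\<close>

definition contract :: "real \<Rightarrow> 'o \<Rightarrow> _ \<Rightarrow> real \<Rightarrow> _" where
  "contract b c z r = track b c (SOME y. y \<in> majority_points b c \<and> glue_map NC y = z) r"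

lemma contract_glue:
  assumes "0 < b" "b \<le> 1" "y \<in> majority_points b c" "r \<in> {0..1}"
  shows "contract b c (glue_map NC y) r = track b c y r"
proof -
  let ?y = "SOME y'. y' \<in> majority_points b c \<and> glue_map NC y' = glue_map NC y"
  have "?y \<in> majority_points b c \<and> glue_map NC ?y = glue_map NC y"
    by (rule someI[of _ y]) (use assms in simp)
  then have y: "?y \<in> majority_points b c" "glue_map NC ?y = glue_map NC y" by blast+
  show ?thesis
    unfolding contract_def using track_glue[OF assms(1,2) y(2), of c] y(1) assms(4) by blast
qed

lemma glue_in_majority_open_iff:
  assumes "0 < b" "b \<le> 1"
  shows "glue_map NC y \<in> majority_open b c \<longleftrightarrow> y \<in> majority_points b c"
proof
  assume "glue_map NC y \<in> majority_open b c"
  then obtain z where "z \<in> majority_points b c" "glue_map NC y = glue_map NC z"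
    by (auto simp: majority_open_def)
  then show "y \<in> majority_points b c" using track_glue[OF assms, of y z c] by blast
qed (simp add: majority_open_def)

lemma continuous_wt: "continuous_map (simplex_topology n) euclideanreal (\<lambda>t. wt b t i)"
proof -
  have k: "continuous_map (simplex_topology n) euclideanreal (\<lambda>t. t k)" for k
    unfolding simplex_topology_def
    by (intro continuous_map_from_subtopology continuous_map_product_projection) simp
  show ?thesis
    unfolding wt_def partial_weight_def
    by (intro continuous_map_diff continuous_map_real_min continuous_map_sum k) auto
qed

lemma openin_majority:
  assumes "x \<in> nerve_simplices C n" "i \<le> n" "fst x i = c"
  shows "openin (simplex_topology n) {t. majority b c ((n, x), t) i}"
proof -
  have "continuous_map (simplex_topology n) euclideanreal (\<lambda>t. \<Sum>j\<in>id_class n x i. wt b t j)"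
    by (intro continuous_map_sum continuous_wt id_class_subset)
  from openin_continuous_map_preimage[OF this, of "{b/2<..}"]
  show ?thesis using assms by (simp add: majority_def)
qed

lemma openin_majority_points:
  "openin (simplex_sum NC) (majority_points b c)"
proof -
  have "openin (simplex_topology n) {t. ((n, x), t) \<in> majority_points b c}" if x: "x \<in> nerve_simplices C n" for n x
  proof -
    have "{t. ((n, x), t) \<in> majority_points b c} = (\<Union>i\<in>{i. i \<le> n \<and> fst x i = c}. {t. majority b c ((n, x), t) i})"
      by (auto simp: majority_points_def majority_def)
    then show ?thesis using openin_majority[OF x] by (auto intro!: openin_Union)
  qed
  moreover have "majority_points b c \<subseteq> Sigma (SIGMA n:UNIV. simps_of NC n) (topspace \<circ> (\<lambda>(n, x). simplex_topology n))"
    by (auto simp: majority_points_def majority_def)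
  ultimately show ?thesis
    unfolding simplex_sum_def openin_sum_topology by auto
qed

lemma openin_majority_open:
  assumes "0 < b" "b \<le> 1"
  shows "openin RC (majority_open b c)"
proof -
  have sub: "majority_open b c \<subseteq> topspace RC"
    using openin_subset[OF openin_majority_points] quotient_imp_surjective_map[OF quotient_map_glue]
    unfolding majority_open_def by blast
  have "{y \<in> topspace (simplex_sum NC). glue_map NC y \<in> majority_open b c} = majority_points b c"
    using openin_subset[OF openin_majority_points] glue_in_majority_open_iff[OF assms] by blast
  then show ?thesis
    using quotient_map_glue[of NC, unfolded quotient_map_def, THEN conjunct2, rule_format, OF sub]
      openin_majority_points by simp
qed

text \<open>The unit interval is locally compact, so its product with the quotient map onto the realization
  is again a quotient map (Whitehead). Continuity can therefore be checked on the product of the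
  interval with each simplex, where the contraction is given by a formula.\<close>

lemma continuous_contract:
  assumes b: "0 < b" "b \<le> 1"
  shows "continuous_map (subtopology (prod_topology unit_interval RC) ({0..1} \<times> majority_open b c)) RC
    (\<lambda>(r, z). contract b c z r)"
proof -
  let ?Y = "simplex_sum NC" and ?Q = "\<lambda>(r, y). (r, glue_map NC y)"
  let ?P = "prod_topology unit_interval RC" and ?PY = "prod_topology unit_interval ?Y"
  let ?W = "{0..1::real} \<times> majority_open b c"
  have Q: "quotient_map ?PY ?P ?Q"
  proof (rule quotient_map_prod_right[OF _ _ quotient_map_glue])
    have "compact_space unit_interval"
      by (intro compact_space_subtopology) simp
    then show "locally_compact_space unit_interval" by (rule compact_imp_locally_compact_space)
    show "Hausdorff_space unit_interval \<or> regular_space unit_interval"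
      by (simp add: Hausdorff_space_subtopology)
  qed
  have W: "openin ?P ?W"
    using openin_majority_open[OF b] by (simp add: openin_prod_Times_iff)
  have WP: "?W \<subseteq> topspace ?P" by (rule openin_subset[OF W])
  have "openin ?P {w \<in> ?W. (\<lambda>(r, z). contract b c z r) w \<in> V}" if V: "openin RC V" for V
  proof -
    let ?T = "{w \<in> ?W. (\<lambda>(r, z). contract b c z r) w \<in> V}"
    let ?E = "{w \<in> topspace ?PY. ?Q w \<in> ?T}"
    have E: "w \<in> ?E \<longleftrightarrow> (case w of (r, y) \<Rightarrow> r \<in> {0..1} \<and> y \<in> majority_points b c \<and> track b c y r \<in> V)" for w
      using glue_in_majority_open_iff[OF b] contract_glue[OF b] openin_subset[OF openin_majority_points]
      by (cases w) (auto; blast)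
    \<comment> \<open>A neighbourhood of a point in the preimage, inside the simplex \<open>x\<close> where the index \<open>i\<close> keeps its
      majority.\<close>
    have "openin ?PY ?E"
    proof (subst openin_subopen, intro ballI)
      fix w assume w: "w \<in> ?E"
      obtain r0 n x t0 where wr: "w = (r0, ((n, x), t0))" by (metis surj_pair)
      have r0: "r0 \<in> {0..1}" and mp: "((n, x), t0) \<in> majority_points b c" and V0: "track b c ((n, x), t0) r0 \<in> V"
        using w unfolding E wr by auto
      obtain i where i: "majority b c ((n, x), t0) i" using mp by (auto simp: majority_points_def)
      then have x: "x \<in> nerve_simplices C n" "t0 \<in> standard_simplex n" "i \<le> n" "fst x i = c" by (auto simp: majority_def)
      let ?O = "{t. majority b c ((n, x), t) i}"
      have O: "openin (simplex_topology n) ?O" by (rule openin_majority[OF x(1,3,4)])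
      let ?F = "\<lambda>(r, t). segment t (squash (id_class n x i) t) r"
      let ?Z = "subtopology (prod_topology unit_interval (simplex_topology n)) ({0..1} \<times> ?O)"
      have cont_r: "continuous_map ?Z euclideanreal fst"
        using continuous_map_from_subtopology[OF continuous_map_fst[of unit_interval "simplex_topology n"]]
        by (auto simp: continuous_map_in_subtopology)
      have cont_t: "continuous_map ?Z euclideanreal (\<lambda>w. snd w k)" for k
      proof -
        have "continuous_map ?Z (simplex_topology n) snd"
          by (rule continuous_map_from_subtopology[OF continuous_map_snd])
        then show ?thesis unfolding continuous_map_simplex_topology by blast
      qed
      have pos: "(\<Sum>k\<in>id_class n x i. snd w k) \<noteq> 0" if "w \<in> topspace ?Z" for w
        using that majority_weight_pos[OF _ b(1), of c n x "snd w" i] by auto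
      have "continuous_map ?Z (simplex_topology n) ?F"
        unfolding continuous_map_simplex_topology
      proof (intro conjI allI)
        fix k
        have "continuous_map ?Z euclideanreal (\<lambda>w. squash (id_class n x i) (snd w) k)"
          unfolding squash_def using pos
          by (cases "k \<in> id_class n x i") (auto intro!: continuous_map_real_divide continuous_map_sum cont_t id_class_subset)
        then show "continuous_map ?Z euclideanreal (\<lambda>z. ?F z k)"
          unfolding segment_def case_prod_unfold
          by (intro continuous_map_add continuous_map_real_mult continuous_map_diff cont_r cont_t) auto
        show "?F ` topspace ?Z \<subseteq> standard_simplex n"
          using squash_in_simplex[OF _ id_class_subset(1)[of n x i]] majority_weight_pos[OF _ b(1), of c n x _ i]
          by (auto intro!: segment_in_simplex)
      qed
      from continuous_map_compose[OF this continuous_realization_point[of x NC n]]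
      have cF: "continuous_map ?Z RC (\<lambda>w. realization_point NC n x (?F w))"
        using x(1) by (simp add: o_def)
      have "openin ?Z {w \<in> topspace ?Z. realization_point NC n x (?F w) \<in> V}"
        by (rule openin_continuous_map_preimage[OF cF V])
      moreover have "openin (prod_topology unit_interval (simplex_topology n)) ({0..1} \<times> ?O)"
        using O by (simp add: openin_prod_Times_iff)
      ultimately have op: "openin (prod_topology unit_interval (simplex_topology n))
          {w \<in> topspace ?Z. realization_point NC n x (?F w) \<in> V}" (is "openin _ ?B")
        by (rule openin_trans_full)
      have tr: "track b c ((n, x), t) r = realization_point NC n x (?F (r, t))" if "majority b c ((n, x), t) i" for r t
        using that center_eq[OF b that] by (simp add: track_def realization_point_glue)
      have "(r0, t0) \<in> ?B" using r0 i x(2) V0 tr[OF i] by simp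
      then obtain R T where RT: "openin unit_interval R" "openin (simplex_topology n) T" "r0 \<in> R" "t0 \<in> T" "R \<times> T \<subseteq> ?B"
      proof -
        have "\<exists>U W. openin unit_interval U \<and> openin (simplex_topology n) W \<and> r0 \<in> U \<and> t0 \<in> W \<and> U \<times> W \<subseteq> ?B"
          using op[unfolded openin_prod_topology_alt, rule_format, OF \<open>(r0, t0) \<in> ?B\<close>] .
        then show thesis using that by (elim exE conjE)
      qed
      have T': "openin ?Y (Pair (n, x) ` T)"
        using open_map_component_injection[of "(n, x)" "SIGMA n:UNIV. simps_of NC n" "\<lambda>(n, x). simplex_topology n"] x(1) RT(2)
        unfolding open_map_def simplex_sum_def by simp
      show "\<exists>T. openin ?PY T \<and> w \<in> T \<and> T \<subseteq> ?E"
      proof (intro exI conjI)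
        show "openin ?PY (R \<times> Pair (n, x) ` T)" using T' RT(1) by (simp add: openin_prod_Times_iff)
        show "w \<in> R \<times> Pair (n, x) ` T" using RT wr by simp
        show "R \<times> Pair (n, x) ` T \<subseteq> ?E"
        proof
          fix v assume "v \<in> R \<times> Pair (n, x) ` T"
          then obtain r t where v: "v = (r, ((n, x), t))" "(r, t) \<in> R \<times> T" by auto
          then have "(r, t) \<in> ?B" using RT(5) by blast
          then have "r \<in> {0..1}" "majority b c ((n, x), t) i" "track b c ((n, x), t) r \<in> V" using tr by auto
          then show "v \<in> ?E" unfolding E v by (auto simp: majority_points_def)
        qed
      qed
    qed
    moreover have "?T \<subseteq> topspace ?P" using WP by blast
    ultimately show ?thesis using Q unfolding quotient_map_def by blast
  qed
  then have "openin (subtopology ?P ?W) {w \<in> topspace (subtopology ?P ?W). (\<lambda>(r, z). contract b c z r) w \<in> V}" if "openin RC V" for V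
    using that WP openin_open_subtopology[OF W] by (auto simp: Int_absorb1 Collect_conj_eq)
  moreover have "(\<lambda>(r, z). contract b c z r) \<in> topspace (subtopology ?P ?W) \<rightarrow> topspace RC"
  proof -
    have "contract b c z r \<in> topspace RC" if r: "r \<in> {0..1}" and z: "z \<in> majority_open b c" for r z
    proof -
      obtain y where y: "y \<in> majority_points b c" "z = glue_map NC y" using z by (auto simp: majority_open_def)
      obtain n x t where yy: "y = ((n, x), t)" by (metis surj_pair)
      obtain i where i: "majority b c ((n, x), t) i" using y yy by (auto simp: majority_points_def)
      then have "x \<in> nerve_simplices C n" "t \<in> standard_simplex n" by (auto simp: majority_def)
      then have "((n, x), segment t (center b c y) r) \<in> topspace (simplex_sum NC)"
        using segment_in_simplex[OF _ center_in_simplex[OF b i] r] yy by (simp add: topspace_simplex_sum)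
      then have "track b c y r \<in> topspace RC"
        unfolding track_def using quotient_imp_surjective_map[OF quotient_map_glue] yy by auto
      then show ?thesis using contract_glue[OF b y(1) r] y(2) by simp
    qed
    then show ?thesis by auto
  qed
  ultimately show ?thesis unfolding continuous_map_def by blast
qed

section \<open>Every loop is generated by edges\<close>

text \<open>Let \<open>i\<close> be the first vertex of positive weight and \<open>b = t\<^sub>i\<close>: then vertex \<open>i\<close> owns everything below
  \<open>b\<close>.\<close>

lemma majority_open_cover:
  assumes "z \<in> topspace RC"
  obtains b c where "0 < b" "b \<le> 1" "z \<in> majority_open b c"
proof -
  obtain y where y: "y \<in> topspace (simplex_sum NC)" "z = glue_map NC y"
    using assms quotient_imp_surjective_map[OF quotient_map_glue] by blast
  obtain n x t where yy: "y = ((n, x), t)" by (metis surj_pair)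
  have x: "x \<in> nerve_simplices C n" and t: "t \<in> standard_simplex n" using y yy by (auto simp: topspace_simplex_sum)
  have t0: "0 \<le> t k" "t k \<le> 1" "(\<Sum>i\<le>n. t i) = 1" for k using t by (auto simp: standard_simplex_def)
  have ex: "\<exists>i. i \<le> n \<and> t i > 0"
  proof (rule ccontr)
    assume "\<not> ?thesis"
    then have "t i = 0" if "i \<le> n" for i using t0(1)[of i] that by force
    then show False using t0(3) by simp
  qed
  define i where "i = (LEAST i. i \<le> n \<and> t i > 0)"
  have i: "i \<le> n" "t i > 0" unfolding i_def using LeastI_ex[OF ex] by blast+
  have "t k = 0" if "k < i" for k
    using not_less_Least[of k "\<lambda>i. i \<le> n \<and> t i > 0"] that i(1) t0(1)[of k] unfolding i_def by force
  then have "partial_weight t i = 0" by (simp add: partial_weight_def)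
  then have "wt (t i) t i = t i" using i by (simp add: wt_def partial_weight_Suc)
  moreover have "wt (t i) t i \<le> (\<Sum>j\<in>id_class n x i. wt (t i) t j)"
    using id_class_self[OF x i(1)] wt_bounds(1)[OF t] id_class_subset(2)[of n x i] by (intro member_le_sum) auto
  ultimately have "majority (t i) (fst x i) ((n, x), t) i"
    using x t i by (simp add: majority_def)
  then have "z \<in> majority_open (t i) (fst x i)"
    unfolding y(2) yy majority_open_def majority_points_def by blast
  then show thesis using that[of "t i"] i t0(2) by blast
qed

lemma majority_openE:
  assumes "z \<in> majority_open b c"
  obtains n a f t i where "z = realization_point NC n (a, f) t" "majority b c ((n, (a, f)), t) i"
proof -
  obtain y where y: "z = glue_map NC y" "y \<in> majority_points b c" using assms by (auto simp: majority_open_def)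
  obtain n a f t where "y = ((n, (a, f)), t)" by (metis surj_pair)
  then show thesis using that y by (auto simp: majority_points_def realization_point_glue)
qed

lemma contract_realization_point:
  assumes "0 < b" "b \<le> 1" "majority b c ((n, x), t) i" "r \<in> {0..1}"
  shows "contract b c (realization_point NC n x t) r =
    realization_point NC n x (segment t (squash (id_class n x i) t) r)"
proof -
  have "((n, x), t) \<in> majority_points b c" using assms(3) by (auto simp: majority_points_def)
  from contract_glue[OF assms(1,2) this assms(4)] show ?thesis
    using center_eq[OF assms(1-3)] by (simp add: realization_point_glue track_def)
qed

lemma vert_on_id_class:
  assumes "majority b c ((n, (a, f)), t) i" "u \<in> standard_simplex n" "\<And>k. k \<notin> id_class n (a, f) i \<Longrightarrow> u k = 0"
  shows "realization_point NC n (a, f) u = vert c"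
proof -
  have x: "(a, f) \<in> nerve_simplices C n" "i \<le> n" "a i = c" using assms(1) by (auto simp: majority_def)
  show ?thesis
  proof (rule realization_point_on_identities[OF x(1) assms(2) id_class_subset(1)])
    show "id_class n (a, f) i \<noteq> {}" using id_class_self[OF x(1,2)] by blast
    show "u k = 0" if "k \<notin> id_class n (a, f) i" for k using assms(3) that by blast
    show "a k = c" if "k \<in> id_class n (a, f) i" for k using id_class_obj[OF that] x(3) by simp
    show "f (j, k) = Id C c" if "j \<in> id_class n (a, f) i" "k \<in> id_class n (a, f) i" "j \<le> k" for j k
      using id_class_ids[OF x(1,2) that] x(3) by simp
  qed
qed

lemma majority_simplex:
  assumes b: "0 < b" and m: "majority b c ((n, (a, f)), t) i"
  shows "(a, f) \<in> nerve_simplices C n" "t \<in> standard_simplex n" "i \<le> n" "a i = c"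
    "squash (id_class n (a, f) i) t \<in> standard_simplex n" "corner i \<in> standard_simplex n" "c \<in> Obj C"
proof -
  show x: "(a, f) \<in> nerve_simplices C n" "t \<in> standard_simplex n" "i \<le> n" "a i = c" using m by (auto simp: majority_def)
  show "squash (id_class n (a, f) i) t \<in> standard_simplex n"
    by (rule squash_in_simplex[OF x(2) id_class_subset(1) majority_weight_pos[OF m b]])
  show "corner i \<in> standard_simplex n" by (rule corner_in_simplex[OF x(3)])
  show "c \<in> Obj C" using nerve_simplexD(1)[OF x(1,3)] x(4) by simp
qed

lemma path_between_contract:
  assumes b: "0 < b" "b \<le> 1" and z: "z \<in> majority_open b c"
  shows "path_between RC z (vert c) (contract b c z)"
proof -
  obtain n a f t i where zz: "z = realization_point NC n (a, f) t" and m: "majority b c ((n, (a, f)), t) i"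
    using majority_openE[OF z] by blast
  note x = majority_simplex[OF b(1) m]
  let ?S = "squash (id_class n (a, f) i) t"
  have v: "realization_point NC n (a, f) ?S = vert c"
    by (rule vert_on_id_class[OF m x(5)]) (simp add: squash_def)
  have p: "path_between RC z (vert c) (\<lambda>r. realization_point NC n (a, f) (segment t ?S r))"
    using path_in_simplex[OF _ path_between_segment[OF x(2,5)], of "(a, f)" NC] x(1) v zz by simp
  have "path_homotopic RC (\<lambda>r. realization_point NC n (a, f) (segment t ?S r)) (contract b c z)"
    by (rule path_homotopic_eqI[OF p]) (use contract_realization_point[OF b m] zz in auto)
  from path_homotopic_between[OF this] show ?thesis using p by simp
qed

text \<open>The contraction along \<open>p\<close> is a map of a square, three of whose sides are \<open>p\<close> and the two
  contraction paths, while the fourth side is constant at \<open>c\<close>.\<close>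

lemma contract_square:
  assumes b: "0 < b" "b \<le> 1" and p: "path_between RC z w p"
    and sub: "\<And>u. u \<in> {0..1} \<Longrightarrow> p u \<in> majority_open b c"
  shows "path_homotopic RC (p \<star> contract b c w) (contract b c z)"
proof -
  let ?K = "{0..1::real} \<times> {0..1::real}"
  define F where "F = (\<lambda>(r, u). contract b c (p u) r)"
  have zw: "p 0 = z" "p 1 = w" using p by (simp_all add: path_between_def)
  have "continuous_map (top_of_set ?K) (subtopology (prod_topology unit_interval RC) ({0..1} \<times> majority_open b c))
    (\<lambda>(r, u). (r, p u))"
  proof (rule continuous_map_into_subtopology)
    have K: "top_of_set ?K = prod_topology unit_interval unit_interval"
      by (simp add: prod_topology_subtopology(1)[symmetric] subtopology_Times[symmetric])
    show "continuous_map (top_of_set ?K) (prod_topology unit_interval RC) (\<lambda>(r, u). (r, p u))"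
      unfolding K case_prod_unfold continuous_map_paired
      by (intro conjI continuous_map_fst
            continuous_map_compose[OF continuous_map_snd path_betweenD(1)[OF p], unfolded o_def])
  qed (use sub in auto)
  from continuous_map_compose[OF this continuous_contract[OF b]]
  have F: "continuous_map (top_of_set ?K) RC F" by (simp add: o_def F_def case_prod_unfold)
  have seg: "path_between (top_of_set ?K) (r, u) (r', u') (\<lambda>s. ((1 - s) * r + s * r', (1 - s) * u + s * u'))"
    if "(r, u) \<in> ?K" "(r', u') \<in> ?K" for r u r' u'
  proof -
    have "(1 - s) * a + s * a' \<in> {0..1}" if "s \<in> {0..1}" "a \<in> {0..1}" "a' \<in> {0..1}" for s a a' :: real
      using that convexD_alt[of "{0..1::real}" a a' s] by simp
    then show ?thesis
      using that by (auto simp: path_between_def pathin_def intro!: continuous_intros)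
  qed
  let ?A = "\<lambda>s::real. (0::real, s)" and ?B = "\<lambda>s::real. (s, 1::real)"
    and ?C = "\<lambda>s::real. (s, 0::real)" and ?D = "\<lambda>s::real. (1::real, s)"
  have AB: "path_between (top_of_set ?K) (0, 0) (1, 1) (?A \<star> ?B)"
    using path_between_join[OF seg[of 0 0 0 1] seg[of 0 1 1 1]] by simp
  have CD: "path_between (top_of_set ?K) (0, 0) (1, 1) (?C \<star> ?D)"
    using path_between_join[OF seg[of 0 0 1 0] seg[of 1 0 1 1]] by simp
  have h: "path_homotopic RC (F \<circ> (?A \<star> ?B)) (F \<circ> (?C \<star> ?D))"
  proof (rule path_homotopic_via_convex[OF F])
    show "convex ?K" by (intro convex_Times) auto
    show "continuous_on {0..1} (?A \<star> ?B)" "(?A \<star> ?B) ` {0..1} \<subseteq> ?K"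
      using path_betweenD(1)[OF AB] by (simp_all add: image_subset_iff_funcset)
    show "continuous_on {0..1} (?C \<star> ?D)" "(?C \<star> ?D) ` {0..1} \<subseteq> ?K"
      using path_betweenD(1)[OF CD] by (simp_all add: image_subset_iff_funcset)
  qed (auto simp: path_join_def)
  have z: "z \<in> majority_open b c" and w: "w \<in> majority_open b c" using sub[of 0] sub[of 1] zw by auto
  note cz = path_between_contract[OF b z] and cw = path_between_contract[OF b w]
  have pc: "contract b c (p s) 0 = p s" "contract b c (p s) 1 = vert c" if "s \<in> {0..1}" for s
    using path_betweenD(2,3)[OF path_between_contract[OF b sub[OF that]]] .
  have 1: "path_homotopic RC (p \<star> contract b c w) (F \<circ> (?A \<star> ?B))"
    by (rule path_homotopic_eqI[OF path_between_join[OF p cw]]) (use pc zw in \<open>auto simp: F_def path_join_def\<close>)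
  have vc: "path_between RC (vert c) (vert c) (\<lambda>s. vert c)"
    by (rule path_between_const[OF path_between_topspace(2)[OF cz]])
  have 2: "path_homotopic RC (contract b c z \<star> (\<lambda>s. vert c)) (F \<circ> (?C \<star> ?D))"
    by (rule path_homotopic_eqI[OF path_between_join[OF cz vc]]) (use pc zw in \<open>auto simp: F_def path_join_def\<close>)
  show ?thesis
    by (rule path_homotopic_trans[OF path_homotopic_trans[OF 1 h]
          path_homotopic_trans[OF path_homotopic_sym[OF 2] path_homotopic_const_right[OF cz]]])
qed

text \<open>After its arrival at the vertex \<open>c\<close>, the contraction path can be prolonged inside the simplex to the
  corner \<open>i\<close>: this prolongation is constant in the realization, since it stays on the majority class.\<close>

lemma contract_homotopic_segment:
  assumes b: "0 < b" "b \<le> 1" and m: "majority b c ((n, (a, f)), t) i"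
  shows "path_homotopic RC (contract b c (realization_point NC n (a, f) t))
    (\<lambda>r. realization_point NC n (a, f) (segment t (corner i) r))"
proof -
  note x = majority_simplex[OF b(1) m]
  let ?S = "squash (id_class n (a, f) i) t" and ?pt = "realization_point NC n (a, f)"
  have x': "(a, f) \<in> simps_of NC n" using x by simp
  note s1 = path_between_segment[OF x(2,5)] and s2 = path_between_segment[OF x(5,6)] and s3 = path_between_segment[OF x(2,6)]
  have i: "i \<in> id_class n (a, f) i" by (rule id_class_self[OF x(1,3)])
  have const: "?pt (segment ?S (corner i) r) = vert c" if "r \<in> {0..1}" for r
    by (rule vert_on_id_class[OF m segment_in_simplex[OF x(5,6) that]])
       (use i in \<open>auto simp: segment_def squash_def corner_def\<close>)
  have z: "?pt t \<in> majority_open b c"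
    using m by (auto simp: majority_open_def majority_points_def realization_point_glue)
  note cz = path_between_contract[OF b z]
  have vc: "path_between RC (vert c) (vert c) (\<lambda>s. vert c)"
    by (rule path_between_const[OF path_between_topspace(2)[OF cz]])
  have "path_homotopic RC (contract b c (?pt t)) (contract b c (?pt t) \<star> (\<lambda>s. vert c))"
    by (rule path_homotopic_sym[OF path_homotopic_const_right[OF cz]])
  also have "path_homotopic RC \<dots> (\<lambda>r. ?pt ((segment t ?S \<star> segment ?S (corner i)) r))"
    by (rule path_homotopic_eqI[OF path_between_join[OF cz vc]])
       (use contract_realization_point[OF b m] const in \<open>auto simp: path_join_def\<close>)
  also have "path_homotopic RC \<dots> (\<lambda>r. ?pt (segment t (corner i) r))"
    by (rule paths_in_simplex_homotopic[OF x' path_between_join[OF s1 s2] s3])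
  finally show ?thesis .
qed

lemma majority_base:
  assumes "c \<in> Obj C"
  shows "majority 1 c ((0, nerve_vertex C c), corner 0) 0" "realization_point NC 0 (nerve_vertex C c) (corner 0) = vert c"
proof -
  have "id_class 0 (nerve_vertex C c) 0 = {0}"
    using id_class_self[OF nerve_vertex_simplex[OF assms], of 0] id_class_subset(1)[of 0 "nerve_vertex C c" 0] by auto
  then show "majority 1 c ((0, nerve_vertex C c), corner 0) 0"
    using nerve_vertex_simplex[OF assms] corner_in_simplex[of 0 0]
    by (simp add: majority_def wt_def partial_weight_def corner_def nerve_vertex_def)
  show "realization_point NC 0 (nerve_vertex C c) (corner 0) = vert c"
    by (simp add: vert_def vertex_point_def corner_def)
qed

end

locale based_category = small_category C for C :: "('o, 'm) small_cat" +
  fixes c0 :: 'o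
  assumes c0: "c0 \<in> Obj C"
begin

sublocale pointed_space RC "vert c0"
  by unfold_locales (rule vert_in_topspace[OF c0])

lemma path_class_edge_comp:
  assumes "a \<in> Obj C" "b \<in> Obj C" "c \<in> Obj C" "f \<in> Hom C a b" "g \<in> Hom C b c" "joined (vert a)"
  shows "path_class (edge a c (Comp C a b c g f)) = path_class (edge b c g) \<otimes>\<^bsub>pi1\<^esub> path_class (edge a b f)"
proof -
  note f = path_between_edge[OF assms(1,2,4)] and g = path_between_edge[OF assms(2,3,5)]
  show ?thesis
    using path_class_homotopic[OF edge_comp[OF assms(1-5)] path_between_join[OF f g] assms(6)]
      path_class_join[OF f g assms(6)] by simp
qed

lemma path_class_edge_closed:
  assumes "a \<in> Obj C" "b \<in> Obj C" "f \<in> Hom C a b" "joined (vert a)"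
  shows "path_class (edge a b f) \<in> carrier pi1"
  by (rule path_class_closed[OF path_between_edge[OF assms(1-3)] assms(4)])

lemma path_class_contract_base: "path_class (contract 1 c0 (vert c0)) = \<one>\<^bsub>pi1\<^esub>"
proof -
  obtain a f where af: "nerve_vertex C c0 = (a, f)" by fastforce
  note m = majority_base[OF c0, unfolded af]
  have "vert c0 \<in> majority_open 1 c0"
    using m(1) by (auto simp: majority_open_def majority_points_def realization_point_glue m(2)[symmetric])
  then have p: "path_between RC (vert c0) (vert c0) (contract 1 c0 (vert c0))"
    by (intro path_between_contract) auto
  have "path_homotopic RC (contract 1 c0 (vert c0)) (\<lambda>r. realization_point NC 0 (a, f) (segment (corner 0) (corner 0) r))"
    using contract_homotopic_segment[OF _ _ m(1)] m(2) by simp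
  moreover have "segment (corner 0) (corner 0) r = corner 0" for r
    by (simp add: segment_def algebra_simps fun_eq_iff)
  ultimately have "path_homotopic RC (contract 1 c0 (vert c0)) (\<lambda>r. vert c0)" using m(2) by simp
  from path_class_homotopic[OF this p joined_base] show ?thesis using path_class_const[OF joined_base] by simp
qed

text \<open>The elements \<open>e c\<close> adjust the chosen tails: \<open>H\<close> is only required to contain the adjusted classes of
  edges.

  Let \<open>g s\<close> be the part of the loop up to time \<open>s\<close>. If \<open>\<gamma> s\<close> lies in \<open>majority_open b c\<close>, then \<open>g s\<close>
  followed by the contraction path ends at the vertex \<open>c\<close>, and its class, adjusted by \<open>e c\<close>, is
  claimed to lie in \<open>H\<close>. The claim does not depend on \<open>b\<close> and \<open>c\<close>: two contraction paths from a point
  are homotopic to segments to two corners of a simplex, and these differ by an edge. It is preserved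
  while \<open>\<gamma>\<close> stays in one set \<open>majority_open b c\<close>, by \<open>contract_square\<close>. As these sets cover the
  realization and \<open>[0,1]\<close> is connected, the claim spreads from \<open>s = 0\<close> to \<open>s = 1\<close>.\<close>

theorem loops_generated_by_edges:
  assumes H: "subgroup H pi1"
    and joined: "\<And>c. c \<in> Obj C \<Longrightarrow> joined (vert c)"
    and e: "\<And>c. c \<in> Obj C \<Longrightarrow> e c \<in> carrier pi1" "e c0 = \<one>\<^bsub>pi1\<^esub>"
    and edges: "\<And>c d f. \<lbrakk>c \<in> Obj C; d \<in> Obj C; f \<in> Hom C c d\<rbrakk> \<Longrightarrow>
      e d \<otimes>\<^bsub>pi1\<^esub> path_class (edge c d f) \<otimes>\<^bsub>pi1\<^esub> inv\<^bsub>pi1\<^esub> (e c) \<in> H"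
    and loop: "loop \<gamma>"
  shows "cls \<gamma> \<in> H"
proof -
  have cancel: "u \<otimes>\<^bsub>pi1\<^esub> (inv\<^bsub>pi1\<^esub> u \<otimes>\<^bsub>pi1\<^esub> v) = v" if "u \<in> carrier pi1" "v \<in> carrier pi1" for u v
    using that by (simp add: pi1.m_assoc[symmetric])
  \<comment> \<open>Independence of \<open>b\<close> and \<open>c\<close>.\<close>
  have trans: "e c' \<otimes>\<^bsub>pi1\<^esub> path_class (contract b' c' z) \<otimes>\<^bsub>pi1\<^esub> w \<in> H"
    if b: "0 < b" "b \<le> 1" "0 < b'" "b' \<le> 1" and z: "z \<in> majority_open b c" "z \<in> majority_open b' c'"
      and jz: "joined z" and w: "w \<in> carrier pi1" and *: "e c \<otimes>\<^bsub>pi1\<^esub> path_class (contract b c z) \<otimes>\<^bsub>pi1\<^esub> w \<in> H"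
    for b b' c c' z w
  proof -
    obtain n a f t i where zz: "z = realization_point NC n (a, f) t" and i: "majority b c ((n, (a, f)), t) i"
      using majority_openE[OF z(1)] by blast
    have "((n, (a, f)), t) \<in> majority_points b' c'"
      using z(2) glue_in_majority_open_iff[OF b(3,4)] zz by (simp add: realization_point_glue)
    then obtain i' where i': "majority b' c' ((n, (a, f)), t) i'" by (auto simp: majority_points_def)
    note x = majority_simplex[OF b(1) i] and x' = majority_simplex[OF b(3) i']
    let ?pt = "realization_point NC n (a, f)"
    define W where "W k = path_class (\<lambda>r. ?pt (segment t (corner k) r))" for k
    have af: "(a, f) \<in> simps_of NC n" using x(1) by simp
    have P: "path_between RC z (vert (a k)) (\<lambda>r. ?pt (segment t (corner k) r))" if "k \<le> n" for k
      using path_in_simplex[OF af path_between_segment[OF x(2) corner_in_simplex[OF that]]]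
        realization_point_corner[OF x(1) that] zz by simp
    have Wc: "W k \<in> carrier pi1" if "k \<le> n" for k
      unfolding W_def by (rule path_class_closed[OF P[OF that] jz])
    have W: "path_class (contract b c z) = W i" "path_class (contract b' c' z) = W i'"
      unfolding W_def
      using path_class_homotopic[OF _ path_between_contract[OF b(1,2) z(1)] jz] contract_homotopic_segment[OF b(1,2) i]
        path_class_homotopic[OF _ path_between_contract[OF b(3,4) z(2)] jz] contract_homotopic_segment[OF b(3,4) i'] zz
      by simp_all
    \<comment> \<open>The segments to two corners differ by the edge between them.\<close>
    have step: "W k' = path_class (edge (a k) (a k') (f (k, k'))) \<otimes>\<^bsub>pi1\<^esub> W k" if "k \<le> k'" "k' \<le> n" for k k'
    proof -
      have ck: "corner k \<in> standard_simplex n" "corner k' \<in> standard_simplex n"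
        using that by (auto intro: corner_in_simplex)
      note sk = path_between_segment[OF x(2) ck(1)] and sk' = path_between_segment[OF x(2) ck(2)]
        and kk = path_between_segment[OF ck]
      have kn: "k \<le> n" using that by simp
      have Ekk: "path_between RC (vert (a k)) (vert (a k')) (\<lambda>r. ?pt (segment (corner k) (corner k') r))"
        using path_in_simplex[OF af kk] realization_point_corner[OF x(1)] that by simp
      have "(\<lambda>r. ?pt ((segment t (corner k) \<star> segment (corner k) (corner k')) r)) =
        (\<lambda>r. ?pt (segment t (corner k) r)) \<star> (\<lambda>r. ?pt (segment (corner k) (corner k') r))"
        by (auto simp: path_join_def fun_eq_iff)
      moreover have "path_homotopic RC (\<lambda>r. ?pt (segment t (corner k') r))
          (\<lambda>r. ?pt ((segment t (corner k) \<star> segment (corner k) (corner k')) r))"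
        by (rule paths_in_simplex_homotopic[OF af sk' path_between_join[OF sk kk]])
      ultimately have "W k' = path_class (\<lambda>r. ?pt (segment (corner k) (corner k') r)) \<otimes>\<^bsub>pi1\<^esub> W k"
        unfolding W_def using path_class_homotopic[OF _ P[OF that(2)] jz] path_class_join[OF P[OF kn] Ekk jz] by simp
      moreover have "joined (vert (a k))" using joined_path[OF P[OF kn]] jz by simp
      ultimately show ?thesis
        using path_class_homotopic[OF path_homotopic_edge[OF x(1) that kk] Ekk] by simp
    qed
    note ec = e(1)[OF x(7)] and ec' = e(1)[OF x'(7)]
    note Wi = Wc[OF x(3)] and Wi' = Wc[OF x'(3)]
    have "e c' \<otimes>\<^bsub>pi1\<^esub> W i' \<otimes>\<^bsub>pi1\<^esub> inv\<^bsub>pi1\<^esub> (e c \<otimes>\<^bsub>pi1\<^esub> W i) \<in> H"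
    proof (cases "i \<le> i'")
      case True
      define E where "E = path_class (edge c c' (f (i, i')))"
      have fH: "f (i, i') \<in> Hom C c c'" using nerve_simplexD(2)[OF x(1) True x'(3)] x(4) x'(4) by simp
      have Ec: "E \<in> carrier pi1" unfolding E_def by (rule path_class_edge_closed[OF x(7) x'(7) fH joined[OF x(7)]])
      have "W i' = E \<otimes>\<^bsub>pi1\<^esub> W i" using step[OF True x'(3)] x(4) x'(4) by (simp add: E_def)
      then have "e c' \<otimes>\<^bsub>pi1\<^esub> W i' \<otimes>\<^bsub>pi1\<^esub> inv\<^bsub>pi1\<^esub> (e c \<otimes>\<^bsub>pi1\<^esub> W i) =
          e c' \<otimes>\<^bsub>pi1\<^esub> E \<otimes>\<^bsub>pi1\<^esub> (W i \<otimes>\<^bsub>pi1\<^esub> inv\<^bsub>pi1\<^esub> W i) \<otimes>\<^bsub>pi1\<^esub> inv\<^bsub>pi1\<^esub> (e c)"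
        using ec ec' Wi Ec by (simp add: pi1.inv_mult_group pi1.m_assoc cancel)
      also have "\<dots> \<in> H" using edges[OF x(7) x'(7) fH] ec ec' Wi Ec by (simp add: E_def)
      finally show ?thesis .
    next
      case False
      then have le: "i' \<le> i" by simp
      define E where "E = path_class (edge c' c (f (i', i)))"
      have fH: "f (i', i) \<in> Hom C c' c" using nerve_simplexD(2)[OF x(1) le x(3)] x(4) x'(4) by simp
      have Ec: "E \<in> carrier pi1" unfolding E_def by (rule path_class_edge_closed[OF x'(7) x(7) fH joined[OF x'(7)]])
      have "W i = E \<otimes>\<^bsub>pi1\<^esub> W i'" using step[OF le x(3)] x(4) x'(4) by (simp add: E_def)
      then have "e c' \<otimes>\<^bsub>pi1\<^esub> W i' \<otimes>\<^bsub>pi1\<^esub> inv\<^bsub>pi1\<^esub> (e c \<otimes>\<^bsub>pi1\<^esub> W i) =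
          e c' \<otimes>\<^bsub>pi1\<^esub> (W i' \<otimes>\<^bsub>pi1\<^esub> inv\<^bsub>pi1\<^esub> W i') \<otimes>\<^bsub>pi1\<^esub> inv\<^bsub>pi1\<^esub> E \<otimes>\<^bsub>pi1\<^esub> inv\<^bsub>pi1\<^esub> (e c)"
        using ec ec' Wi' Ec by (simp add: pi1.inv_mult_group pi1.m_assoc cancel)
      also have "\<dots> = inv\<^bsub>pi1\<^esub> (e c \<otimes>\<^bsub>pi1\<^esub> E \<otimes>\<^bsub>pi1\<^esub> inv\<^bsub>pi1\<^esub> (e c'))"
        using ec ec' Wi' Ec by (simp add: pi1.inv_mult_group pi1.m_assoc)
      also have "\<dots> \<in> H" using edges[OF x'(7) x(7) fH] subgroup.m_inv_closed[OF H] by (simp add: E_def)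
      finally show ?thesis .
    qed
    from subgroup.m_closed[OF H this *[unfolded W]]
    have "e c' \<otimes>\<^bsub>pi1\<^esub> W i' \<otimes>\<^bsub>pi1\<^esub> inv\<^bsub>pi1\<^esub> (e c \<otimes>\<^bsub>pi1\<^esub> W i) \<otimes>\<^bsub>pi1\<^esub> (e c \<otimes>\<^bsub>pi1\<^esub> W i \<otimes>\<^bsub>pi1\<^esub> w) \<in> H" .
    also have "e c' \<otimes>\<^bsub>pi1\<^esub> W i' \<otimes>\<^bsub>pi1\<^esub> inv\<^bsub>pi1\<^esub> (e c \<otimes>\<^bsub>pi1\<^esub> W i) \<otimes>\<^bsub>pi1\<^esub> (e c \<otimes>\<^bsub>pi1\<^esub> W i \<otimes>\<^bsub>pi1\<^esub> w) =
      e c' \<otimes>\<^bsub>pi1\<^esub> W i' \<otimes>\<^bsub>pi1\<^esub> (inv\<^bsub>pi1\<^esub> (e c \<otimes>\<^bsub>pi1\<^esub> W i) \<otimes>\<^bsub>pi1\<^esub> (e c \<otimes>\<^bsub>pi1\<^esub> W i)) \<otimes>\<^bsub>pi1\<^esub> w"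
      using ec ec' Wi Wi' w by (simp only: pi1.m_assoc pi1.m_closed pi1.inv_closed)
    also have "\<dots> = e c' \<otimes>\<^bsub>pi1\<^esub> W i' \<otimes>\<^bsub>pi1\<^esub> w"
      using ec ec' Wi Wi' w by (simp only: pi1.l_inv pi1.m_closed pi1.r_one)
    finally show ?thesis unfolding W .
  qed
  define g where "g s = (\<lambda>u. \<gamma> (s * u))" for s
  have sub: "path_between RC (\<gamma> (s + (s' - s) * 0)) (\<gamma> (s + (s' - s) * 1)) (\<gamma> \<circ> (\<lambda>u. s + (s' - s) * u))"
    if "s \<in> {0..1}" "s' \<in> {0..1}" for s s'
  proof (rule path_between_reparam[OF loop])
    have "s + (s' - s) * u \<in> {0..1}" if "u \<in> {0..1}" for u
      using convexD_alt[of "{0..1::real}" s s' u] that \<open>s \<in> {0..1}\<close> \<open>s' \<in> {0..1}\<close> by (simp add: algebra_simps)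
    then show "(\<lambda>u. s + (s' - s) * u) ` {0..1} \<subseteq> {0..1}" by auto
  qed (intro continuous_intros)
  have g: "path_between RC (vert c0) (\<gamma> s) (g s)" if "s \<in> {0..1}" for s
    using sub[of 0 s] that path_betweenD(2)[OF loop] by (simp add: g_def o_def)
  have g_step: "path_class (g s') = path_class (\<gamma> \<circ> (\<lambda>u. s + (s' - s) * u)) \<otimes>\<^bsub>pi1\<^esub> path_class (g s)"
    if s: "s \<in> {0..1}" "s' \<in> {0..1}" for s s'
  proof -
    let ?p = "\<gamma> \<circ> (\<lambda>u. s + (s' - s) * u)"
    have p: "path_between RC (\<gamma> s) (\<gamma> s') ?p" using sub[OF s] by simp
    define \<psi> where "\<psi> = (\<lambda>u::real. s * u) \<star> (\<lambda>u. s + (s' - s) * u)"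
    have ends: "path_between unit_interval 0 s (\<lambda>u::real. s * u)"
      "path_between unit_interval s s' (\<lambda>u. s + (s' - s) * u)"
      using s convexD_alt[of "{0..1::real}" s s'] 
      by (auto simp: path_between_def pathin_def mult_le_one algebra_simps intro!: continuous_intros)
    note \<psi> = path_between_join[OF ends, folded \<psi>_def]
    have \<psi>': "continuous_on {0..1} \<psi>" "\<psi> ` {0..1} \<subseteq> {0..1}" using path_betweenD(1)[OF \<psi>] by auto
    have "path_homotopic RC (\<gamma> \<circ> (\<lambda>u. s' * u)) (\<gamma> \<circ> \<psi>)"
    proof (rule path_homotopic_reparam[OF loop _ _ \<psi>'])
      show "continuous_on {0..1} (\<lambda>u. s' * u)" by (intro continuous_intros)
      show "(\<lambda>u. s' * u) ` {0..1} \<subseteq> {0..1}" using s by (auto simp: mult_le_one)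
    qed (use path_betweenD(2,3)[OF \<psi>] in auto)
    moreover have "\<gamma> \<circ> \<psi> = g s \<star> ?p" by (auto simp: \<psi>_def g_def path_join_def fun_eq_iff)
    moreover have "\<gamma> \<circ> (\<lambda>u. s' * u) = g s'" by (simp add: g_def o_def)
    ultimately have "path_homotopic RC (g s') (g s \<star> ?p)" by simp
    then show ?thesis using path_class_homotopic[OF _ g[OF s(2)] joined_base] path_class_join[OF g[OF s(1)] p joined_base] by simp
  qed
  have jg: "joined (\<gamma> s)" if "s \<in> {0..1}" for s using joined_path[OF g[OF that]] joined_base by simp
  define P where "P s \<longleftrightarrow> (\<forall>b c. 0 < b \<and> b \<le> 1 \<and> \<gamma> s \<in> majority_open b c \<longrightarrow>
    e c \<otimes>\<^bsub>pi1\<^esub> path_class (contract b c (\<gamma> s)) \<otimes>\<^bsub>pi1\<^esub> path_class (g s) \<in> H)" for s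
  have base: "vert c0 \<in> majority_open 1 c0"
  proof -
    have "((0, nerve_vertex C c0), corner 0) \<in> majority_points 1 c0"
      using majority_base(1)[OF c0] by (auto simp: majority_points_def)
    then have "glue_map NC ((0, nerve_vertex C c0), corner 0) \<in> majority_open 1 c0"
      unfolding majority_open_def by (rule imageI)
    then show ?thesis using majority_base(2)[OF c0] by (simp add: realization_point_glue)
  qed
  have g01: "path_class (g 0) = \<one>\<^bsub>pi1\<^esub>" "g 1 = \<gamma>"
    using path_class_const[OF joined_base] path_betweenD(2)[OF loop] by (simp_all add: g_def)
  have "P 0"
    unfolding P_def
  proof (intro allI impI, elim conjE)
    fix b c assume bc: "0 < b" "b \<le> 1" "\<gamma> 0 \<in> majority_open b c"
    have z: "\<gamma> 0 = vert c0" using path_betweenD(2)[OF loop] .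
    show "e c \<otimes>\<^bsub>pi1\<^esub> path_class (contract b c (\<gamma> 0)) \<otimes>\<^bsub>pi1\<^esub> path_class (g 0) \<in> H"
      unfolding z
      by (rule trans[OF _ _ bc(1,2) base bc(3)[unfolded z] joined_base])
         (use e(2) path_class_contract_base g01(1) subgroup.one_closed[OF H] in auto)
  qed
  moreover have "\<exists>T. openin (top_of_set {0..1}) T \<and> s \<in> T \<and> (\<forall>u\<in>T. \<forall>v\<in>T. P u \<longrightarrow> P v)"
    if s: "s \<in> {0..1}" for s
  proof -
    have "\<gamma> s \<in> topspace RC" by (rule path_between_topspace(3)[OF loop s])
    then obtain b c where bc: "0 < b" "b \<le> 1" "\<gamma> s \<in> majority_open b c" by (rule majority_open_cover)
    have "openin unit_interval {u \<in> {0..1}. \<gamma> u \<in> majority_open b c}"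
      using openin_continuous_map_preimage[OF path_betweenD(1)[OF loop] openin_majority_open[OF bc(1,2), of c]] by simp
    then obtain d where d: "d > 0" "\<And>u. u \<in> {0..1} \<Longrightarrow> dist u s < d \<Longrightarrow> \<gamma> u \<in> majority_open b c"
      using bc(3) s unfolding openin_euclidean_subtopology_iff by blast
    let ?T = "{0..1} \<inter> ball s d"
    have PT: "P v" if uv: "u \<in> ?T" "v \<in> ?T" and Pu: "P u" for u v
    proof -
      let ?p = "\<gamma> \<circ> (\<lambda>w. u + (v - u) * w)"
      have uv': "u \<in> {0..1}" "v \<in> {0..1}" using uv by auto
      have p: "path_between RC (\<gamma> u) (\<gamma> v) ?p" using sub[OF uv'] by simp
      have cv: "convex ?T" by (intro convex_Int) auto
      have "u + (v - u) * w \<in> ?T" if "w \<in> {0..1}" for w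
        using convexD_alt[OF cv uv, of w] that by (simp add: algebra_simps)
      then have pm: "?p w \<in> majority_open b c" if "w \<in> {0..1}" for w
        using that d(2) by (auto simp: dist_commute)
      have um: "\<gamma> u \<in> majority_open b c" and vm: "\<gamma> v \<in> majority_open b c" using pm[of 0] pm[of 1] by auto
      note cu = path_between_contract[OF bc(1,2) um] and cv = path_between_contract[OF bc(1,2) vm]
      have "path_class (contract b c (\<gamma> u)) = path_class (contract b c (\<gamma> v)) \<otimes>\<^bsub>pi1\<^esub> path_class ?p"
        using path_class_homotopic[OF contract_square[OF bc(1,2) p pm] path_between_join[OF p cv] jg[OF uv'(1)]]
          path_class_join[OF p cv jg[OF uv'(1)]] by simp
      moreover have "e c \<otimes>\<^bsub>pi1\<^esub> path_class (contract b c (\<gamma> u)) \<otimes>\<^bsub>pi1\<^esub> path_class (g u) \<in> H"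
        using Pu bc(1,2) um unfolding P_def by blast
      moreover have "c \<in> Obj C"
        by (rule majority_openE[OF um]) (rule majority_simplex(7)[OF bc(1)])
      ultimately have v: "e c \<otimes>\<^bsub>pi1\<^esub> path_class (contract b c (\<gamma> v)) \<otimes>\<^bsub>pi1\<^esub> path_class (g v) \<in> H"
        using g_step[OF uv'] e(1)[of c] path_class_closed[OF cv jg[OF uv'(2)]] path_class_closed[OF p jg[OF uv'(1)]]
          path_class_closed[OF g[OF uv'(1)] joined_base] by (simp add: pi1.m_assoc)
      show ?thesis
        unfolding P_def
        using trans[OF bc(1,2) _ _ vm _ jg[OF uv'(2)] path_class_closed[OF g[OF uv'(2)] joined_base] v] by blast
    qed
    have "openin unit_interval ?T" by (simp add: openin_open_Int)
    moreover have "s \<in> ?T" using s d(1) by simp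
    ultimately show ?thesis using PT by blast
  qed
  ultimately have "P 1"
    using connected_induction_simple[of "{0..1::real}" 0 1 P] by auto
  then have "e c0 \<otimes>\<^bsub>pi1\<^esub> path_class (contract 1 c0 (\<gamma> 1)) \<otimes>\<^bsub>pi1\<^esub> path_class (g 1) \<in> H"
    using base path_betweenD(3)[OF loop] unfolding P_def by simp
  then show ?thesis
    using e(2) path_class_contract_base path_betweenD(3)[OF loop] g01(2) path_class_loop[OF loop] cls_closed[OF loop] by simp
qed

end

section \<open>Sampling a point of a simplex\<close>

text \<open>Subdivide \<open>[0,1)\<close> into consecutive intervals of lengths \<open>t\<^sub>0, t\<^sub>1, \<dots>\<close>; \<open>sample t s\<close> is the index of the
  interval that contains \<open>s\<close>.\<close>

definition sample :: "(nat \<Rightarrow> real) \<Rightarrow> real \<Rightarrow> nat" where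
  "sample t s = (LEAST i. s < partial_weight t (Suc i))"

lemma partial_weight_mono: "t \<in> standard_simplex n \<Longrightarrow> i \<le> j \<Longrightarrow> partial_weight t i \<le> partial_weight t j"
  unfolding partial_weight_def by (rule sum_mono2) (auto simp: standard_simplex_def)

lemma partial_weight_full: "t \<in> standard_simplex n \<Longrightarrow> partial_weight t (Suc n) = 1"
  by (simp add: partial_weight_def standard_simplex_def lessThan_Suc_atMost)

lemma sample:
  assumes t: "t \<in> standard_simplex n" and s: "s \<in> {0..<1}"
  shows "sample t s \<le> n" "sample t s = i \<longleftrightarrow> partial_weight t i \<le> s \<and> s < partial_weight t (Suc i)"
proof -
  have ex: "s < partial_weight t (Suc n)" using partial_weight_full[OF t] s by simp
  show "sample t s \<le> n" unfolding sample_def by (rule Least_le[of "\<lambda>i. s < partial_weight t (Suc i)", OF ex])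
  have up: "s < partial_weight t (Suc (sample t s))"
    unfolding sample_def by (rule LeastI[of "\<lambda>i. s < partial_weight t (Suc i)", OF ex])
  have low: "partial_weight t (sample t s) \<le> s"
  proof (cases "sample t s")
    case 0
    then show ?thesis using s by (simp add: partial_weight_def)
  next
    case (Suc j)
    then have "\<not> s < partial_weight t (Suc j)"
      using not_less_Least[of j "\<lambda>i. s < partial_weight t (Suc i)"] by (simp add: sample_def)
    then show ?thesis using Suc by simp
  qed
  have "sample t s = i" if i: "partial_weight t i \<le> s" "s < partial_weight t (Suc i)"
    unfolding sample_def
  proof (rule Least_equality[of "\<lambda>i. s < partial_weight t (Suc i)" i, OF i(2)])
    fix j assume j: "s < partial_weight t (Suc j)"
    show "i \<le> j"
    proof (rule ccontr)
      assume "\<not> i \<le> j"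
      then have "partial_weight t (Suc j) \<le> partial_weight t i" by (intro partial_weight_mono[OF t]) simp
      then show False using i(1) j by simp
    qed
  qed
  then show "sample t s = i \<longleftrightarrow> partial_weight t i \<le> s \<and> s < partial_weight t (Suc i)" using up low by blast
qed

text \<open>A monotone \<open>\<theta>\<close> only merges neighbouring intervals and inserts empty ones.\<close>

lemma sample_push:
  assumes \<theta>: "\<theta> \<in> simplex_ops m n" and t: "t \<in> standard_simplex m" and s: "s \<in> {0..<1}"
  shows "sample (simplex_push m \<theta> t) s = \<theta> (sample t s)"
proof -
  let ?k = "sample t s"
  have k: "?k \<le> m" "partial_weight t ?k \<le> s" "s < partial_weight t (Suc ?k)" using sample[OF t s] by blast+
  have mono: "\<theta> i \<le> \<theta> j" if "i \<le> j" "j \<le> m" for i j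
    using \<theta> that by (auto simp: simplex_ops_def mono_on_def)
  have \<theta>k: "\<theta> ?k \<le> n" using \<theta> k by (auto simp: simplex_ops_def)
  have t0: "0 \<le> t i" for i using t by (simp add: standard_simplex_def)
  have "partial_weight (simplex_push m \<theta> t) (\<theta> ?k) = (\<Sum>i | i \<le> m \<and> \<theta> i < \<theta> ?k. t i)"
    by (rule partial_weight_push[OF \<theta>]) (use \<theta>k in simp)
  also have "\<dots> \<le> (\<Sum>i<?k. t i)"
  proof (rule sum_mono2)
    show "{i. i \<le> m \<and> \<theta> i < \<theta> ?k} \<subseteq> {..<?k}" using mono[of ?k] by (auto simp: not_less[symmetric])
  qed (use t0 in auto)
  finally have 1: "partial_weight (simplex_push m \<theta> t) (\<theta> ?k) \<le> s" using k by (simp add: partial_weight_def)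
  have "partial_weight t (Suc ?k) = (\<Sum>i\<le>?k. t i)" by (simp add: partial_weight_def lessThan_Suc_atMost)
  also have "\<dots> \<le> (\<Sum>i | i \<le> m \<and> \<theta> i < Suc (\<theta> ?k). t i)"
  proof (rule sum_mono2)
    show "{..?k} \<subseteq> {i. i \<le> m \<and> \<theta> i < Suc (\<theta> ?k)}" using mono k(1) by (auto simp: less_Suc_eq_le)
  qed (use t0 in auto)
  also have "\<dots> = partial_weight (simplex_push m \<theta> t) (Suc (\<theta> ?k))"
    by (rule partial_weight_push[OF \<theta>, symmetric]) (use \<theta>k in simp)
  finally have "s < partial_weight (simplex_push m \<theta> t) (Suc (\<theta> ?k))" using k(3) by simp
  then show ?thesis using 1 sample(2)[OF simplex_push_in_simplex[OF \<theta> t] s] by blast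
qed

section \<open>Measure of agreement\<close>

lemma unit_interval_fmeasurable: "{0..1::real} \<in> fmeasurable lborel"
  by (simp add: fmeasurable_def)

lemma fmeasurable_unit: "A \<in> sets borel \<Longrightarrow> A \<subseteq> {0..<1::real} \<Longrightarrow> A \<in> fmeasurable lborel"
  by (rule fmeasurableI2[OF unit_interval_fmeasurable]) auto

lemma measure_Int_unit:
  assumes "A \<in> sets borel" "A \<subseteq> {0..<1::real}" "B \<in> sets borel" "B \<subseteq> {0..<1}"
  shows "measure lborel A + measure lborel B \<le> 1 + measure lborel (A \<inter> B)"
proof -
  have "measure lborel (A \<union> B) \<le> measure lborel {0..1::real}"
    by (rule measure_mono_fmeasurable[OF _ _ unit_interval_fmeasurable]) (use assms in auto)
  moreover have "measure lborel (A \<union> B) = measure lborel A + measure lborel B - measure lborel (A \<inter> B)"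
    by (rule measure_Un3) (use assms fmeasurable_unit in auto)
  ultimately show ?thesis by simp
qed

text \<open>The measure of \<open>A\<close> below \<open>c\<close> is a 1-Lipschitz function of \<open>c\<close>.\<close>

lemma continuous_on_truncated_measure:
  assumes A: "A \<in> sets borel" "A \<subseteq> {0..<1::real}"
  shows "continuous_on UNIV (\<lambda>c. measure lborel (A \<inter> {..<c}))"
    "a \<le> b \<Longrightarrow> measure lborel (A \<inter> {a..<b}) = measure lborel (A \<inter> {..<b}) - measure lborel (A \<inter> {..<a})"
proof -
  have fm: "A \<inter> B \<in> fmeasurable lborel" if "B \<in> sets borel" for B
    using that A by (intro fmeasurable_unit) auto
  have diff: "measure lborel (A \<inter> {a..<b}) = measure lborel (A \<inter> {..<b}) - measure lborel (A \<inter> {..<a})"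
    if "a \<le> b" for a b
  proof -
    have "A \<inter> {..<b} = (A \<inter> {..<a}) \<union> (A \<inter> {a..<b})" "(A \<inter> {..<a}) \<inter> (A \<inter> {a..<b}) = {}"
      using that by auto
    then show ?thesis using measure_Un3[OF fm[of "{..<a}"] fm[of "{a..<b}"]] by simp
  qed
  then show "a \<le> b \<Longrightarrow> measure lborel (A \<inter> {a..<b}) = measure lborel (A \<inter> {..<b}) - measure lborel (A \<inter> {..<a})" .
  let ?\<phi> = "\<lambda>c. measure lborel (A \<inter> {..<c})"
  have le: "\<bar>?\<phi> b - ?\<phi> a\<bar> \<le> \<bar>b - a\<bar>" for a b
  proof -
    have *: "\<bar>?\<phi> b - ?\<phi> a\<bar> \<le> \<bar>b - a\<bar>" if "a \<le> b" for a b
    proof -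
      have "measure lborel (A \<inter> {a..<b}) \<le> measure lborel {a..<b}"
        by (rule measure_mono_fmeasurable) (use A that in \<open>auto simp: fmeasurable_def\<close>)
      then show ?thesis
        using diff[OF that] that measure_nonneg[of lborel "A \<inter> {a..<b}"] by (simp add: measure_lborel_Ico)
    qed
    show ?thesis using *[of a b] *[of b a] by (cases "a \<le> b") (auto simp: abs_minus_commute)
  qed
  have "1-lipschitz_on UNIV ?\<phi>"
    by (rule lipschitz_onI) (use le in \<open>auto simp: dist_real_def\<close>)
  then show "continuous_on UNIV ?\<phi>" by (rule lipschitz_on_continuous_on)
qed

locale step_functions = group \<Gamma> for \<Gamma> :: "('g, 'h) monoid_scheme" (structure)
begin

definition stepfun :: "(real \<Rightarrow> 'g) \<Rightarrow> bool" where
  "stepfun u \<longleftrightarrow> finite (u ` {0..<1}) \<and> u ` {0..<1} \<subseteq> carrier \<Gamma> \<and> (\<forall>x. {s \<in> {0..<1}. u s = x} \<in> sets borel)"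

definition agree :: "(real \<Rightarrow> 'g) \<Rightarrow> (real \<Rightarrow> 'g) \<Rightarrow> 'g \<Rightarrow> real set" where
  "agree u v k = {s \<in> {0..<1}. v s = u s \<otimes> k}"

text \<open>Closeness in measure, up to a right translation.\<close>

definition close :: "real \<Rightarrow> (real \<Rightarrow> 'g) \<Rightarrow> (real \<Rightarrow> 'g) \<Rightarrow> 'g \<Rightarrow> bool" where
  "close \<epsilon> u v k \<longleftrightarrow> k \<in> carrier \<Gamma> \<and> measure lborel (agree u v k) > \<epsilon>"

lemma agree_measurable:
  assumes "stepfun u" "stepfun v"
  shows "agree u v k \<in> sets borel" "agree u v k \<subseteq> {0..<1}"
proof -
  have "agree u v k = (\<Union>x\<in>u ` {0..<1}. {s \<in> {0..<1}. u s = x} \<inter> {s \<in> {0..<1}. v s = x \<otimes> k})"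
    by (auto simp: agree_def)
  also have "\<dots> \<in> sets borel"
    using assms unfolding stepfun_def by (intro sets.finite_UN sets.Int) auto
  finally show "agree u v k \<in> sets borel" .
qed (auto simp: agree_def)

lemma stepfun_closed: "stepfun u \<Longrightarrow> s \<in> {0..<1} \<Longrightarrow> u s \<in> carrier \<Gamma>"
  by (auto simp: stepfun_def)

lemma agree_Int:
  assumes "stepfun u" "stepfun v" "stepfun u'" "stepfun v'"
  shows "measure lborel (agree u v k) + measure lborel (agree u' v' l) \<le> 1 + measure lborel (agree u v k \<inter> agree u' v' l)"
  by (rule measure_Int_unit[OF agree_measurable[OF assms(1,2)] agree_measurable[OF assms(3,4)]])

text \<open>Three subsets of \<open>[0,1)\<close> of measure more than \<open>3/4\<close> have a common point, and there the values
  determine the translations.\<close>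

lemma close_cocycle:
  assumes st: "stepfun u" "stepfun v" "stepfun w"
    and uv: "close (3/4) u v k" and vw: "close (3/4) v w l" and uw: "close (3/4) u w m"
  shows "m = k \<otimes> l"
proof -
  let ?A = "agree u v k" and ?B = "agree v w l" and ?C = "agree u w m"
  have k: "k \<in> carrier \<Gamma>" "l \<in> carrier \<Gamma>" "m \<in> carrier \<Gamma>" using uv vw uw by (auto simp: close_def)
  have AB: "measure lborel (?A \<inter> ?B) > 1/2"
    using agree_Int[OF st(1,2,2,3), of k l] uv vw by (simp add: close_def)
  have "measure lborel (?A \<inter> ?B) + measure lborel ?C \<le> 1 + measure lborel (?A \<inter> ?B \<inter> ?C)"
    using agree_measurable[OF st(1,2)] agree_measurable[OF st(2,3)] agree_measurable[OF st(1,3)]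
    by (intro measure_Int_unit) auto
  then have "measure lborel (?A \<inter> ?B \<inter> ?C) \<noteq> 0" using AB uw by (simp add: close_def)
  then have "?A \<inter> ?B \<inter> ?C \<noteq> {}" by force
  then obtain s where "s \<in> ?A \<inter> ?B \<inter> ?C" by blast
  then have s: "s \<in> {0..<1}" "v s = u s \<otimes> k" "w s = v s \<otimes> l" "w s = u s \<otimes> m"
    by (auto simp: agree_def)
  have "u s \<otimes> m = u s \<otimes> (k \<otimes> l)" using s k stepfun_closed[OF st(1) s(1)] by (simp add: m_assoc)
  then show ?thesis using k stepfun_closed[OF st(1) s(1)] by simp
qed

text \<open>The constants satisfy \<open>7/8 + 7/8 - 1 = 3/4\<close>.\<close>

lemma close_near:
  assumes st: "stepfun u" "stepfun v" "stepfun w"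
    and uv: "close (7/8) u v k" and uw: "close (7/8) u w l"
  shows "close (3/4) v w (inv k \<otimes> l)"
proof -
  have k: "k \<in> carrier \<Gamma>" "l \<in> carrier \<Gamma>" using uv uw by (auto simp: close_def)
  have "agree u v k \<inter> agree u w l \<subseteq> agree v w (inv k \<otimes> l)"
  proof
    fix s assume "s \<in> agree u v k \<inter> agree u w l"
    then have s: "s \<in> {0..<1}" "v s = u s \<otimes> k" "w s = u s \<otimes> l" by (auto simp: agree_def)
    have us: "u s \<in> carrier \<Gamma>" by (rule stepfun_closed[OF st(1) s(1)])
    have "v s \<otimes> (inv k \<otimes> l) = u s \<otimes> (k \<otimes> inv k) \<otimes> l"
      unfolding s(2) using us k by (simp only: m_assoc m_closed inv_closed)
    also have "\<dots> = w s" unfolding s(3) using us k by simp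
    finally show "s \<in> agree v w (inv k \<otimes> l)" using s(1) by (simp add: agree_def)
  qed
  then have "measure lborel (agree u v k \<inter> agree u w l) \<le> measure lborel (agree v w (inv k \<otimes> l))"
    using agree_measurable[OF st(1,2)] agree_measurable[OF st(1,3)] agree_measurable[OF st(2,3)] fmeasurable_unit
    by (intro measure_mono_fmeasurable) auto
  then show ?thesis
    using agree_Int[OF st(1,2,1,3), of k l] uv uw k by (simp add: close_def)
qed

lemma close_refl: "stepfun u \<Longrightarrow> \<epsilon> < 1 \<Longrightarrow> close \<epsilon> u u \<one>"
proof -
  assume u: "stepfun u" "\<epsilon> < 1"
  have "agree u u \<one> = {0..<1}" using stepfun_closed[OF u(1)] by (auto simp: agree_def)
  then show ?thesis using u(2) by (simp add: close_def measure_lborel_Ico)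
qed

lemma close_self: "stepfun u \<Longrightarrow> close (3/4) u u k \<Longrightarrow> k = \<one>"
  using close_cocycle[of u u u k k k] by (simp add: close_def)

section \<open>Parallel transport over a square\<close>

text \<open>By a Lebesgue number argument, nearby points \<open>p\<close>, \<open>q\<close> have a unique comparison element \<open>T p q\<close>, and
  these elements satisfy the cocycle identity. The function \<open>g\<close> integrates the cocycle: \<open>g p\<close> is the
  product of the comparison elements along \<open>N\<close> small steps of the segment from \<open>0\<close> to \<open>p\<close>. For nearby
  \<open>p\<close> and \<open>q\<close> the two products are compared step by step.\<close>

lemma transport_exists:
  fixes D :: "'d::real_normed_vector set" and u :: "'d \<Rightarrow> real \<Rightarrow> 'g"
  assumes D: "compact D" "convex D" "0 \<in> D"
    and st: "\<And>p. p \<in> D \<Longrightarrow> stepfun (u p)"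
    and loc: "\<And>p. p \<in> D \<Longrightarrow> \<exists>B. open B \<and> p \<in> B \<and> (\<forall>q\<in>B \<inter> D. \<exists>k. close (7/8) (u p) (u q) k)"
  obtains g \<delta> where "\<delta> > 0" "\<And>p. p \<in> D \<Longrightarrow> g p \<in> carrier \<Gamma>"
    "\<And>p q. p \<in> D \<Longrightarrow> q \<in> D \<Longrightarrow> dist p q < \<delta> \<Longrightarrow> close (3/4) (u p) (u q) (inv (g p) \<otimes> g q)"
proof -
  define \<B> where "\<B> = {B. open B \<and> (\<exists>p\<in>D. \<forall>q\<in>B \<inter> D. \<exists>k. close (7/8) (u p) (u q) k)}"
  obtain \<delta> where \<delta>: "\<delta> > 0" "\<And>T. T \<subseteq> D \<Longrightarrow> diameter T < \<delta> \<Longrightarrow> \<exists>B\<in>\<B>. T \<subseteq> B"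
  proof (rule Lebesgue_number_lemma[OF D(1)])
    show "\<B> \<noteq> {}" using loc[OF D(3)] D(3) by (auto simp: \<B>_def)
    show "D \<subseteq> \<Union>\<B>" using loc by (fastforce simp: \<B>_def)
    show "open B" if "B \<in> \<B>" for B using that by (simp add: \<B>_def)
  qed (use that in blast)
  have close_ex: "\<exists>k. close (3/4) (u p) (u q) k" if pq: "p \<in> D" "q \<in> D" "dist p q < \<delta>" for p q
  proof -
    have "diameter {p, q} \<le> dist p q"
      by (rule diameter_le) (auto simp: dist_norm norm_minus_commute)
    then obtain B where B: "B \<in> \<B>" "{p, q} \<subseteq> B" using \<delta>(2)[of "{p, q}"] pq by auto
    then obtain r where r: "r \<in> D" "\<forall>q\<in>B \<inter> D. \<exists>k. close (7/8) (u r) (u q) k" by (auto simp: \<B>_def)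
    then obtain k l where "close (7/8) (u r) (u p) k" "close (7/8) (u r) (u q) l"
      using B(2) pq(1,2) by blast
    then show ?thesis using close_near[OF st[OF r(1)] st[OF pq(1)] st[OF pq(2)]] by blast
  qed
  define T where "T p q = (SOME k. close (3/4) (u p) (u q) k)" for p q
  have T: "close (3/4) (u p) (u q) (T p q)" if "p \<in> D" "q \<in> D" "dist p q < \<delta>" for p q
    unfolding T_def using close_ex[OF that] by (rule someI_ex)
  have Tc: "T p q \<in> carrier \<Gamma>" if "p \<in> D" "q \<in> D" "dist p q < \<delta>" for p q
    using T[OF that] by (simp add: close_def)
  have Tcoc: "T p r = T p q \<otimes> T q r" if "p \<in> D" "q \<in> D" "r \<in> D" "dist p q < \<delta>" "dist q r < \<delta>" "dist p r < \<delta>" for p q r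
    using close_cocycle[OF st st st T T T] that by blast
  have T0: "T p p = \<one>" if "p \<in> D" for p
    using close_self[OF st T] that \<delta>(1) by simp
  obtain R where R: "R > 0" "\<And>p. p \<in> D \<Longrightarrow> norm p \<le> R"
    using compact_imp_bounded[OF D(1)] bounded_pos by blast
  obtain N :: nat where N: "N > 0" "R / N < \<delta> / 3"
  proof -
    obtain N :: nat where N: "real N > 3 * R / \<delta>" using reals_Archimedean2 by blast
    then have "N > 0" using R(1) \<delta>(1) by (metis divide_pos_pos less_trans mult_pos_pos of_nat_0_less_iff zero_less_numeral)
    moreover have "R / N < \<delta> / 3" using N \<open>N > 0\<close> \<delta>(1) by (simp add: field_simps)
    ultimately show thesis using that by blast
  qed
  define pt where "pt i p = (real i / N) *\<^sub>R p" for i :: nat and p :: 'd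
  have ptD: "pt i p \<in> D" if "p \<in> D" "i \<le> N" for i p
    using convexD_alt[OF D(2,3) that(1), of "real i / N"] that(2) N(1) by (simp add: pt_def)
  have pt_step: "dist (pt i p) (pt (Suc i) p) < \<delta> / 3" if "p \<in> D" for i p
  proof -
    have "pt (Suc i) p - pt i p = (1 / N) *\<^sub>R p"
      by (simp add: pt_def add_divide_distrib scaleR_add_left)
    then have "dist (pt i p) (pt (Suc i) p) = norm p / N"
      by (simp add: dist_norm norm_minus_commute[of "pt i p"])
    also have "\<dots> \<le> R / N" using R(2)[OF that] by (simp add: divide_right_mono)
    also have "\<dots> < \<delta> / 3" by (rule N(2))
    finally show ?thesis .
  qed
  have pt_dist: "dist (pt i p) (pt i q) \<le> dist p q" if "i \<le> N" for i p q
  proof -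
    have "dist (pt i p) (pt i q) = (real i / N) * dist p q"
      by (simp add: pt_def dist_norm flip: scaleR_diff_right)
    also have "\<dots> \<le> 1 * dist p q" using that N(1) by (intro mult_right_mono) (auto simp: divide_le_eq_1)
    finally show ?thesis by simp
  qed
  define h where "h p = rec_nat \<one> (\<lambda>i x. x \<otimes> T (pt i p) (pt (Suc i) p))" for p
  have h0: "h p 0 = \<one>" and hS: "h p (Suc i) = h p i \<otimes> T (pt i p) (pt (Suc i) p)" for p i
    by (simp_all add: h_def)
  have hc: "h p i \<in> carrier \<Gamma>" if "p \<in> D" "i \<le> N" for p i
    using that(2)
  proof (induction i)
    case (Suc i)
    have "T (pt i p) (pt (Suc i) p) \<in> carrier \<Gamma>"
      by (rule Tc) (use Suc.prems ptD[OF that(1)] pt_step[OF that(1), of i] \<delta>(1) in auto)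
    then show ?case using Suc unfolding hS by simp
  qed (simp add: h0)
  \<comment> \<open>The bound \<open>\<delta> / 3\<close> on the sides of the quadrilateral of two consecutive steps keeps its diagonal below
    \<open>\<delta>\<close>.\<close>
  have main: "h q i = h p i \<otimes> T (pt i p) (pt i q)" if "p \<in> D" "q \<in> D" "dist p q < \<delta> / 3" "i \<le> N" for p q i
    using that(4)
  proof (induction i)
    case 0
    then show ?case using T0[OF D(3)] by (simp add: h0 pt_def)
  next
    case (Suc i)
    let ?p = "pt i p" and ?p' = "pt (Suc i) p" and ?q = "pt i q" and ?q' = "pt (Suc i) q"
    have in_D: "?p \<in> D" "?p' \<in> D" "?q \<in> D" "?q' \<in> D" using Suc.prems ptD that by auto
    have d: "dist ?p ?q < \<delta> / 3" "dist ?p' ?q' < \<delta> / 3" "dist ?p ?p' < \<delta> / 3" "dist ?q ?q' < \<delta> / 3"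
      using pt_dist[of i p q] pt_dist[of "Suc i" p q] Suc.prems that(3) pt_step[OF that(1)] pt_step[OF that(2)] by auto
    have d2: "dist ?p ?q' < \<delta>" using dist_triangle[of ?p ?q' ?q] d \<delta>(1) by simp
    have d3: "dist ?p ?q < \<delta>" "dist ?p' ?q' < \<delta>" "dist ?p ?p' < \<delta>" "dist ?q ?q' < \<delta>" using d \<delta>(1) by auto
    have c: "h p i \<in> carrier \<Gamma>" "T ?p ?q \<in> carrier \<Gamma>" "T ?p' ?q' \<in> carrier \<Gamma>" "T ?p ?p' \<in> carrier \<Gamma>" "T ?q ?q' \<in> carrier \<Gamma>"
      using hc[OF that(1)] Suc.prems Tc in_D d3 by auto
    have "h q (Suc i) = h p i \<otimes> (T ?p ?q \<otimes> T ?q ?q')"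
      unfolding hS using Suc c by (simp add: m_assoc)
    also have "T ?p ?q \<otimes> T ?q ?q' = T ?p ?p' \<otimes> T ?p' ?q'"
      using Tcoc[OF in_D(1,3,4) d3(1,4) d2] Tcoc[OF in_D(1,2,4) d3(3,2) d2] by simp
    finally show ?case unfolding hS using c by (simp add: m_assoc)
  qed
  show thesis
  proof (rule that[of "\<delta> / 3" "\<lambda>p. h p N"])
    show "\<delta> / 3 > 0" using \<delta> by simp
    show "h p N \<in> carrier \<Gamma>" if "p \<in> D" for p using hc[OF that] by simp
    fix p q assume pq: "p \<in> D" "q \<in> D" "dist p q < \<delta> / 3"
    have pN: "pt N r = r" for r using N(1) by (simp add: pt_def)
    have "h q N = h p N \<otimes> T p q" using main[OF pq order_refl] by (simp add: pN)
    moreover have pq': "dist p q < \<delta>" using pq(3) \<delta>(1) by simp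
    ultimately have "inv (h p N) \<otimes> h q N = T p q"
      using hc[OF pq(1) order_refl] Tc[OF pq(1,2)] by (simp add: m_assoc[symmetric])
    then show "close (3/4) (u p) (u q) (inv (h p N) \<otimes> h q N)" using T[OF pq(1,2) pq'] by simp
  qed
qed

text \<open>\<open>g\<close> records the translation of \<open>u\<close> along the unit interval: between nearby \<open>p\<close> and \<open>q\<close> it is
  \<open>inv (g p) \<otimes> g q\<close>. The total translation is then \<open>inv (g 0) \<otimes> g 1\<close>.\<close>

definition lift :: "(real \<Rightarrow> real \<Rightarrow> 'g) \<Rightarrow> (real \<Rightarrow> 'g) \<Rightarrow> bool" where
  "lift u g \<longleftrightarrow> (\<exists>\<delta>>0. (\<forall>p\<in>{0..1}. g p \<in> carrier \<Gamma>) \<and>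
     (\<forall>p\<in>{0..1}. \<forall>q\<in>{0..1}. dist p q < \<delta> \<longrightarrow> close (3/4) (u p) (u q) (inv (g p) \<otimes> g q)))"

text \<open>The comparison elements of nearby points are unique, so \<open>h p \<otimes> inv (g p)\<close> is locally constant in \<open>p\<close>.\<close>

lemma lift_unique:
  assumes st: "\<And>p. p \<in> {0..1} \<Longrightarrow> stepfun (u p)" and g: "lift u g" and h: "lift u h"
  shows "inv (g 0) \<otimes> g 1 = inv (h 0) \<otimes> h 1"
proof -
  obtain \<delta> where \<delta>: "\<delta> > 0" "\<And>p. p \<in> {0..1} \<Longrightarrow> g p \<in> carrier \<Gamma>"
    "\<And>p q. p \<in> {0..1} \<Longrightarrow> q \<in> {0..1} \<Longrightarrow> dist p q < \<delta> \<Longrightarrow> close (3/4) (u p) (u q) (inv (g p) \<otimes> g q)"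
    using g unfolding lift_def by blast
  obtain \<epsilon> where \<epsilon>: "\<epsilon> > 0" "\<And>p. p \<in> {0..1} \<Longrightarrow> h p \<in> carrier \<Gamma>"
    "\<And>p q. p \<in> {0..1} \<Longrightarrow> q \<in> {0..1} \<Longrightarrow> dist p q < \<epsilon> \<Longrightarrow> close (3/4) (u p) (u q) (inv (h p) \<otimes> h q)"
    using h unfolding lift_def by blast
  have local: "h q \<otimes> inv (g q) = h p \<otimes> inv (g p)" if "p \<in> {0..1}" "q \<in> {0..1}" "dist p q < min \<delta> \<epsilon>" for p q
  proof -
    have c: "g p \<in> carrier \<Gamma>" "g q \<in> carrier \<Gamma>" "h p \<in> carrier \<Gamma>" "h q \<in> carrier \<Gamma>" using \<delta>(2) \<epsilon>(2) that by auto
    have "close (3/4) (u p) (u p) \<one>" using close_refl[OF st] that by simp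
    from close_cocycle[OF st st st this \<delta>(3) \<epsilon>(3), of q] have "inv (h p) \<otimes> h q = inv (g p) \<otimes> g q"
      using that c by simp
    then have "h p \<otimes> (inv (h p) \<otimes> h q) \<otimes> inv (g q) = h p \<otimes> (inv (g p) \<otimes> g q) \<otimes> inv (g q)" by simp
    moreover have "h p \<otimes> (inv (h p) \<otimes> h q) = h q" using c by (simp add: m_assoc[symmetric])
    moreover have "h p \<otimes> (inv (g p) \<otimes> g q) \<otimes> inv (g q) = h p \<otimes> inv (g p)" using c by (simp add: m_assoc)
    ultimately show ?thesis by simp
  qed
  define P where "P q \<longleftrightarrow> h q \<otimes> inv (g q) = h 0 \<otimes> inv (g 0)" for q
  have "P 1"
  proof (rule connected_induction_simple[of "{0..1::real}" 0 1 P])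
    fix p :: real assume p: "p \<in> {0..1}"
    let ?T = "{0..1} \<inter> ball p (min \<delta> \<epsilon> / 2)"
    have "P y" if "x \<in> ?T" "y \<in> ?T" "P x" for x y
    proof -
      have "dist x y \<le> dist p x + dist p y" by (metis dist_commute dist_triangle)
      then have "dist x y < min \<delta> \<epsilon>" using that by auto
      then show ?thesis using local[of x y] that by (simp add: P_def)
    qed
    moreover have "openin unit_interval ?T" by (simp add: openin_open_Int)
    moreover have "p \<in> ?T" using p \<delta>(1) \<epsilon>(1) by simp
    ultimately show "\<exists>T. openin unit_interval T \<and> p \<in> T \<and> (\<forall>x\<in>T. \<forall>y\<in>T. P x \<longrightarrow> P y)" by blast
  qed (auto simp: P_def)
  then have eq: "h 1 \<otimes> inv (g 1) = h 0 \<otimes> inv (g 0)" by (simp add: P_def)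
  have c: "g 0 \<in> carrier \<Gamma>" "g 1 \<in> carrier \<Gamma>" "h 0 \<in> carrier \<Gamma>" "h 1 \<in> carrier \<Gamma>" using \<delta>(2) \<epsilon>(2) by auto
  have "inv (h 0) \<otimes> (h 1 \<otimes> inv (g 1)) \<otimes> g 1 = inv (h 0) \<otimes> (h 0 \<otimes> inv (g 0)) \<otimes> g 1" unfolding eq ..
  moreover have "inv (h 0) \<otimes> (h 1 \<otimes> inv (g 1)) \<otimes> g 1 = inv (h 0) \<otimes> h 1" using c by (simp add: m_assoc)
  moreover have "inv (h 0) \<otimes> (h 0 \<otimes> inv (g 0)) \<otimes> g 1 = inv (g 0) \<otimes> g 1" using c by (simp add: m_assoc[symmetric])
  ultimately show ?thesis by simp
qed

text \<open>The transport over the square restricts to a lift on each side. On the two sides where \<open>U\<close> is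
  constant the total translation is trivial, so it is equal on the other two.\<close>

lemma lift_homotopy_invariant:
  fixes U :: "real \<times> real \<Rightarrow> real \<Rightarrow> 'g"
  assumes st: "\<And>p. p \<in> {0..1} \<times> {0..1} \<Longrightarrow> stepfun (U p)"
    and loc: "\<And>p. p \<in> {0..1} \<times> {0..1} \<Longrightarrow>
      \<exists>B. open B \<and> p \<in> B \<and> (\<forall>q\<in>B \<inter> {0..1} \<times> {0..1}. \<exists>k. close (7/8) (U p) (U q) k)"
    and sides: "\<And>r. r \<in> {0..1} \<Longrightarrow> U (r, 0) = U (0, 0)" "\<And>r. r \<in> {0..1} \<Longrightarrow> U (r, 1) = U (0, 1)"
    and g: "lift (\<lambda>s. U (0, s)) g" and h: "lift (\<lambda>s. U (1, s)) h"
  shows "inv (g 0) \<otimes> g 1 = inv (h 0) \<otimes> h 1"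
proof -
  let ?D = "{0..1::real} \<times> {0..1::real}"
  have D: "compact ?D" "convex ?D" "0 \<in> ?D"
    by (auto intro: compact_Times convex_Times simp: zero_prod_def)
  obtain G \<delta> where G: "\<delta> > 0" "\<And>p. p \<in> ?D \<Longrightarrow> G p \<in> carrier \<Gamma>"
    "\<And>p q. p \<in> ?D \<Longrightarrow> q \<in> ?D \<Longrightarrow> dist p q < \<delta> \<Longrightarrow> close (3/4) (U p) (U q) (inv (G p) \<otimes> G q)"
    by (rule transport_exists[OF D st loc], assumption, assumption, rule that)
  have lift: "lift (\<lambda>s. U (a s, b s)) (\<lambda>s. G (a s, b s))"
    if ab: "(a = (\<lambda>s. c) \<and> b = (\<lambda>s. s) \<or> a = (\<lambda>s. s) \<and> b = (\<lambda>s. c)) \<and> c \<in> {0..1}" for a b c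
    unfolding lift_def
  proof (intro exI[of _ \<delta>] conjI ballI impI G(1))
    fix p :: real assume p: "p \<in> {0..1}"
    have in_D: "(a r, b r) \<in> ?D" if "r \<in> {0..1}" for r using ab that by auto
    show "G (a p, b p) \<in> carrier \<Gamma>" by (rule G(2)[OF in_D[OF p]])
    fix q :: real assume q: "q \<in> {0..1}" "dist p q < \<delta>"
    have "dist (a p, b p) (a q, b q) = dist p q" using ab by (auto simp: dist_Pair_Pair)
    then show "close (3/4) (U (a p, b p)) (U (a q, b q)) (inv (G (a p, b p)) \<otimes> G (a q, b q))"
      using q(2) by (intro G(3) in_D p q(1)) simp
  qed
  have const: "inv (G (0, c)) \<otimes> G (1, c) = \<one>" if c: "c \<in> {0..1}" "\<And>r. r \<in> {0..1} \<Longrightarrow> U (r, c) = U (0, c)" for c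
  proof -
    have "lift (\<lambda>s. U (s, c)) (\<lambda>s. \<one>)"
      unfolding lift_def
    proof (intro exI[of _ 1] conjI ballI impI)
      fix p q :: real assume pq: "p \<in> {0..1}" "q \<in> {0..1}"
      have "stepfun (U (0, c))" using st c(1) by simp
      from close_refl[OF this, of "3/4"]
      show "close (3/4) (U (p, c)) (U (q, c)) (inv \<one> \<otimes> \<one>)"
        unfolding c(2)[OF pq(1)] c(2)[OF pq(2)] by simp
    qed auto
    from lift_unique[OF _ lift[where a = "\<lambda>s. s" and b = "\<lambda>s. c" and c = c] this] show ?thesis
      using st c(1) by simp
  qed
  have e: "G (1, 0) = G (0, 0)" "G (1, 1) = G (0, 1)"
  proof -
    have eq: "y = x" if "x \<in> carrier \<Gamma>" "y \<in> carrier \<Gamma>" "inv x \<otimes> y = \<one>" for x y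
      using that by (metis inv_equality inv_inv inv_closed)
    show "G (1, 0) = G (0, 0)" by (rule eq[OF G(2) G(2) const[OF _ sides(1)]]) auto
    show "G (1, 1) = G (0, 1)" by (rule eq[OF G(2) G(2) const[OF _ sides(2)]]) auto
  qed
  have "inv (g 0) \<otimes> g 1 = inv (G (0, 0)) \<otimes> G (0, 1)"
    by (rule lift_unique[OF _ g lift[where a = "\<lambda>s. 0" and b = "\<lambda>s. s" and c = 0]]) (use st in auto)
  also have "\<dots> = inv (G (1, 0)) \<otimes> G (1, 1)" unfolding e ..
  also have "\<dots> = inv (h 0) \<otimes> h 1"
    by (rule lift_unique[OF _ lift[where a = "\<lambda>s. 1" and b = "\<lambda>s. s" and c = 1] h]) (use st in auto)
  finally show ?thesis .
qed

end

section \<open>Group-valued functors on a category\<close>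

locale group_valued_functor = based_category C c0 + step_functions \<Gamma>
  for C :: "('o, 'm) small_cat" and c0 :: 'o and \<Gamma> :: "('g, 'h) monoid_scheme" (structure) +
  fixes F :: "'o \<Rightarrow> 'o \<Rightarrow> 'm \<Rightarrow> 'g"
  assumes F_closed: "\<lbrakk>c \<in> Obj C; d \<in> Obj C; f \<in> Hom C c d\<rbrakk> \<Longrightarrow> F c d f \<in> carrier \<Gamma>"
    and F_comp: "\<lbrakk>a \<in> Obj C; b \<in> Obj C; c \<in> Obj C; f \<in> Hom C a b; g \<in> Hom C b c\<rbrakk> \<Longrightarrow>
      F a c (Comp C a b c g f) = F b c g \<otimes> F a b f"
begin

lemma F_Id: "c \<in> Obj C \<Longrightarrow> F c c (Id C c) = \<one>"
proof -
  assume c: "c \<in> Obj C"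
  note i = Id_in[OF c]
  have "F c c (Id C c) \<otimes> F c c (Id C c) = F c c (Id C c)"
    using F_comp[OF c c c i i] Comp_Id_left[OF c c i] by simp
  then show ?thesis using F_closed[OF c c i] l_cancel_one by blast
qed

text \<open>The step function of a point of a simplex: its value at \<open>s\<close> is the value of the functor on the
  morphism from the initial vertex to the vertex sampled by \<open>s\<close>.\<close>

definition step :: "(nat \<times> ((nat \<Rightarrow> 'o) \<times> (nat \<times> nat \<Rightarrow> 'm))) \<times> (nat \<Rightarrow> real) \<Rightarrow> real \<Rightarrow> 'g" where
  "step y s = (let x = snd (fst y); k = sample (snd y) s in F (fst x 0) (fst x k) (snd x (0, k)))"

lemma step_eq: "step ((n, (a, f)), t) s = F (a 0) (a (sample t s)) (f (0, sample t s))"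
  by (simp add: step_def Let_def)

lemma step_value_closed:
  "(a, f) \<in> nerve_simplices C n \<Longrightarrow> i \<le> n \<Longrightarrow> F (a 0) (a i) (f (0, i)) \<in> carrier \<Gamma>"
  by (intro F_closed nerve_simplexD) auto

lemma sample_preimage_measurable:
  assumes t: "t \<in> standard_simplex n"
  shows "{s \<in> {0..<1}. Q (sample t s)} \<in> sets borel"
    "{s \<in> {0..<1}. Q (sample t s)} = (\<Union>i\<in>{i. i \<le> n \<and> Q i}. {0..<1} \<inter> {partial_weight t i..<partial_weight t (Suc i)})"
proof -
  show eq: "{s \<in> {0..<1}. Q (sample t s)} =
      (\<Union>i\<in>{i. i \<le> n \<and> Q i}. {0..<1} \<inter> {partial_weight t i..<partial_weight t (Suc i)})"
  proof (intro equalityI subsetI)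
    fix s assume s: "s \<in> {s \<in> {0..<1}. Q (sample t s)}"
    then have "s \<in> {0..<1}" by simp
    from sample[OF t this] show "s \<in> (\<Union>i\<in>{i. i \<le> n \<and> Q i}. {0..<1} \<inter> {partial_weight t i..<partial_weight t (Suc i)})"
      using s by auto
  next
    fix s assume "s \<in> (\<Union>i\<in>{i. i \<le> n \<and> Q i}. {0..<1} \<inter> {partial_weight t i..<partial_weight t (Suc i)})"
    then obtain i where i: "i \<le> n" "Q i" "s \<in> {0..<1}" "partial_weight t i \<le> s" "s < partial_weight t (Suc i)" by auto
    then have "sample t s = i" using sample(2)[OF t i(3)] by blast
    then show "s \<in> {s \<in> {0..<1}. Q (sample t s)}" using i by simp
  qed
  show "{s \<in> {0..<1}. Q (sample t s)} \<in> sets borel" unfolding eq by (intro sets.finite_UN) auto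
qed

lemma stepfun_step:
  assumes "y \<in> topspace (simplex_sum NC)"
  shows "stepfun (step y)"
proof -
  obtain n a f t where y: "y = ((n, (a, f)), t)" by (metis surj_pair)
  have x: "(a, f) \<in> nerve_simplices C n" and t: "t \<in> standard_simplex n" using assms y by (auto simp: topspace_simplex_sum)
  let ?v = "\<lambda>i. F (a 0) (a i) (f (0, i))"
  have im: "step y ` {0..<1} \<subseteq> ?v ` {..n}"
    using sample(1)[OF t] unfolding y step_eq by auto
  moreover have "?v ` {..n} \<subseteq> carrier \<Gamma>" using step_value_closed[OF x] by auto
  moreover have "{s \<in> {0..<1}. step y s = z} \<in> sets borel" for z
    unfolding y step_eq by (rule sample_preimage_measurable(1)[OF t])
  ultimately show ?thesis unfolding stepfun_def using finite_subset[OF im] by blast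
qed

definition translates :: "(real \<Rightarrow> 'g) \<Rightarrow> (real \<Rightarrow> 'g) \<Rightarrow> bool" where
  "translates u v \<longleftrightarrow> (\<exists>k\<in>carrier \<Gamma>. \<forall>s\<in>{0..<1}. v s = u s \<otimes> k)"

lemma translates_refl: "stepfun u \<Longrightarrow> translates u u"
  unfolding translates_def by (intro bexI[of _ \<one>]) (auto simp: stepfun_closed)

lemma translates_sym:
  assumes "stepfun u" "translates u v"
  shows "translates v u"
proof -
  obtain k where k: "k \<in> carrier \<Gamma>" "\<And>s. s \<in> {0..<1} \<Longrightarrow> v s = u s \<otimes> k" using assms(2) by (auto simp: translates_def)
  have "u s = v s \<otimes> inv k" if "s \<in> {0..<1}" for s
    using k(2)[OF that] k(1) stepfun_closed[OF assms(1) that] by (simp add: m_assoc)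
  then show ?thesis unfolding translates_def using k(1) by (intro bexI[of _ "inv k"]) auto
qed

lemma translates_trans:
  assumes "stepfun u" "translates u v" "translates v w"
  shows "translates u w"
proof -
  obtain k where k: "k \<in> carrier \<Gamma>" "\<And>s. s \<in> {0..<1} \<Longrightarrow> v s = u s \<otimes> k" using assms(2) by (auto simp: translates_def)
  obtain l where l: "l \<in> carrier \<Gamma>" "\<And>s. s \<in> {0..<1} \<Longrightarrow> w s = v s \<otimes> l" using assms(3) by (auto simp: translates_def)
  have "w s = u s \<otimes> (k \<otimes> l)" if "s \<in> {0..<1}" for s
    using k l that stepfun_closed[OF assms(1) that] by (simp add: m_assoc)
  then show ?thesis unfolding translates_def using k(1) l(1) by (intro bexI[of _ "k \<otimes> l"]) auto
qed

text \<open>Passing to another simplex changes the initial vertex from \<open>0\<close> to \<open>\<theta> 0\<close>; by functoriality this is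
  a right translation by the value on the morphism between them.\<close>

lemma step_face:
  assumes x: "x \<in> nerve_simplices C n" and \<theta>: "\<theta> \<in> simplex_ops m n" and t: "t \<in> standard_simplex m"
  shows "translates (step ((m, nerve_act m \<theta> x), t)) (step ((n, x), simplex_push m \<theta> t))"
proof -
  obtain a f where af: "x = (a, f)" by fastforce
  note D = nerve_simplexD[OF x[unfolded af]]
  have \<theta>n: "\<theta> i \<le> n" if "i \<le> m" for i using \<theta> that by (auto simp: simplex_ops_def)
  have mono: "\<theta> 0 \<le> \<theta> i" if "i \<le> m" for i using \<theta> that by (auto simp: simplex_ops_def mono_on_def)
  let ?k = "F (a 0) (a (\<theta> 0)) (f (0, \<theta> 0))"
  have k: "?k \<in> carrier \<Gamma>" using step_value_closed[OF x[unfolded af]] \<theta>n[of 0] by simp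
  have "step ((n, x), simplex_push m \<theta> t) s = step ((m, nerve_act m \<theta> x), t) s \<otimes> ?k" if s: "s \<in> {0..<1}" for s
  proof -
    define i where "i = sample t s"
    have i: "i \<le> m" unfolding i_def by (rule sample(1)[OF t s])
    have "step ((n, x), simplex_push m \<theta> t) s = F (a 0) (a (\<theta> i)) (f (0, \<theta> i))"
      unfolding af step_eq sample_push[OF \<theta> t s] i_def ..
    also have "f (0, \<theta> i) = Comp C (a 0) (a (\<theta> 0)) (a (\<theta> i)) (f (\<theta> 0, \<theta> i)) (f (0, \<theta> 0))"
      by (rule D(4)[OF _ mono[OF i] \<theta>n[OF i]]) simp
    also have "F (a 0) (a (\<theta> i)) \<dots> = F (a (\<theta> 0)) (a (\<theta> i)) (f (\<theta> 0, \<theta> i)) \<otimes> ?k"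
      by (intro F_comp D(1,2)) (use \<theta>n[OF i] \<theta>n[of 0] mono[OF i] in auto)
    also have "F (a (\<theta> 0)) (a (\<theta> i)) (f (\<theta> 0, \<theta> i)) = step ((m, nerve_act m \<theta> x), t) s"
      using i by (simp add: af nerve_act_def step_eq i_def[symmetric] le_pairs_def)
    finally show ?thesis .
  qed
  then show ?thesis unfolding translates_def using k by blast
qed

lemma step_glue:
  assumes "glue_map NC y = glue_map NC z"
  shows "(y \<in> topspace (simplex_sum NC) \<longleftrightarrow> z \<in> topspace (simplex_sum NC)) \<and>
    (y \<in> topspace (simplex_sum NC) \<longrightarrow> translates (step y) (step z))" (is "?P y z")
proof -
  have "(y, z) \<in> realization_equiv NC" using assms glue_map_eq_iff by blast
  then show ?thesis
  proof (rule realization_equiv_invariant[where P = ?P])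
    fix m n \<theta> x and t :: "nat \<Rightarrow> real"
    assume x: "x \<in> simps_of NC n" and \<theta>: "\<theta> \<in> simplex_ops m n" and t: "t \<in> standard_simplex m"
    then show "?P ((m, simp_act NC m n \<theta> x), t) ((n, x), simplex_push m \<theta> t)"
      using nerve_act_simplex[of x n \<theta> m] simplex_push_in_simplex[OF \<theta> t] step_face[of x n \<theta> m t]
      by (simp add: topspace_simplex_sum)
  next
    show "?P y y" for y using translates_refl[OF stepfun_step] by blast
    show "?P z y" if "?P y z" for y z using translates_sym[OF stepfun_step] that by blast
    show "?P y w" if "?P y z" "?P z w" for y z w using translates_trans[OF stepfun_step] that by blast
  qed
qed

text \<open>The step function of an arbitrary representative. It is determined up to right translation, which
  is enough since \<open>\<exists>k. close \<epsilon> v u k\<close> does not change when \<open>u\<close> is translated.\<close>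

definition point_step where
  "point_step z = step (SOME y. y \<in> topspace (simplex_sum NC) \<and> glue_map NC y = z)"

lemma point_step:
  assumes "y \<in> topspace (simplex_sum NC)"
  shows "stepfun (point_step (glue_map NC y))" "translates (step y) (point_step (glue_map NC y))"
proof -
  let ?y = "SOME y'. y' \<in> topspace (simplex_sum NC) \<and> glue_map NC y' = glue_map NC y"
  have "?y \<in> topspace (simplex_sum NC) \<and> glue_map NC ?y = glue_map NC y"
    by (rule someI[of _ y]) (use assms in simp)
  then have y: "?y \<in> topspace (simplex_sum NC)" "glue_map NC y = glue_map NC ?y" by auto
  show "stepfun (point_step (glue_map NC y))" unfolding point_step_def by (rule stepfun_step[OF y(1)])
  show "translates (step y) (point_step (glue_map NC y))"
    unfolding point_step_def using step_glue[OF y(2)] assms by blast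
qed

lemma stepfun_point_step:
  assumes "z \<in> topspace RC"
  shows "stepfun (point_step z)"
proof -
  have "z \<in> glue_map NC ` topspace (simplex_sum NC)"
    using assms quotient_imp_surjective_map[OF quotient_map_glue[of NC]] by simp
  then show ?thesis using point_step(1) by (elim imageE) simp
qed

lemma close_translates:
  assumes "stepfun u" "translates u u'" "close \<epsilon> v u k"
    and v: "stepfun v"
  shows "\<exists>l. close \<epsilon> v u' l"
proof -
  obtain c where c: "c \<in> carrier \<Gamma>" "\<And>s. s \<in> {0..<1} \<Longrightarrow> u' s = u s \<otimes> c" using assms(2) by (auto simp: translates_def)
  have k: "k \<in> carrier \<Gamma>" using assms(3) by (simp add: close_def)
  have "u' s = v s \<otimes> (k \<otimes> c) \<longleftrightarrow> u s = v s \<otimes> k" if s: "s \<in> {0..<1}" for s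
    using c k s stepfun_closed[OF assms(1) s] stepfun_closed[OF v s] by (simp add: m_assoc[symmetric])
  then have "agree v u' (k \<otimes> c) = agree v u k" by (auto simp: agree_def)
  then show ?thesis using assms(3) c(1) by (auto simp: close_def)
qed

text \<open>On a simplex the measure of agreement with \<open>v\<close> is a finite sum over the vertices of the measures of
  fixed sets within the sampling intervals, whose ends depend continuously on the point.\<close>

lemma openin_close_simplex:
  assumes x: "x \<in> nerve_simplices C n" and v: "stepfun v"
  shows "openin (simplex_topology n) {t \<in> standard_simplex n. \<exists>k. close \<epsilon> v (step ((n, x), t)) k}"
proof -
  obtain a f where af: "x = (a, f)" by fastforce
  have "openin (simplex_topology n) {t \<in> standard_simplex n. measure lborel (agree v (step ((n, x), t)) k) > \<epsilon>}" for k
  proof -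
    define A where "A i = {s \<in> {0..<1}. F (a 0) (a i) (f (0, i)) = v s \<otimes> k}" for i
    have A: "A i \<in> sets borel" "A i \<subseteq> {0..<1}" for i
    proof -
      have "A i = (\<Union>z\<in>{z \<in> v ` {0..<1}. F (a 0) (a i) (f (0, i)) = z \<otimes> k}. {s \<in> {0..<1}. v s = z})"
        by (auto simp: A_def)
      also have "\<dots> \<in> sets borel" using v unfolding stepfun_def by (intro sets.finite_UN) auto
      finally show "A i \<in> sets borel" .
    qed (auto simp: A_def)
    have eq: "measure lborel (agree v (step ((n, x), t)) k) =
      (\<Sum>i\<le>n. measure lborel (A i \<inter> {..<partial_weight t (Suc i)}) - measure lborel (A i \<inter> {..<partial_weight t i}))"
      if t: "t \<in> standard_simplex n" for t
    proof -
      let ?I = "\<lambda>i. A i \<inter> {partial_weight t i..<partial_weight t (Suc i)}"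
      have "agree v (step ((n, x), t)) k = (\<Union>i\<in>{..n}. ?I i)"
      proof (intro equalityI subsetI)
        fix s assume "s \<in> agree v (step ((n, x), t)) k"
        then have s: "s \<in> {0..<1}" "step ((n, x), t) s = v s \<otimes> k" by (auto simp: agree_def)
        then show "s \<in> (\<Union>i\<in>{..n}. ?I i)"
          using sample[OF t s(1)] by (auto simp: A_def af step_eq)
      next
        fix s assume "s \<in> (\<Union>i\<in>{..n}. ?I i)"
        then obtain i where i: "s \<in> A i" "partial_weight t i \<le> s" "s < partial_weight t (Suc i)" by auto
        then have "sample t s = i" using sample(2)[OF t, of s i] A(2) by blast
        then show "s \<in> agree v (step ((n, x), t)) k" using i(1) by (auto simp: agree_def A_def af step_eq)
      qed
      moreover have "measure lborel (\<Union>i\<in>{..n}. ?I i) = (\<Sum>i\<in>{..n}. measure lborel (?I i))"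
      proof (rule measure_finite_Union)
        show "disjoint_family_on ?I {..n}"
          unfolding disjoint_family_on_def
        proof (intro ballI impI)
          fix i j assume ij: "i \<in> {..n}" "j \<in> {..n}" "i \<noteq> j"
          show "?I i \<inter> ?I j = {}"
          proof (rule ccontr)
            assume "?I i \<inter> ?I j \<noteq> {}"
            then obtain s where s: "s \<in> ?I i" "s \<in> ?I j" by blast
            then have "s \<in> {0..<1}" using A(2) by blast
            from sample(2)[OF t this] s have "sample t s = i" "sample t s = j" by auto
            then show False using ij(3) by simp
          qed
        qed
        show "emeasure lborel (?I i) \<noteq> \<infinity>" if "i \<in> {..n}" for i
        proof -
          have "?I i \<in> sets borel" "?I i \<subseteq> {0..<1}" using A[of i] by auto
          from fmeasurable_unit[OF this] show ?thesis by (simp add: fmeasurable_def less_top)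
        qed
      qed (use A in auto)
      moreover have "measure lborel (?I i) = measure lborel (A i \<inter> {..<partial_weight t (Suc i)}) - measure lborel (A i \<inter> {..<partial_weight t i})" for i
        by (rule continuous_on_truncated_measure(2)[OF A partial_weight_mono[OF t]]) simp
      ultimately show ?thesis by simp
    qed
    have proj: "continuous_map (simplex_topology n) euclideanreal (\<lambda>t. t j)" for j
      unfolding simplex_topology_def
      by (intro continuous_map_from_subtopology continuous_map_product_projection) simp
    have pw: "continuous_map (simplex_topology n) euclideanreal (\<lambda>t. partial_weight t j)" for j
      unfolding partial_weight_def by (intro continuous_map_sum proj) auto
    have "continuous_map (simplex_topology n) euclideanreal (\<lambda>t. measure lborel (A i \<inter> {..<partial_weight t j}))" for i j
      using continuous_map_compose[OF pw, of euclideanreal "\<lambda>c. measure lborel (A i \<inter> {..<c})" j]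
        continuous_on_truncated_measure(1)[OF A] by (simp add: o_def)
    then have "continuous_map (simplex_topology n) euclideanreal
      (\<lambda>t. \<Sum>i\<le>n. measure lborel (A i \<inter> {..<partial_weight t (Suc i)}) - measure lborel (A i \<inter> {..<partial_weight t i}))"
      by (intro continuous_map_sum continuous_map_diff) auto
    from openin_continuous_map_preimage[OF this, of "{\<epsilon><..}"]
    show ?thesis using eq by (simp cong: conj_cong)
  qed
  then have "openin (simplex_topology n) (\<Union>k\<in>carrier \<Gamma>. {t \<in> standard_simplex n. measure lborel (agree v (step ((n, x), t)) k) > \<epsilon>})"
    by (intro openin_Union) auto
  also have "(\<Union>k\<in>carrier \<Gamma>. {t \<in> standard_simplex n. measure lborel (agree v (step ((n, x), t)) k) > \<epsilon>}) =
    {t \<in> standard_simplex n. \<exists>k. close \<epsilon> v (step ((n, x), t)) k}"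
    by (auto simp: close_def)
  finally show ?thesis .
qed

lemma openin_close:
  assumes v: "stepfun v"
  shows "openin RC {z \<in> topspace RC. \<exists>k. close \<epsilon> v (point_step z) k}" (is "openin RC ?V")
proof -
  let ?E = "{y \<in> topspace (simplex_sum NC). \<exists>k. close \<epsilon> v (step y) k}"
  have im: "glue_map NC y \<in> topspace RC" if "y \<in> topspace (simplex_sum NC)" for y
    using that quotient_imp_surjective_map[OF quotient_map_glue[of NC]] by blast
  have "(\<exists>k. close \<epsilon> v (point_step (glue_map NC y)) k) \<longleftrightarrow> (\<exists>k. close \<epsilon> v (step y) k)"
    if y: "y \<in> topspace (simplex_sum NC)" for y
    using close_translates[OF stepfun_step[OF y] point_step(2)[OF y] _ v]
      close_translates[OF point_step(1)[OF y] translates_sym[OF stepfun_step[OF y] point_step(2)[OF y]] _ v] by blast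
  then have eq: "{y \<in> topspace (simplex_sum NC). glue_map NC y \<in> ?V} = ?E" using im by blast
  have "openin (simplex_sum NC) ?E"
    unfolding simplex_sum_def openin_sum_topology
  proof (intro conjI ballI)
    fix nx assume nx: "nx \<in> (SIGMA n:UNIV. simps_of NC n)"
    obtain n x where nx': "nx = (n, x)" by (cases nx)
    have x: "x \<in> nerve_simplices C n" using nx nx' by simp
    have "{t. (nx, t) \<in> ?E} = {t \<in> standard_simplex n. \<exists>k. close \<epsilon> v (step ((n, x), t)) k}"
      using x by (auto simp: nx' topspace_simplex_sum)
    then show "openin ((\<lambda>(n, x). simplex_topology n) nx)
      {t. (nx, t) \<in> {y \<in> topspace (sum_topology (\<lambda>(n, x). simplex_topology n) (SIGMA n:UNIV. simps_of NC n)). \<exists>k. close \<epsilon> v (step y) k}}"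
      using openin_close_simplex[OF x v] by (simp add: nx' simplex_sum_def)
  qed auto
  then show ?thesis
    using quotient_map_glue[of NC, unfolded quotient_map_def, THEN conjunct2, rule_format, of ?V] eq by auto
qed

lemma nerve_edge_simplex:
  assumes "c \<in> Obj C" "d \<in> Obj C" "f \<in> Hom C c d"
  shows "nerve_edge C c d f \<in> nerve_simplices C 1"
proof -
  obtain a m where x: "(a, m) \<in> nerve_simplices C 2" "a 0 = c" "a 1 = d" "m (0, 1) = f"
    using edge_simplex[OF assms] by blast
  have "(\<lambda>k. if k = 0 then 0 else 1) \<in> simplex_ops 1 2" by (auto simp: simplex_ops_def mono_on_def)
  from nerve_act_simplex[OF x(1) this] show ?thesis using nerve_act_edge[OF x(1), of 0 1] x by simp
qed

text \<open>At the point \<open>s\<close> of the edge of \<open>f\<close>, the step function is \<open>\<one>\<close> on \<open>[0,1-s)\<close> and the value of \<open>f\<close> on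
  \<open>[1-s,1)\<close>. Let \<open>g s\<close> be the translation from it to the step function of the chosen representative.
  Evaluation at the parameter \<open>0\<close> gives the two boundary values, as \<open>0\<close> lies in the first interval at
  the start of the edge and in the second one at its end.\<close>

lemma edge_lift:
  assumes c: "c \<in> Obj C" "d \<in> Obj C" and f: "f \<in> Hom C c d"
  obtains g where "lift (\<lambda>s. point_step (edge c d f s)) g" "g 0 = point_step (vert c) 0"
    "F c d f \<otimes> g 1 = point_step (vert d) 0" "g 1 \<in> carrier \<Gamma>"
proof -
  define t where "t s = (\<lambda>i::nat. if i = 0 then 1 - s else if i = 1 then s else 0)" for s :: real
  let ?e = "nerve_edge C c d f"
  have t: "t s \<in> standard_simplex 1" if "s \<in> {0..1}" for s
    using that by (auto simp: standard_simplex_def t_def)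
  have y: "((1, ?e), t s) \<in> topspace (simplex_sum NC)" if "s \<in> {0..1}" for s
    using nerve_edge_simplex[OF assms] t[OF that] by (simp add: topspace_simplex_sum)
  have edge_glue: "edge c d f s = glue_map NC ((1, ?e), t s)" for s
    by (simp add: edge_def edge_path_def realization_point_glue t_def)
  have step: "step ((1, ?e), t s) r = (if r < 1 - s then \<one> else F c d f)" if s: "s \<in> {0..1}" "r \<in> {0..<1}" for s r
  proof -
    have "sample (t s) r = (if r < 1 - s then 0 else 1)"
      unfolding sample(2)[OF t[OF s(1)] s(2)] using s by (simp add: partial_weight_def t_def)
    then show ?thesis using F_Id[OF c(1)]
      by (auto simp: step_def nerve_edge_def le_pairs_def)
  qed
  have "\<forall>s\<in>{0..1}. \<exists>k. k \<in> carrier \<Gamma> \<and> (\<forall>r\<in>{0..<1}. point_step (edge c d f s) r = step ((1, ?e), t s) r \<otimes> k)"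
    using point_step(2)[OF y] unfolding edge_glue translates_def by blast
  then obtain g where g: "\<And>s. s \<in> {0..1} \<Longrightarrow> g s \<in> carrier \<Gamma>"
    "\<And>s r. s \<in> {0..1} \<Longrightarrow> r \<in> {0..<1} \<Longrightarrow> point_step (edge c d f s) r = step ((1, ?e), t s) r \<otimes> g s"
    by metis
  have st: "stepfun (point_step (edge c d f s))" if "s \<in> {0..1}" for s
    unfolding edge_glue by (rule point_step(1)[OF y[OF that]])
  have Fc: "F c d f \<in> carrier \<Gamma>" by (rule F_closed[OF assms])
  have ends: "edge c d f 0 = vert c" "edge c d f 1 = vert d"
    using path_betweenD(2,3)[OF path_between_edge[OF assms]] .
  show thesis
  proof (rule that[of g])
    show "lift (\<lambda>s. point_step (edge c d f s)) g"
      unfolding lift_def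
    \<comment> \<open>For \<open>|p - q| < 1/4\<close> the two step functions of the edge differ at most on an interval of length less
      than \<open>1/4\<close>.\<close>
    proof (intro exI[of _ "1/4"] conjI ballI impI g(1))
      fix p q :: real assume p: "p \<in> {0..1}" and q: "q \<in> {0..1}" and pq: "dist p q < 1/4"
      let ?G = "agree (point_step (edge c d f p)) (point_step (edge c d f q)) (inv (g p) \<otimes> g q)"
      let ?M = "{1 - max p q..<1 - min p q}"
      have "r \<in> ?G" if r: "r \<in> {0..<1}" "r \<notin> ?M" for r
      proof -
        have eq: "r < 1 - p \<longleftrightarrow> r < 1 - q" using r(2) by (auto simp: min_def max_def split: if_splits)
        define w where "w = (if r < 1 - p then \<one> else F c d f)"
        have w: "w \<in> carrier \<Gamma>" using Fc by (simp add: w_def)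
        have "point_step (edge c d f p) r = w \<otimes> g p" "point_step (edge c d f q) r = w \<otimes> g q"
          unfolding g(2)[OF p r(1)] g(2)[OF q r(1)] step[OF p r(1)] step[OF q r(1)] w_def eq by simp_all
        moreover have "w \<otimes> g p \<otimes> (inv (g p) \<otimes> g q) = w \<otimes> (g p \<otimes> inv (g p)) \<otimes> g q"
          using w g(1)[OF p] g(1)[OF q] by (simp only: m_assoc m_closed inv_closed)
        ultimately show ?thesis using r(1) w g(1)[OF p] g(1)[OF q] by (simp add: agree_def)
      qed
      then have sub: "{0..<1} \<subseteq> ?G \<union> ?M" by blast
      have Gm: "?G \<in> sets borel" "?G \<subseteq> {0..<1}" using agree_measurable[OF st[OF p] st[OF q]] by blast+
      have "?G \<union> ?M \<in> fmeasurable lborel"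
        using fmeasurable_unit[OF Gm] by (intro fmeasurable.Un) (auto simp: fmeasurable_def)
      then have "measure lborel {0..<1::real} \<le> measure lborel (?G \<union> ?M)"
        by (intro measure_mono_fmeasurable[OF sub]) auto
      also have "\<dots> \<le> measure lborel ?G + measure lborel ?M"
        using Gm by (intro measure_Un_le) auto
      also have "measure lborel ?M = max p q - min p q" by (subst measure_lborel_Ico) auto
      finally have "measure lborel ?G > 3/4"
        using pq by (auto simp: measure_lborel_Ico dist_real_def max_def min_def split: if_splits)
      then show "close (3/4) (point_step (edge c d f p)) (point_step (edge c d f q)) (inv (g p) \<otimes> g q)"
        using g(1)[OF p] g(1)[OF q] by (simp add: close_def)
    qed auto
    show "g 0 = point_step (vert c) 0"
      using g(2)[of 0 0] step[of 0 0] ends(1) g(1)[of 0] by simp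
    show "F c d f \<otimes> g 1 = point_step (vert d) 0"
      using g(2)[of 1 0] step[of 1 0] ends(2) by simp
    show "g 1 \<in> carrier \<Gamma>" using g(1) by simp
  qed
qed

text \<open>Along the edge of \<open>f\<close>, the total translation of the step functions is the inverse of the value of
  \<open>f\<close>, conjugated by a constant that depends on the base vertex only. It is invariant under homotopy.\<close>

theorem homotopic_edges_imp_equal:
  assumes f: "f \<in> Hom C c0 c0" "f' \<in> Hom C c0 c0"
    and hom: "path_homotopic RC (edge c0 c0 f) (edge c0 c0 f')"
  shows "F c0 c0 f = F c0 c0 f'"
proof -
  note E = path_between_edge[OF c0 c0 f(1)]
  obtain h where h: "continuous_map (prod_topology unit_interval unit_interval) RC h"
    "\<And>s. h (0, s) = edge c0 c0 f s" "\<And>s. h (1, s) = edge c0 c0 f' s"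
    "\<And>r. r \<in> {0..1} \<Longrightarrow> h (r, 0) = vert c0 \<and> h (r, 1) = vert c0"
    using hom path_betweenD(2,3)[OF E] unfolding path_homotopic_def homotopic_with_def by auto
  let ?D = "{0..1::real} \<times> {0..1::real}"
  have K: "prod_topology unit_interval unit_interval = top_of_set ?D"
    by (simp add: prod_topology_subtopology(1)[symmetric] subtopology_Times[symmetric])
  have hc: "continuous_map (top_of_set ?D) RC h" using h(1) unfolding K .
  have hD: "h p \<in> topspace RC" if "p \<in> ?D" for p using hc that by (auto simp: continuous_map_def Pi_def)
  define U where "U p = point_step (h p)" for p
  have st: "stepfun (U p)" if "p \<in> ?D" for p unfolding U_def by (rule stepfun_point_step[OF hD[OF that]])
  have loc: "\<exists>B. open B \<and> p \<in> B \<and> (\<forall>q\<in>B \<inter> ?D. \<exists>k. close (7/8) (U p) (U q) k)" if p: "p \<in> ?D" for p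
  proof -
    have "openin (top_of_set ?D) {q \<in> topspace (top_of_set ?D). h q \<in> {z \<in> topspace RC. \<exists>k. close (7/8) (U p) (point_step z) k}}"
      by (rule openin_continuous_map_preimage[OF hc openin_close[OF st[OF p]]])
    then obtain B where B: "open B" "{q \<in> ?D. h q \<in> {z \<in> topspace RC. \<exists>k. close (7/8) (U p) (point_step z) k}} = ?D \<inter> B"
      unfolding openin_open by auto
    have "close (7/8) (U p) (U p) \<one>" by (rule close_refl[OF st[OF p]]) simp
    then have "p \<in> B" using B(2) p hD[OF p] unfolding U_def by blast
    moreover have "\<exists>k. close (7/8) (U p) (U q) k" if "q \<in> B \<inter> ?D" for q
      using that B(2) unfolding U_def by blast
    ultimately show ?thesis using B(1) by blast
  qed
  obtain g where g: "lift (\<lambda>s. point_step (edge c0 c0 f s)) g" "g 0 = point_step (vert c0) 0"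
    "F c0 c0 f \<otimes> g 1 = point_step (vert c0) 0" "g 1 \<in> carrier \<Gamma>" by (rule edge_lift[OF c0 c0 f(1)])
  obtain g' where g': "lift (\<lambda>s. point_step (edge c0 c0 f' s)) g'" "g' 0 = point_step (vert c0) 0"
    "F c0 c0 f' \<otimes> g' 1 = point_step (vert c0) 0" "g' 1 \<in> carrier \<Gamma>" by (rule edge_lift[OF c0 c0 f(2)])
  have v: "point_step (vert c0) 0 \<in> carrier \<Gamma>"
    using stepfun_closed[OF stepfun_point_step[OF vert_in_topspace[OF c0]]] by simp
  have "inv (g 0) \<otimes> g 1 = inv (g' 0) \<otimes> g' 1"
    by (rule lift_homotopy_invariant[where U = U, OF st loc]) 
      (use h(2-4) g(1) g'(1) path_betweenD(2,3)[OF E] in \<open>simp_all add: U_def\<close>)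
  then have "g 1 = g' 1" using g g' v by simp
  then show ?thesis using g g' F_closed[OF c0 c0 f(1)] F_closed[OF c0 c0 f(2)] by (metis right_cancel)
qed

end

section \<open>Maps of coset spaces\<close>

context group
begin

lemma p_subgroup_generate_singleton:
  assumes "prime p" "u \<in> carrier G" "u [^] (p ^ k) = \<one>"
  shows "p_subgroup G p (generate G {u})"
proof -
  have "ord u dvd p ^ k" using pow_eq_id[OF assms(2)] assms(3) by blast
  then obtain j where "ord u = p ^ j" using divides_primepow_nat[OF assms(1)] by blast
  then show ?thesis
    using generate_pow_card[OF assms(2)] generate_is_subgroup[of "{u}"] assms(2) by (auto simp: p_subgroup_def)
qed

lemma lcosets_memI: "x \<in> carrier G \<Longrightarrow> x <# P \<in> lcosets P"
  by (auto simp: LCOSETS_def)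

lemma subgroup_in_lcosets: "subgroup P G \<Longrightarrow> P \<in> lcosets P"
  using lcosets_memI[of \<one> P] lcos_mult_one[OF subgroup.subset] by simp

lemma lcosets_act: "P \<subseteq> carrier G \<Longrightarrow> g \<in> carrier G \<Longrightarrow> C \<in> lcosets P \<Longrightarrow> g <# C \<in> lcosets P"
  by (auto simp: LCOSETS_def lcos_m_assoc)

lemma lcosets_inj:
  assumes "subgroup P G" "subgroup Q G" "lcosets P = lcosets Q"
  shows "P = Q"
proof -
  have "P \<in> lcosets Q" using subgroup_in_lcosets[OF assms(1)] assms(3) by simp
  then obtain y where y: "y \<in> carrier G" "P = y <# Q" by (auto simp: LCOSETS_def)
  then have "\<one> \<in> y <# Q" using subgroup.one_closed[OF assms(1)] by simp
  from l_repr_independence[OF this y(1) assms(2)] show ?thesis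
    using y(2) lcos_mult_one[OF subgroup.subset[OF assms(2)]] by simp
qed

lemma G_mapsD:
  assumes "f \<in> G_maps G X Y"
  shows "f \<in> X \<rightarrow>\<^sub>E Y" "g \<in> carrier G \<Longrightarrow> C \<in> X \<Longrightarrow> f (g <# C) = g <# f C"
  using assms by (auto simp: G_maps_def)

lemma G_maps_eqI:
  assumes P: "subgroup P G" and f: "f \<in> G_maps G (lcosets P) Y" and f': "f' \<in> G_maps G (lcosets P) Y'"
    and eq: "f P = f' P"
  shows "f = f'"
proof
  fix C
  show "f C = f' C"
  proof (cases "C \<in> lcosets P")
    case True
    then obtain x where "x \<in> carrier G" "C = x <# P" by (auto simp: LCOSETS_def)
    then show ?thesis
      using G_mapsD(2)[OF f _ subgroup_in_lcosets[OF P]] G_mapsD(2)[OF f' _ subgroup_in_lcosets[OF P]] eq by simp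
  next
    case False
    then show ?thesis using G_mapsD(1)[OF f] G_mapsD(1)[OF f'] by (simp add: PiE_def extensional_def)
  qed
qed

text \<open>The \<open>G\<close>-map \<open>gP \<mapsto> gxQ\<close>. The product of sets avoids the choice of \<open>g\<close>.\<close>

definition coset_map :: "'a set \<Rightarrow> 'a set \<Rightarrow> 'a \<Rightarrow> 'a set \<Rightarrow> 'a set" where
  "coset_map P Q x = restrict (\<lambda>C. C <#> (x <# Q)) (lcosets P)"

lemma coset_map_apply:
  assumes P: "subgroup P G" and Q: "subgroup Q G" and x: "x \<in> carrier G" and PQ: "conj_set G P x \<subseteq> Q"
    and g: "g \<in> carrier G"
  shows "coset_map P Q x (g <# P) = (g \<otimes> x) <# Q"
proof -
  have Pc: "a \<in> carrier G" if "a \<in> P" for a using that P subgroup.mem_carrier by metis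
  have Qc: "a \<in> carrier G" if "a \<in> Q" for a using that Q subgroup.mem_carrier by metis
  have "(g <# P) <#> (x <# Q) = (g \<otimes> x) <# Q"
  proof (intro equalityI subsetI)
    fix y assume "y \<in> (g <# P) <#> (x <# Q)"
    then obtain a q where y: "a \<in> P" "q \<in> Q" "y = (g \<otimes> a) \<otimes> (x \<otimes> q)"
      by (auto simp: set_mult_def l_coset_def)
    have xx: "x \<otimes> (inv x \<otimes> w) = w" if "w \<in> carrier G" for w using x that by (simp add: m_assoc[symmetric])
    have "y = (g \<otimes> x) \<otimes> ((inv x \<otimes> a \<otimes> x) \<otimes> q)"
      unfolding y(3) using g x Pc[OF y(1)] Qc[OF y(2)] by (simp add: m_assoc xx)
    moreover have "inv x \<otimes> a \<otimes> x \<in> Q" using PQ y(1) by (auto simp: conj_set_def)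
    ultimately show "y \<in> (g \<otimes> x) <# Q"
      using subgroup.m_closed[OF Q _ y(2)] by (auto simp: l_coset_def)
  next
    fix y assume "y \<in> (g \<otimes> x) <# Q"
    then obtain q where q: "q \<in> Q" "y = g \<otimes> x \<otimes> q" by (auto simp: l_coset_def)
    then have "y = (g \<otimes> \<one>) \<otimes> (x \<otimes> q)" using g x Qc by (simp add: m_assoc)
    then show "y \<in> (g <# P) <#> (x <# Q)"
      using subgroup.one_closed[OF P] q(1) unfolding set_mult_def l_coset_def by blast
  qed
  then show ?thesis using lcosets_memI[OF g] by (simp add: coset_map_def)
qed

lemma coset_map_base:
  assumes "subgroup P G" "subgroup Q G" "x \<in> carrier G" "conj_set G P x \<subseteq> Q"
  shows "coset_map P Q x P = x <# Q"
  using coset_map_apply[OF assms one_closed] lcos_mult_one[OF subgroup.subset[OF assms(1)]] assms(3) by simp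

lemma coset_map_G_map:
  assumes P: "subgroup P G" and Q: "subgroup Q G" and x: "x \<in> carrier G" and PQ: "conj_set G P x \<subseteq> Q"
  shows "coset_map P Q x \<in> G_maps G (lcosets P) (lcosets Q)"
proof -
  have "coset_map P Q x C \<in> lcosets Q \<and> (\<forall>g\<in>carrier G. coset_map P Q x (g <# C) = g <# coset_map P Q x C)"
    if C: "C \<in> lcosets P" for C
  proof -
    obtain h where h: "h \<in> carrier G" "C = h <# P" using C by (auto simp: LCOSETS_def)
    have "coset_map P Q x (g <# C) = g <# coset_map P Q x C" if "g \<in> carrier G" for g
      unfolding h(2) lcos_m_assoc[OF subgroup.subset[OF P] that h(1)] coset_map_apply[OF assms h(1)]
        coset_map_apply[OF assms m_closed[OF that h(1)]]
      using lcos_m_assoc[OF subgroup.subset[OF Q] that m_closed[OF h(1) x]] that h(1) x by (simp add: m_assoc)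
    then show ?thesis using coset_map_apply[OF assms h(1)] lcosets_memI h x by simp
  qed
  then show ?thesis
    unfolding G_maps_def by (auto simp: coset_map_def)
qed

lemma G_map_is_coset_map:
  assumes P: "subgroup P G" and Q: "subgroup Q G" and f: "f \<in> G_maps G (lcosets P) (lcosets Q)"
    and x: "x \<in> carrier G" "f P = x <# Q"
  shows "conj_set G P x \<subseteq> Q" "f = coset_map P Q x"
proof -
  have "a <# (x <# Q) = x <# Q" if "a \<in> P" for a
  proof -
    have a: "a \<in> carrier G" using that P subgroup.mem_carrier by metis
    have "a <# P = P" using coset_join3[OF a P that] .
    then show ?thesis using G_mapsD(2)[OF f a subgroup_in_lcosets[OF P]] x(2) by simp
  qed
  then show PQ: "conj_set G P x \<subseteq> Q" using coset_fixed_iff[OF subgroup.subset[OF P] Q x(1)] by blast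
  show "f = coset_map P Q x"
    by (rule G_maps_eqI[OF P f coset_map_G_map[OF P Q x(1) PQ]]) (simp add: coset_map_base[OF P Q x(1) PQ] x(2))
qed

lemma G_map_value:
  assumes P: "subgroup P G" and f: "f \<in> G_maps G (lcosets P) (lcosets Q)"
  obtains x where "x \<in> carrier G" "f P = x <# Q"
  using PiE_mem[OF G_mapsD(1)[OF f] subgroup_in_lcosets[OF P]] by (auto simp: LCOSETS_def)

lemma coset_map_eqI:
  assumes "subgroup P G" "subgroup Q G" "x \<in> carrier G" "conj_set G P x \<subseteq> Q" "q \<in> Q"
  shows "coset_map P Q (x \<otimes> q) = coset_map P Q x"
proof -
  have q: "q \<in> carrier G" using assms subgroup.mem_carrier by metis
  have "(x \<otimes> q) <# Q = x <# (q <# Q)" using lcos_m_assoc[OF subgroup.subset[OF assms(2)] assms(3) q] by simp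
  then have eq: "(x \<otimes> q) <# Q = x <# Q" using coset_join3[OF q assms(2,5)] by simp
  show ?thesis unfolding coset_map_def eq ..
qed

lemma compose_G_maps:
  assumes "f \<in> G_maps G X Y" "g \<in> G_maps G Y Z" "\<And>h C. h \<in> carrier G \<Longrightarrow> C \<in> X \<Longrightarrow> h <# C \<in> X"
  shows "compose X g f \<in> G_maps G X Z"
proof -
  note f = G_mapsD[OF assms(1)] and g = G_mapsD[OF assms(2)]
  have fY: "f C \<in> Y" if "C \<in> X" for C using PiE_mem[OF f(1) that] .
  have gZ: "g D \<in> Z" if "D \<in> Y" for D using PiE_mem[OF g(1) that] .
  show ?thesis
    unfolding G_maps_def using f(2) g(2) fY gZ assms(3) by (auto simp: compose_def)
qed

lemma compose_coset_map:
  assumes P: "subgroup P G" and Q: "subgroup Q G" and R: "subgroup R G" and x: "x \<in> carrier G" "conj_set G P x \<subseteq> Q"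
    and y: "y \<in> carrier G" "conj_set G Q y \<subseteq> R"
  shows "compose (lcosets P) (coset_map Q R y) (coset_map P Q x) = coset_map P R (x \<otimes> y)"
    "conj_set G P (x \<otimes> y) \<subseteq> R"
proof -
  show sub: "conj_set G P (x \<otimes> y) \<subseteq> R"
    using conj_set_mono[OF x(2), of y] y(2) conj_set_mult[OF subgroup.subset[OF P] x(1) y(1)] by simp
  note f = coset_map_G_map[OF P Q x] and g = coset_map_G_map[OF Q R y]
  have c: "compose (lcosets P) (coset_map Q R y) (coset_map P Q x) \<in> G_maps G (lcosets P) (lcosets R)"
    by (rule compose_G_maps[OF f g]) (rule lcosets_act[OF subgroup.subset[OF P]])
  show "compose (lcosets P) (coset_map Q R y) (coset_map P Q x) = coset_map P R (x \<otimes> y)"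
  proof (rule G_maps_eqI[OF P c coset_map_G_map[OF P R m_closed[OF x(1) y(1)] sub]])
    show "compose (lcosets P) (coset_map Q R y) (coset_map P Q x) P = coset_map P R (x \<otimes> y) P"
      using compose_eq[OF subgroup_in_lcosets[OF P], of "coset_map Q R y" "coset_map P Q x"] coset_map_base[OF P Q x] coset_map_apply[OF Q R y x(1)]
        coset_map_base[OF P R m_closed[OF x(1) y(1)] sub] by simp
  qed
qed

end

section \<open>The orbit category\<close>

locale orbit_setting = sylow_system +
  assumes p_dvd: "p dvd order G"
begin

abbreviation OC where "OC \<equiv> orbit_cat G p"

definition obj_group :: "'a set \<Rightarrow> bool" where
  "obj_group P \<longleftrightarrow> p_subgroup G p P \<and> P \<noteq> {\<one>}"

lemma Obj_OC: "X \<in> Obj OC \<longleftrightarrow> (\<exists>P. obj_group P \<and> X = lcosets P)"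
  by (auto simp: orbit_cat_def obj_group_def)

lemma Hom_OC [simp]: "Hom OC = G_maps G"
  by (simp add: orbit_cat_def)

lemma Comp_OC [simp]: "Comp OC X Y Z g f = compose X g f"
  by (simp add: orbit_cat_def)

lemma Id_OC: "Id OC X = (\<lambda>C\<in>X. C)"
  by (simp add: orbit_cat_def restrict_def fun_eq_iff)

lemma obj_groupD: "obj_group P \<Longrightarrow> subgroup P G" "obj_group P \<Longrightarrow> P \<subseteq> carrier G"
  using subgroup.subset by (auto simp: obj_group_def p_subgroup_def)

lemma sub_obj_group: "sub P \<Longrightarrow> obj_group P"
  using p_subgroup_sub subD by (auto simp: obj_group_def)

lemma sub_S: "sub S"
proof -
  have "order G \<noteq> 0" using order_gt_0_iff_finite fin by simp
  then have "multiplicity p (order G) > 0"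
    using p_dvd prime_p by (simp add: prime_multiplicity_gt_zero_iff)
  then have "card S > 1"
    using sylow_S one_less_power[OF prime_gt_1_nat[OF prime_p], of "multiplicity p (order G)"] by (simp add: sylow_subgroup_def)
  then show ?thesis using S(1) by (auto simp: nontrivial_subgroup_of_def)
qed

sublocale OC: based_category OC "lcosets S"
proof
  have act: "h <# C \<in> X" if "X \<in> Obj OC" "h \<in> carrier G" "C \<in> X" for X h C
    using that lcosets_act obj_groupD unfolding Obj_OC by blast
  have ext: "f \<in> X \<rightarrow> Y" "f \<in> extensional X" if "f \<in> Hom OC X Y" for f X Y
    using that G_mapsD(1)[of f X Y] by (auto simp: PiE_def)
  show "Id OC X \<in> Hom OC X X" if "X \<in> Obj OC" for X
    using act[OF that] by (auto simp: Id_OC G_maps_def)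
  show "Comp OC X Y Z g f \<in> Hom OC X Z"
    if "X \<in> Obj OC" "Y \<in> Obj OC" "Z \<in> Obj OC" "f \<in> Hom OC X Y" "g \<in> Hom OC Y Z" for X Y Z f g
    using compose_G_maps[of f X Y g Z] act[OF that(1)] that(4,5) by simp
  show "Comp OC X X Y f (Id OC X) = f" if "X \<in> Obj OC" "Y \<in> Obj OC" "f \<in> Hom OC X Y" for X Y f
    using compose_Id[OF ext[OF that(3)]] by (simp add: Id_OC)
  show "Comp OC X Y Y (Id OC Y) f = f" if "X \<in> Obj OC" "Y \<in> Obj OC" "f \<in> Hom OC X Y" for X Y f
    using Id_compose[OF ext[OF that(3)]] by (simp add: Id_OC)
  show "Comp OC W Y Z h (Comp OC W X Y g f) = Comp OC W X Z (Comp OC X Y Z h g) f"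
    if "W \<in> Obj OC" "X \<in> Obj OC" "Y \<in> Obj OC" "Z \<in> Obj OC" "f \<in> Hom OC W X" "g \<in> Hom OC X Y" "h \<in> Hom OC Y Z"
    for W X Y Z f g h
    using compose_assoc[OF ext(1)[OF that(5)]] by simp
  show "lcosets S \<in> Obj OC" using sub_obj_group[OF sub_S] unfolding Obj_OC by blast
qed

definition group_of :: "'a set set \<Rightarrow> 'a set" where
  "group_of X = (THE P. obj_group P \<and> lcosets P = X)"

lemma group_of_eq: "obj_group P \<Longrightarrow> group_of (lcosets P) = P"
  unfolding group_of_def using lcosets_inj obj_groupD(1) by (intro the_equality) auto

lemma obj: "obj_group P \<Longrightarrow> lcosets P \<in> Obj OC"
  unfolding Obj_OC by blast

lemma coset_map_Hom:
  "obj_group P \<Longrightarrow> obj_group Q \<Longrightarrow> x \<in> carrier G \<Longrightarrow> conj_set G P x \<subseteq> Q \<Longrightarrow>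
    coset_map P Q x \<in> Hom OC (lcosets P) (lcosets Q)"
  using coset_map_G_map obj_groupD by simp

lemma HomE:
  assumes "obj_group P" "obj_group Q" "f \<in> Hom OC (lcosets P) (lcosets Q)"
  obtains x where "x \<in> carrier G" "conj_set G P x \<subseteq> Q" "f = coset_map P Q x"
proof -
  have f: "f \<in> G_maps G (lcosets P) (lcosets Q)" using assms(3) by simp
  obtain x where x: "x \<in> carrier G" "f P = x <# Q" by (rule G_map_value[OF obj_groupD(1)[OF assms(1)] f])
  show thesis
    using that[OF x(1) G_map_is_coset_map[OF obj_groupD(1)[OF assms(1)] obj_groupD(1)[OF assms(2)] f x]] .
qed

text \<open>A chosen element that conjugates \<open>P\<close> into \<open>S\<close>. The unit is chosen for \<open>P = S\<close>, so that no correction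
  appears for automorphisms of \<open>G/S\<close>.\<close>

definition into_S :: "'a set \<Rightarrow> 'a" where
  "into_S P = (if P = S then \<one> else (SOME x. x \<in> carrier G \<and> conj_set G P x \<subseteq> S))"

lemma into_S:
  assumes "obj_group P"
  shows "into_S P \<in> carrier G" "conj_set G P (into_S P) \<subseteq> S" "sub (conj_set G P (into_S P))"
proof -
  have "into_S P \<in> carrier G \<and> conj_set G P (into_S P) \<subseteq> S"
  proof (cases "P = S")
    case True
    then show ?thesis using conj_set_one[OF S(2)] by (simp add: into_S_def)
  next
    case False
    obtain x where "x \<in> carrier G" "conj_set G P x \<subseteq> S"
      using p_subgroup_conj_into_S[of P] assms by (auto simp: obj_group_def)
    then show ?thesis using False someI[of "\<lambda>x. x \<in> carrier G \<and> conj_set G P x \<subseteq> S" x] by (simp add: into_S_def)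
  qed
  then show x: "into_S P \<in> carrier G" "conj_set G P (into_S P) \<subseteq> S" by blast+
  show "sub (conj_set G P (into_S P))"
    unfolding nontrivial_subgroup_of_def
    using x subgroup_conj_set conj_set_trivial_iff obj_groupD(1)[OF assms] assms by (simp add: obj_group_def)
qed

lemma into_S_S: "into_S S = \<one>"
  by (simp add: into_S_def)

end

section \<open>Functors from the orbit category to a group\<close>

locale orbit_functor = orbit_setting + \<pi>: group \<pi>
  for \<pi> :: "('g, 'h) monoid_scheme" +
  fixes \<Phi> :: "'a set set \<Rightarrow> 'a set set \<Rightarrow> ('a set \<Rightarrow> 'a set) \<Rightarrow> 'g"
  assumes \<Phi>_closed: "\<lbrakk>X \<in> Obj OC; Y \<in> Obj OC; f \<in> Hom OC X Y\<rbrakk> \<Longrightarrow> \<Phi> X Y f \<in> carrier \<pi>"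
    and \<Phi>_comp: "\<lbrakk>X \<in> Obj OC; Y \<in> Obj OC; Z \<in> Obj OC; f \<in> Hom OC X Y; g \<in> Hom OC Y Z\<rbrakk> \<Longrightarrow>
      \<Phi> X Z (Comp OC X Y Z g f) = \<Phi> Y Z g \<otimes>\<^bsub>\<pi>\<^esub> \<Phi> X Y f"
begin

definition phi :: "'a set \<Rightarrow> 'a set \<Rightarrow> 'a \<Rightarrow> 'g" where
  "phi P Q x = \<Phi> (lcosets P) (lcosets Q) (coset_map P Q x)"

lemma phi_closed: "obj_group P \<Longrightarrow> obj_group Q \<Longrightarrow> x \<in> carrier G \<Longrightarrow> conj_set G P x \<subseteq> Q \<Longrightarrow> phi P Q x \<in> carrier \<pi>"
  unfolding phi_def by (intro \<Phi>_closed obj coset_map_Hom)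

lemma phi_mult:
  assumes "obj_group P" "obj_group Q" "obj_group R" "x \<in> carrier G" "conj_set G P x \<subseteq> Q" "y \<in> carrier G" "conj_set G Q y \<subseteq> R"
  shows "phi P R (x \<otimes> y) = phi Q R y \<otimes>\<^bsub>\<pi>\<^esub> phi P Q x"
  using \<Phi>_comp[OF obj[OF assms(1)] obj[OF assms(2)] obj[OF assms(3)] coset_map_Hom[OF assms(1,2,4,5)] coset_map_Hom[OF assms(2,3,6,7)]]
    compose_coset_map(1)[OF obj_groupD(1)[OF assms(1)] obj_groupD(1)[OF assms(2)] obj_groupD(1)[OF assms(3)] assms(4-7)]
  by (simp add: phi_def)

lemma phi_one: "obj_group P \<Longrightarrow> phi P P \<one> = \<one>\<^bsub>\<pi>\<^esub>"
proof -
  assume P: "obj_group P"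
  have c: "conj_set G P \<one> \<subseteq> P" using conj_set_one obj_groupD(2)[OF P] by simp
  have "phi P P \<one> \<otimes>\<^bsub>\<pi>\<^esub> phi P P \<one> = phi P P \<one>"
    using phi_mult[OF P P P one_closed c one_closed c] by simp
  then show ?thesis using phi_closed[OF P P one_closed c] \<pi>.l_cancel_one by blast
qed

text \<open>The value of \<open>g\<close> relative to the inclusion of \<open>P\<close> in \<open>S\<close>. Composition of the maps \<open>hP \<mapsto> hxQ\<close> multiplies
  the elements \<open>x\<close> in the opposite order; the inverse makes \<open>lam\<close> multiplicative in the order in
  which chains are written.\<close>

definition lam :: "'a set \<Rightarrow> 'a \<Rightarrow> 'g" where
  "lam P g = phi P S \<one> \<otimes>\<^bsub>\<pi>\<^esub> inv\<^bsub>\<pi>\<^esub> phi P S g"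

lemma obj_S: "obj_group S"
  by (rule sub_obj_group[OF sub_S])

lemma phi_S_closed:
  assumes "sub P" "g \<in> carrier G" "conj_set G P g \<subseteq> S"
  shows "phi P S g \<in> carrier \<pi>" "phi P S \<one> \<in> carrier \<pi>"
proof -
  note P = sub_obj_group[OF assms(1)]
  show "phi P S g \<in> carrier \<pi>" by (rule phi_closed[OF P obj_S assms(2,3)])
  show "phi P S \<one> \<in> carrier \<pi>"
    by (rule phi_closed[OF P obj_S one_closed]) (simp add: conj_set_one subD[OF assms(1)])
qed

lemma lam_closed: "sub P \<Longrightarrow> g \<in> carrier G \<Longrightarrow> conj_set G P g \<subseteq> S \<Longrightarrow> lam P g \<in> carrier \<pi>"
  unfolding lam_def using phi_S_closed by simp

lemma lam_mult:
  assumes P: "sub P" and g: "g \<in> carrier G" "conj_set G P g \<subseteq> S" and h: "h \<in> carrier G" "conj_set G P (g \<otimes> h) \<subseteq> S"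
  shows "lam P (g \<otimes> h) = lam P g \<otimes>\<^bsub>\<pi>\<^esub> lam (conj_set G P g) h"
proof -
  let ?Q = "conj_set G P g"
  have Q: "sub ?Q" by (rule sub_conj[OF P g])
  have hQ: "conj_set G ?Q h \<subseteq> S" using h conj_set_mult[OF subD(4)[OF P] g(1) h(1)] by simp
  have oQ: "conj_set G ?Q \<one> \<subseteq> S" using conj_set_one subD[OF Q] by simp
  note oP = sub_obj_group[OF P] and oQ' = sub_obj_group[OF Q]
  have 1: "phi P S (g \<otimes> h) = phi ?Q S h \<otimes>\<^bsub>\<pi>\<^esub> phi P ?Q g"
    by (rule phi_mult[OF oP oQ' obj_S g(1) _ h(1) hQ]) simp
  have 2: "phi P S g = phi ?Q S \<one> \<otimes>\<^bsub>\<pi>\<^esub> phi P ?Q g"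
    using phi_mult[OF oP oQ' obj_S g(1) _ one_closed oQ] g(1) by simp
  have c: "phi P S \<one> \<in> carrier \<pi>" "phi ?Q S h \<in> carrier \<pi>" "phi ?Q S \<one> \<in> carrier \<pi>" "phi P ?Q g \<in> carrier \<pi>"
    using phi_S_closed[OF P g] phi_S_closed[OF Q h(1) hQ] phi_closed[OF oP oQ' g(1)] by auto
  have cancel: "inv\<^bsub>\<pi>\<^esub> u \<otimes>\<^bsub>\<pi>\<^esub> (u \<otimes>\<^bsub>\<pi>\<^esub> v) = v" if "u \<in> carrier \<pi>" "v \<in> carrier \<pi>" for u v
    using that by (simp add: \<pi>.m_assoc[symmetric])
  show ?thesis
    unfolding lam_def 1 2 using c by (simp add: \<pi>.inv_mult_group \<pi>.m_assoc cancel)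
qed

lemma lam_mono:
  assumes P: "sub P" and Q: "sub Q" and PQ: "P \<subseteq> Q" and g: "g \<in> carrier G" "conj_set G Q g \<subseteq> S"
  shows "lam P g = lam Q g"
proof -
  note oP = sub_obj_group[OF P] and oQ = sub_obj_group[OF Q]
  have i: "conj_set G P \<one> \<subseteq> Q" using conj_set_one subD(4)[OF P] PQ by simp
  have oneQ: "conj_set G Q \<one> \<subseteq> S" using conj_set_one subD[OF Q] by simp
  have 1: "phi P S g = phi Q S g \<otimes>\<^bsub>\<pi>\<^esub> phi P Q \<one>"
    using phi_mult[OF oP oQ obj_S one_closed i g] g(1) by simp
  have 2: "phi P S \<one> = phi Q S \<one> \<otimes>\<^bsub>\<pi>\<^esub> phi P Q \<one>"
    using phi_mult[OF oP oQ obj_S one_closed i one_closed oneQ] by simp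
  have c: "phi Q S g \<in> carrier \<pi>" "phi Q S \<one> \<in> carrier \<pi>" "phi P Q \<one> \<in> carrier \<pi>"
    using phi_S_closed[OF Q g] phi_closed[OF oP oQ one_closed i] by auto
  have cancel: "u \<otimes>\<^bsub>\<pi>\<^esub> (inv\<^bsub>\<pi>\<^esub> u \<otimes>\<^bsub>\<pi>\<^esub> v) = v" if "u \<in> carrier \<pi>" "v \<in> carrier \<pi>" for u v
    using that by (simp add: \<pi>.m_assoc[symmetric])
  show ?thesis
    unfolding lam_def 1 2 using c by (simp add: \<pi>.inv_mult_group \<pi>.m_assoc cancel)
qed

lemma lam_one: "sub P \<Longrightarrow> lam P \<one> = \<one>\<^bsub>\<pi>\<^esub>"
  unfolding lam_def using phi_S_closed(2)[of P \<one>] conj_set_one subD by simp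

lemma phi_times_S:
  assumes "obj_group P" "y \<in> carrier G" "conj_set G P y \<subseteq> S" "s \<in> S"
  shows "phi P S (y \<otimes> s) = phi P S y"
  unfolding phi_def coset_map_eqI[OF obj_groupD(1)[OF assms(1)] S(1) assms(2-4)] ..

text \<open>Sylow's theorem in \<open>N\<^sub>G(Q)\<close> puts \<open>u\<close> and \<open>Q\<close> into one \<open>p\<close>-subgroup \<open>U\<close>. If \<open>U\<^sup>y \<le> S\<close>, then \<open>u y = y s\<close> with
  \<open>s = u\<^sup>y \<in> S\<close>, and \<open>y s\<close> and \<open>y\<close> define the same map to \<open>G/S\<close>.\<close>

lemma lam_p_element:
  assumes Q: "sub Q" and u: "u \<in> normalizer G Q" "u [^] (p ^ k) = \<one>"
  shows "lam Q u = \<one>\<^bsub>\<pi>\<^esub>"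
proof -
  note Qc = subD(4)[OF Q]
  have uG: "u \<in> carrier G" and uQ: "conj_set G Q u = Q" using u conj_set_in_normalizer[OF Qc] by auto
  note NQ = normalizer_imp_subgroup[OF Qc]
  have QN: "Q \<subseteq> normalizer G Q"
    using subgroup_in_normalizer[OF subD(1)[OF Q]] normal_imp_subgroup subgroup.subset by force
  have gN: "generate G {u} \<subseteq> normalizer G Q" by (rule generate_subgroup_incl[OF _ NQ]) (use u in simp)
  obtain x U where U: "x \<in> normalizer G Q" "p_subgroup G p U" "conj_set G Q x \<subseteq> U" "generate G {u} \<subseteq> U"
    using common_p_overgroup[OF fin prime_p NQ p_subgroup_sub[OF subD(1)[OF Q] subD(3)[OF Q]] QN
        p_subgroup_generate_singleton[OF prime_p uG u(2)] gN] by metis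
  have QU: "Q \<subseteq> U" using U(1,3) conj_set_in_normalizer[OF Qc] by simp
  have uU: "u \<in> U" using U(4) generate.incl[of u "{u}" G] by auto
  obtain y where y: "y \<in> carrier G" "conj_set G U y \<subseteq> S" by (rule p_subgroup_conj_into_S[OF U(2)])
  have Qy: "conj_set G Q y \<subseteq> S" using conj_set_mono[OF QU] y(2) by blast
  have s: "inv y \<otimes> u \<otimes> y \<in> S" using y(2) uU by (auto simp: conj_set_def)
  have uy: "u \<otimes> y = y \<otimes> (inv y \<otimes> u \<otimes> y)" using uG y(1) by (simp add: m_assoc[symmetric])
  have Quy: "conj_set G Q (u \<otimes> y) \<subseteq> S" using conj_set_mult[OF Qc uG y(1)] uQ Qy by simp
  have "lam Q (u \<otimes> y) = lam Q y"
    unfolding lam_def uy phi_times_S[OF sub_obj_group[OF Q] y(1) Qy s] ..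
  moreover have "lam Q (u \<otimes> y) = lam Q u \<otimes>\<^bsub>\<pi>\<^esub> lam Q y"
    using lam_mult[OF Q uG _ y(1) Quy] uQ subD(3)[OF Q] by simp
  moreover have "lam Q u \<in> carrier \<pi>" "lam Q y \<in> carrier \<pi>"
    using lam_closed[OF Q uG] uQ subD(3)[OF Q] lam_closed[OF Q y(1) Qy] by auto
  ultimately show ?thesis using \<pi>.r_cancel_one' by metis
qed

lemma lam_Opn:
  assumes Q: "sub Q" and x: "x \<in> Opn Q"
  shows "lam Q x = \<one>\<^bsub>\<pi>\<^esub>"
proof -
  note Qc = subD(4)[OF Q]
  let ?X = "{h \<in> normalizer G Q. \<exists>k. h [^] (p ^ k) = \<one>}"
  have "x \<in> generate G ?X" using x unfolding Op'_norm_grp[OF prime_p Qc] .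
  then have "x \<in> carrier G \<and> conj_set G Q x = Q \<and> lam Q x = \<one>\<^bsub>\<pi>\<^esub>"
  proof (induction rule: generate.induct)
    case one
    then show ?case using lam_one[OF Q] conj_set_one[OF Qc] by simp
  next
    case (incl h)
    then show ?case using lam_p_element[OF Q] conj_set_in_normalizer[OF Qc] by auto
  next
    case (inv h)
    then obtain k where h: "h \<in> normalizer G Q" "h [^] (p ^ k) = \<one>" by blast
    have hG: "h \<in> carrier G" using h conj_set_in_normalizer[OF Qc] by blast
    have "inv h \<in> normalizer G Q" by (rule subgroup.m_inv_closed[OF normalizer_imp_subgroup[OF Qc] h(1)])
    moreover have "(inv h) [^] (p ^ k) = \<one>" using h hG by (simp add: nat_pow_inv)
    ultimately show ?case using lam_p_element[OF Q] conj_set_in_normalizer[OF Qc] by blast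
  next
    case (eng g h)
    have "conj_set G Q (g \<otimes> h) = Q" using eng conj_set_mult[OF Qc] by metis
    then show ?case using eng lam_mult[OF Q, of g h] subD(3)[OF Q] by simp
  qed
  then show ?thesis by blast
qed

lemma lam_chain:
  assumes P: "sub P" and z: "chain P z"
  shows "lam P z = \<one>\<^bsub>\<pi>\<^esub>"
  using z
proof (induction rule: chain.induct)
  case one
  then show ?case by (rule lam_one[OF P])
next
  case (step g Q x)
  note PS = subD(3)[OF P]
  have gx: "chain P (g \<otimes> x)" by (rule chain.step[OF step.hyps])
  have g: "g \<in> carrier G" "conj_set G P g \<subseteq> S" using chain_carrier[OF step.hyps(1)] chain_conj[OF step.hyps(1) PS] .
  note x = Opn(2,3)[OF step.hyps(2,4)]
  have "lam P (g \<otimes> x) = lam P g \<otimes>\<^bsub>\<pi>\<^esub> lam (conj_set G P g) x"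
    by (rule lam_mult[OF P g x(1) chain_conj[OF gx PS]])
  also have "lam (conj_set G P g) x = lam Q x"
    by (rule lam_mono[OF sub_conj[OF P g] step.hyps(2,3) x(1)]) (use x(2) subD(3)[OF step.hyps(2)] in simp)
  finally show ?case using step.IH lam_Opn[OF step.hyps(2,4)] by simp
qed

lemma lam_N: "sub P \<Longrightarrow> n \<in> N \<Longrightarrow> lam P n = lam S n"
  using lam_mono[OF _ sub_S] subD(3) N_iff by simp

lemma lam_S_hom: "m \<in> N \<Longrightarrow> n \<in> N \<Longrightarrow> lam S (m \<otimes> n) = lam S m \<otimes>\<^bsub>\<pi>\<^esub> lam S n"
  using lam_mult[OF sub_S, of m n] N_iff N_mult[of m n] by simp

lemma lam_S_closed: "n \<in> N \<Longrightarrow> lam S n \<in> carrier \<pi>"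
  using lam_closed[OF sub_S] N_iff by simp

lemma lam_S_inv: "n \<in> N \<Longrightarrow> lam S (inv n) = inv\<^bsub>\<pi>\<^esub> lam S n"
  using lam_S_hom[OF N_inv, of n n] lam_one[OF sub_S] lam_S_closed N_inv N_carrier
  by (intro \<pi>.inv_equality[symmetric]) auto

lemma lam_S_eq: "n \<in> N \<Longrightarrow> lam S n = phi S S (inv n)"
proof -
  assume n: "n \<in> N"
  have c: "conj_set G S n \<subseteq> S" "conj_set G S (inv n) \<subseteq> S" using n N_inv N_iff by auto
  have "phi S S (inv n \<otimes> n) = phi S S n \<otimes>\<^bsub>\<pi>\<^esub> phi S S (inv n)"
    by (rule phi_mult[OF obj_S obj_S obj_S _ c(2) _ c(1)]) (use N_carrier[OF n] in auto)
  then have "phi S S n \<otimes>\<^bsub>\<pi>\<^esub> phi S S (inv n) = \<one>\<^bsub>\<pi>\<^esub>"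
    using N_carrier[OF n] phi_one[OF obj_S] by simp
  then have "inv\<^bsub>\<pi>\<^esub> phi S S n = phi S S (inv n)"
    using phi_closed[OF obj_S obj_S _ c(1)] phi_closed[OF obj_S obj_S _ c(2)] N_carrier[OF n]
    by (metis \<pi>.inv_equality \<pi>.inv_inv inv_closed)
  then show ?thesis
    unfolding lam_def phi_one[OF obj_S] using phi_closed[OF obj_S obj_S _ c(2)] N_carrier[OF n] by simp
qed

lemma lam_K: "g \<in> K \<Longrightarrow> g \<in> N \<and> lam S g = \<one>\<^bsub>\<pi>\<^esub>"
  unfolding K_eq
proof (induction rule: generate.induct)
  case one
  then show ?case using lam_one[OF sub_S] subgroup.one_closed[OF N_subgroup] by simp
next
  case (incl h)
  then obtain P where P: "h \<in> N" "sub P" "chain P h" by auto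
  then show ?case using lam_chain[OF P(2,3)] lam_N[OF P(2,1)] by simp
next
  case (inv h)
  then obtain P where P: "h \<in> N" "sub P" "chain P h" by auto
  then have "lam S h = \<one>\<^bsub>\<pi>\<^esub>" using lam_chain[OF P(2,3)] lam_N[OF P(2,1)] by simp
  then show ?case using P(1) lam_S_inv N_inv norm_grp_inv[OF S(2)] by simp
next
  case (eng g h)
  then show ?case using lam_S_hom N_mult by simp
qed

text \<open>The value of the chosen map \<open>G/P \<rightarrow> G/S\<close>; comparing with it turns the value of a morphism into
  that of an endomorphism of \<open>G/S\<close>.\<close>

definition eps :: "'a set set \<Rightarrow> 'g" where
  "eps X = phi (group_of X) S (into_S (group_of X))"

lemma eps_eq: "obj_group P \<Longrightarrow> eps (lcosets P) = phi P S (into_S P)"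
  by (simp add: eps_def group_of_eq)

lemma eps_closed: "X \<in> Obj OC \<Longrightarrow> eps X \<in> carrier \<pi>"
  unfolding Obj_OC using eps_eq phi_closed[OF _ obj_S] into_S by auto

lemma eps_S: "eps (lcosets S) = \<one>\<^bsub>\<pi>\<^esub>"
  using eps_eq[OF obj_S] phi_one[OF obj_S] into_S_S by simp

text \<open>Conjugating source and target into \<open>S\<close> reduces the claim to a map on some \<open>P' \<le> S\<close>. It splits into
  a chain, which has trivial value, and an element of \<open>N\<close>.\<close>

lemma morphism_from_N:
  assumes "X \<in> Obj OC" "Y \<in> Obj OC" "f \<in> Hom OC X Y"
  shows "eps Y \<otimes>\<^bsub>\<pi>\<^esub> \<Phi> X Y f \<otimes>\<^bsub>\<pi>\<^esub> inv\<^bsub>\<pi>\<^esub> (eps X) \<in> lam S ` N"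
proof -
  obtain P Q where PQ: "obj_group P" "X = lcosets P" "obj_group Q" "Y = lcosets Q" using assms Obj_OC by metis
  obtain x where x: "x \<in> carrier G" "conj_set G P x \<subseteq> Q" "f = coset_map P Q x"
    by (rule HomE[OF PQ(1,3) assms(3)[unfolded PQ(2,4)]])
  note c = into_S[OF PQ(1)] and d = into_S[OF PQ(3)]
  define P' where "P' = conj_set G P (into_S P)"
  have P': "sub P'" "obj_group P'" using c(3) sub_obj_group by (auto simp: P'_def)
  define g where "g = inv (into_S P) \<otimes> x \<otimes> into_S Q"
  have g: "g \<in> carrier G" using c(1) d(1) x(1) by (simp add: g_def)
  have cg: "into_S P \<otimes> g = x \<otimes> into_S Q"
    unfolding g_def using c(1) d(1) x(1) by (simp add: m_assoc[symmetric])
  note xd = compose_coset_map(2)[OF obj_groupD(1)[OF PQ(1)] obj_groupD(1)[OF PQ(3)] S(1) x(1,2) d(1,2)]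
  have P'g: "conj_set G P' g \<subseteq> S"
    unfolding P'_def conj_set_mult[OF obj_groupD(2)[OF PQ(1)] c(1) g] cg by (rule xd)
  have one: "conj_set G P' \<one> \<subseteq> S" using conj_set_one subD[OF P'(1)] by simp
  have pc: "conj_set G P (into_S P) \<subseteq> P'" by (simp add: P'_def)
  have 1: "eps Y \<otimes>\<^bsub>\<pi>\<^esub> \<Phi> X Y f = phi P S (x \<otimes> into_S Q)"
    using phi_mult[OF PQ(1,3) obj_S x(1,2) d(1,2)] by (simp add: PQ eps_eq x(3) phi_def)
  have 2: "phi P S (x \<otimes> into_S Q) = phi P' S g \<otimes>\<^bsub>\<pi>\<^esub> phi P P' (into_S P)"
    using phi_mult[OF PQ(1) P'(2) obj_S c(1) pc g P'g] cg by simp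
  have 3: "eps X = phi P' S \<one> \<otimes>\<^bsub>\<pi>\<^esub> phi P P' (into_S P)"
    using phi_mult[OF PQ(1) P'(2) obj_S c(1) pc one_closed one] c(1) by (simp add: PQ eps_eq)
  have cl: "phi P' S g \<in> carrier \<pi>" "phi P' S \<one> \<in> carrier \<pi>" "phi P P' (into_S P) \<in> carrier \<pi>"
    using phi_S_closed[OF P'(1) g P'g] phi_closed[OF PQ(1) P'(2) c(1) pc] by auto
  have cancel: "u \<otimes>\<^bsub>\<pi>\<^esub> (inv\<^bsub>\<pi>\<^esub> u \<otimes>\<^bsub>\<pi>\<^esub> v) = v" if "u \<in> carrier \<pi>" "v \<in> carrier \<pi>" for u v
    using that by (simp add: \<pi>.m_assoc[symmetric])
  have val: "eps Y \<otimes>\<^bsub>\<pi>\<^esub> \<Phi> X Y f \<otimes>\<^bsub>\<pi>\<^esub> inv\<^bsub>\<pi>\<^esub> (eps X) = inv\<^bsub>\<pi>\<^esub> (lam P' g)"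
    unfolding 1 2 3 lam_def using cl by (simp add: \<pi>.inv_mult_group \<pi>.m_assoc cancel)
  obtain z n where zn: "chain P' z" "n \<in> N" "g = z \<otimes> n"
    using splits_all[OF P'(1) g P'g] unfolding splits_def by blast
  note P'S = subD(3)[OF P'(1)]
  have z: "z \<in> carrier G" "conj_set G P' z \<subseteq> S" using chain_carrier[OF zn(1)] chain_conj[OF zn(1) P'S] .
  have "lam P' g = lam P' z \<otimes>\<^bsub>\<pi>\<^esub> lam (conj_set G P' z) n"
    unfolding zn(3) by (rule lam_mult[OF P'(1) z N_carrier[OF zn(2)] P'g[unfolded zn(3)]])
  also have "\<dots> = lam S n"
    using lam_chain[OF P'(1) zn(1)] lam_N[OF sub_conj[OF P'(1) z] zn(2)] lam_S_closed[OF zn(2)] by simp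
  finally have "inv\<^bsub>\<pi>\<^esub> (lam P' g) = lam S (inv n)" using lam_S_inv[OF zn(2)] by simp
  then show ?thesis using N_inv[OF zn(2)] unfolding val by simp
qed

end

context orbit_setting
begin

section \<open>The functor from the orbit category to N/K\<close>

text \<open>\<open>theta\<close> of the map from the chosen conjugate of \<open>P\<close> in \<open>S\<close> to that of \<open>Q\<close> which corresponds to \<open>x\<close>.\<close>

definition twist :: "'a set \<Rightarrow> 'a set \<Rightarrow> 'a \<Rightarrow> 'a set" where
  "twist P Q x = theta (conj_set G P (into_S P)) (inv (into_S P) \<otimes> x \<otimes> into_S Q)"

lemma twist_aux:
  assumes "obj_group P" "obj_group Q" "x \<in> carrier G" "conj_set G P x \<subseteq> Q"
  shows "inv (into_S P) \<otimes> x \<otimes> into_S Q \<in> carrier G"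
    "conj_set G (conj_set G P (into_S P)) (inv (into_S P) \<otimes> x \<otimes> into_S Q) = conj_set G P (x \<otimes> into_S Q)"
    "conj_set G P (x \<otimes> into_S Q) \<subseteq> conj_set G Q (into_S Q)" "conj_set G P (x \<otimes> into_S Q) \<subseteq> S"
proof -
  note c = into_S[OF assms(1)] and d = into_S[OF assms(2)]
  show g: "inv (into_S P) \<otimes> x \<otimes> into_S Q \<in> carrier G" using c d assms(3) by simp
  have "into_S P \<otimes> (inv (into_S P) \<otimes> x \<otimes> into_S Q) = x \<otimes> into_S Q"
    using c(1) d(1) assms(3) by (simp add: m_assoc[symmetric])
  then show "conj_set G (conj_set G P (into_S P)) (inv (into_S P) \<otimes> x \<otimes> into_S Q) = conj_set G P (x \<otimes> into_S Q)"
    using conj_set_mult[OF obj_groupD(2)[OF assms(1)] c(1) g] by simp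
  show "conj_set G P (x \<otimes> into_S Q) \<subseteq> conj_set G Q (into_S Q)"
    using conj_set_mono[OF assms(4), of "into_S Q"] conj_set_mult[OF obj_groupD(2)[OF assms(1)] assms(3) d(1)] by simp
  then show "conj_set G P (x \<otimes> into_S Q) \<subseteq> S" using d(2) by blast
qed

lemma twist_closed:
  assumes "obj_group P" "obj_group Q" "x \<in> carrier G" "conj_set G P x \<subseteq> Q"
  shows "twist P Q x \<in> carrier Gam"
  unfolding twist_def using theta_closed[OF into_S(3)[OF assms(1)] twist_aux(1)[OF assms]] twist_aux(2,4)[OF assms] by simp

lemma twist_mult:
  assumes P: "obj_group P" and Q: "obj_group Q" and R: "obj_group R"
    and x: "x \<in> carrier G" "conj_set G P x \<subseteq> Q" and y: "y \<in> carrier G" "conj_set G Q y \<subseteq> R"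
  shows "twist P R (x \<otimes> y) = twist P Q x \<otimes>\<^bsub>Gam\<^esub> twist Q R y"
proof -
  note c = into_S[OF P] and d = into_S[OF Q] and e = into_S[OF R]
  let ?g = "inv (into_S P) \<otimes> x \<otimes> into_S Q" and ?h = "inv (into_S Q) \<otimes> y \<otimes> into_S R"
  let ?P = "conj_set G P (into_S P)" and ?Q = "conj_set G Q (into_S Q)"
  note g = twist_aux[OF P Q x] and h = twist_aux[OF Q R y]
  have xy: "conj_set G P (x \<otimes> y) \<subseteq> R"
    by (rule compose_coset_map(2)[OF obj_groupD(1)[OF P] obj_groupD(1)[OF Q] obj_groupD(1)[OF R] x y])
  note gh = twist_aux[OF P R m_closed[OF x(1) y(1)] xy]
  have dd: "into_S Q \<otimes> (inv (into_S Q) \<otimes> w) = w" if "w \<in> carrier G" for w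
    using d(1) that by (simp add: m_assoc[symmetric])
  have eq: "?g \<otimes> ?h = inv (into_S P) \<otimes> (x \<otimes> y) \<otimes> into_S R"
    using c(1) d(1) e(1) x(1) y(1) by (simp add: m_assoc dd)
  have gS: "conj_set G ?P ?g \<subseteq> S" unfolding g(2) by (rule g(4))
  have hS: "conj_set G ?Q ?h \<subseteq> S" unfolding h(2) by (rule h(4))
  have ghS: "conj_set G ?P (?g \<otimes> ?h) \<subseteq> S" unfolding eq gh(2) by (rule gh(4))
  have "twist P R (x \<otimes> y) = theta ?P ?g \<otimes>\<^bsub>Gam\<^esub> theta (conj_set G ?P ?g) ?h"
    unfolding twist_def eq[symmetric] by (rule theta_mult[OF c(3) g(1) gS h(1) ghS])
  also have "theta (conj_set G ?P ?g) ?h = theta ?Q ?h"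
    by (rule theta_mono[OF sub_conj[OF c(3) g(1) gS] d(3) _ h(1) hS]) (simp only: g(2,3))
  finally show ?thesis unfolding twist_def .
qed

text \<open>An element \<open>q\<close> of \<open>Q\<close> becomes an element of \<open>S\<close> after conjugation, and elements of \<open>S\<close> are chains.\<close>

lemma twist_coset:
  assumes P: "obj_group P" and Q: "obj_group Q" and x: "x \<in> carrier G" "conj_set G P x \<subseteq> Q" and q: "q \<in> Q"
  shows "twist P Q (x \<otimes> q) = twist P Q x"
proof -
  have qG: "q \<in> carrier G" using q obj_groupD(2)[OF Q] by blast
  have qQ: "conj_set G Q q \<subseteq> Q"
    using obj_groupD(1)[OF Q] q by (auto simp: conj_set_def subgroup.m_closed subgroup.m_inv_closed)
  note d = into_S[OF Q]
  have s: "inv (into_S Q) \<otimes> q \<otimes> into_S Q \<in> S" using d(2) q by (auto simp: conj_set_def)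
  interpret Gam: group Gam by (rule Gam_group)
  have "twist Q Q q = \<one>\<^bsub>Gam\<^esub>"
    unfolding twist_def by (rule theta_chain[OF d(3) S_chain[OF d(3) s]])
  then show ?thesis unfolding twist_mult[OF P Q Q x qG qQ] by (simp only: Gam.r_one[OF twist_closed[OF P Q x]])
qed

text \<open>A morphism determines its element \<open>x\<close> up to right multiplication by the target group, which does not
  change \<open>twist\<close>. Composition of morphisms multiplies these elements in the opposite order, hence the
  inverse.\<close>

definition to_quotient :: "'a set set \<Rightarrow> 'a set set \<Rightarrow> ('a set \<Rightarrow> 'a set) \<Rightarrow> 'a set" where
  "to_quotient X Y f = inv\<^bsub>Gam\<^esub> twist (group_of X) (group_of Y)
     (SOME x. x \<in> carrier G \<and> f (group_of X) = x <# group_of Y)"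

lemma to_quotient_coset_map:
  assumes P: "obj_group P" and Q: "obj_group Q" and x: "x \<in> carrier G" "conj_set G P x \<subseteq> Q"
  shows "to_quotient (lcosets P) (lcosets Q) (coset_map P Q x) = inv\<^bsub>Gam\<^esub> twist P Q x"
proof -
  note Ps = obj_groupD(1)[OF P] and Qs = obj_groupD(1)[OF Q]
  define y where "y = (SOME y. y \<in> carrier G \<and> coset_map P Q x P = y <# Q)"
  have "y \<in> carrier G \<and> coset_map P Q x P = y <# Q"
    unfolding y_def by (rule someI[of _ x]) (use x coset_map_base[OF Ps Qs x] in simp)
  then have y: "y \<in> carrier G" "x <# Q = y <# Q" using coset_map_base[OF Ps Qs x] by auto
  then have "y \<in> x <# Q" using lcos_self[OF y(1) Qs] by simp
  then obtain q where q: "q \<in> Q" "y = x \<otimes> q" by (auto simp: l_coset_def)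
  have "twist P Q y = twist P Q x" unfolding q(2) by (rule twist_coset[OF P Q x q(1)])
  then show ?thesis unfolding to_quotient_def group_of_eq[OF P] group_of_eq[OF Q] y_def[symmetric] by simp
qed

lemma group_valued_to_quotient: "group_valued_functor OC (lcosets S) Gam to_quotient"
proof -
  interpret Gam: group Gam by (rule Gam_group)
  show ?thesis
  proof (intro group_valued_functor.intro step_functions.intro group_valued_functor_axioms.intro
      OC.based_category_axioms Gam_group)
    fix X Y f assume f: "X \<in> Obj OC" "Y \<in> Obj OC" "f \<in> Hom OC X Y"
    obtain P Q where PQ: "obj_group P" "X = lcosets P" "obj_group Q" "Y = lcosets Q" using f Obj_OC by metis
    obtain x where x: "x \<in> carrier G" "conj_set G P x \<subseteq> Q" "f = coset_map P Q x"
      by (rule HomE[OF PQ(1,3) f(3)[unfolded PQ(2,4)]])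
    show "to_quotient X Y f \<in> carrier Gam"
      unfolding PQ(2,4) x(3) to_quotient_coset_map[OF PQ(1,3) x(1,2)] using twist_closed[OF PQ(1,3) x(1,2)] by simp
    fix Z g assume g: "Z \<in> Obj OC" "g \<in> Hom OC Y Z"
    obtain R where R: "obj_group R" "Z = lcosets R" using g Obj_OC by metis
    obtain y where y: "y \<in> carrier G" "conj_set G Q y \<subseteq> R" "g = coset_map Q R y"
      by (rule HomE[OF PQ(3) R(1) g(2)[unfolded PQ(4) R(2)]])
    note cc = compose_coset_map[OF obj_groupD(1)[OF PQ(1)] obj_groupD(1)[OF PQ(3)] obj_groupD(1)[OF R(1)] x(1,2) y(1,2)]
    show "to_quotient X Z (Comp OC X Y Z g f) = to_quotient Y Z g \<otimes>\<^bsub>Gam\<^esub> to_quotient X Y f"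
      unfolding PQ(2,4) R(2) x(3) y(3) Comp_OC cc(1) to_quotient_coset_map[OF PQ(1) R(1) m_closed[OF x(1) y(1)] cc(2)]
        to_quotient_coset_map[OF PQ(1,3) x(1,2)] to_quotient_coset_map[OF PQ(3) R(1) y(1,2)]
        twist_mult[OF PQ(1,3) R(1) x(1,2) y(1,2)]
      by (rule Gam.inv_mult_group[OF twist_closed[OF PQ(1,3) x(1,2)] twist_closed[OF PQ(3) R(1) y(1,2)]])
  qed
qed

section \<open>The natural map\<close>

lemma joined_vert: "X \<in> Obj OC \<Longrightarrow> OC.joined (OC.vert X)"
proof -
  assume X: "X \<in> Obj OC"
  then obtain P where P: "obj_group P" "X = lcosets P" using Obj_OC by blast
  note c = into_S[OF P(1)]
  have S: "obj_group S" by (rule sub_obj_group[OF sub_S])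
  have "coset_map P S (into_S P) \<in> Hom OC X (lcosets S)"
    unfolding P(2) by (rule coset_map_Hom[OF P(1) S c(1,2)])
  from OC.path_between_edge[OF X obj[OF S] this] show ?thesis unfolding OC.joined_def by blast
qed

lemma orbit_functor_path_class: "orbit_functor G p S OC.pi1 (\<lambda>X Y f. OC.path_class (OC.edge X Y f))"
proof (intro orbit_functor.intro orbit_functor_axioms.intro orbit_setting_axioms OC.group_pi1)
  fix X Y f assume f: "X \<in> Obj OC" "Y \<in> Obj OC" "f \<in> Hom OC X Y"
  show "OC.path_class (OC.edge X Y f) \<in> carrier OC.pi1" by (rule OC.path_class_edge_closed[OF f joined_vert[OF f(1)]])
  fix Z g assume g: "Z \<in> Obj OC" "g \<in> Hom OC Y Z"
  show "OC.path_class (OC.edge X Z (Comp OC X Y Z g f)) = OC.path_class (OC.edge Y Z g) \<otimes>\<^bsub>OC.pi1\<^esub> OC.path_class (OC.edge X Y f)"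
    by (rule OC.path_class_edge_comp[OF f(1,2) g(1) f(3) g(2) joined_vert[OF f(1)]])
qed

lemma orbit_pi1_eq: "orbit_pi1 G p S = OC.pi1"
  by (simp add: orbit_pi1_def orbit_base_def OC.vert_def)

lemma orbit_aut_eq:
  assumes "n \<in> N"
  shows "orbit_aut G S n = coset_map S S (inv n)"
proof -
  have i: "inv n \<in> carrier G" "conj_set G S (inv n) \<subseteq> S" using N_inv[OF assms] N_iff by auto
  show ?thesis
    unfolding orbit_aut_def
  proof (rule the_equality)
    show "coset_map S S (inv n) \<in> G_maps G (lcosets S) (lcosets S) \<and> coset_map S S (inv n) S = inv n <# S"
      using coset_map_G_map[OF S(1) S(1) i] coset_map_base[OF S(1) S(1) i] by blast
    show "f = coset_map S S (inv n)" if "f \<in> G_maps G (lcosets S) (lcosets S) \<and> f S = inv n <# S" for f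
      using G_map_is_coset_map(2)[OF S(1) S(1) _ i(1)] that by blast
  qed
qed

lemma orbit_aut_loop:
  assumes "n \<in> N"
  shows "OC.loop (OC.edge (lcosets S) (lcosets S) (orbit_aut G S n))"
proof -
  have i: "inv n \<in> carrier G" "conj_set G S (inv n) \<subseteq> S" using N_inv[OF assms] N_iff by auto
  have S: "obj_group S" by (rule sub_obj_group[OF sub_S])
  show ?thesis
    unfolding orbit_aut_eq[OF assms] by (rule OC.path_between_edge[OF obj[OF S] obj[OF S] coset_map_Hom[OF S S i]])
qed

lemma natural_map_cls:
  "natural_map G p S n = OC.cls (OC.edge (lcosets S) (lcosets S) (orbit_aut G S n))"
  unfolding natural_map_def orbit_base_def OC.cls_def by (simp add: OC.edge_def OC.vert_def)

interpretation E: orbit_functor G p S OC.pi1 "\<lambda>X Y f. OC.path_class (OC.edge X Y f)"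
  by (rule orbit_functor_path_class)

interpretation Q: group_valued_functor OC "lcosets S" Gam to_quotient
  by (rule group_valued_to_quotient)

text \<open>The inverse in \<open>lam\<close> matches the inverse in \<open>eS \<mapsto> n\<^sup>-\<^sup>1 S\<close>.\<close>

lemma natural_map_lam: "n \<in> N \<Longrightarrow> natural_map G p S n = E.lam S n"
  unfolding natural_map_cls E.lam_S_eq E.phi_def
  using OC.path_class_loop[OF orbit_aut_loop] orbit_aut_eq by metis

lemma natural_map_group_hom: "group_hom (norm_grp G S) (orbit_pi1 G p S) (natural_map G p S)"
  unfolding orbit_pi1_eq group_hom_def group_hom_axioms_def
proof (intro conjI group_norm_grp[OF S(2)] OC.group_pi1 homI)
  fix m assume m: "m \<in> carrier (norm_grp G S)"
  then show "natural_map G p S m \<in> carrier OC.pi1" using natural_map_lam E.lam_S_closed by simp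
  fix n assume "n \<in> carrier (norm_grp G S)"
  then show "natural_map G p S (m \<otimes>\<^bsub>norm_grp G S\<^esub> n) = natural_map G p S m \<otimes>\<^bsub>OC.pi1\<^esub> natural_map G p S n"
    using m natural_map_lam E.lam_S_hom N_mult by simp
qed

text \<open>Edges generate the fundamental group, and the class of each edge, compared with the chosen maps to
  \<open>G/S\<close>, comes from \<open>N\<close>.\<close>

lemma natural_map_surj: "natural_map G p S ` N = carrier (orbit_pi1 G p S)"
proof
  interpret h: group_hom "norm_grp G S" OC.pi1 "natural_map G p S"
    using natural_map_group_hom unfolding orbit_pi1_eq .
  show "natural_map G p S ` N \<subseteq> carrier (orbit_pi1 G p S)"
    unfolding orbit_pi1_eq using h.hom_closed by auto
  have H: "subgroup (natural_map G p S ` N) OC.pi1" using h.img_is_subgroup by simp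
  have eq: "E.lam S ` N = natural_map G p S ` N" using natural_map_lam by (intro image_cong) auto
  have "OC.cls \<gamma> \<in> natural_map G p S ` N" if "OC.loop \<gamma>" for \<gamma>
    by (rule OC.loops_generated_by_edges[OF H joined_vert E.eps_closed E.eps_S E.morphism_from_N[unfolded eq] that])
  then show "carrier (orbit_pi1 G p S) \<subseteq> natural_map G p S ` N"
    unfolding orbit_pi1_eq OC.carrier_pi1 by blast
qed

lemma to_quotient_aut: "n \<in> N \<Longrightarrow> to_quotient (lcosets S) (lcosets S) (orbit_aut G S n) = inv\<^bsub>Gam\<^esub> (K #>\<^bsub>norm_grp G S\<^esub> inv n)"
proof -
  assume n: "n \<in> N"
  have i: "inv n \<in> carrier G" "conj_set G S (inv n) \<subseteq> S" using N_inv[OF n] N_iff by auto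
  have S': "obj_group S" by (rule sub_obj_group[OF sub_S])
  have "twist S S (inv n) = theta S (inv n)"
    using i(1) conj_set_one[OF S(2)] by (simp add: twist_def into_S_S)
  then show ?thesis
    using to_quotient_coset_map[OF S' S' i] orbit_aut_eq[OF n] theta_N[OF sub_S N_inv[OF n]] by simp
qed

text \<open>\<open>K\<close> is in the kernel since chains have trivial value under the functor of edge classes. Conversely,
  if the loop of \<open>n\<close> is null-homotopic, the functor to \<open>N/K\<close> does not distinguish it from the loop of
  the unit, so the coset of \<open>n\<close> is trivial.\<close>

lemma natural_map_kernel: "kernel (norm_grp G S) (orbit_pi1 G p S) (natural_map G p S) = K"
proof
  interpret h: group_hom "norm_grp G S" OC.pi1 "natural_map G p S"
    using natural_map_group_hom unfolding orbit_pi1_eq .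
  show "K \<subseteq> kernel (norm_grp G S) (orbit_pi1 G p S) (natural_map G p S)"
    unfolding orbit_pi1_eq kernel_def using E.lam_K natural_map_lam by auto
  show "kernel (norm_grp G S) (orbit_pi1 G p S) (natural_map G p S) \<subseteq> K"
  proof
    fix n assume "n \<in> kernel (norm_grp G S) (orbit_pi1 G p S) (natural_map G p S)"
    then have n: "n \<in> N" and eq: "natural_map G p S n = natural_map G p S \<one>"
      using h.hom_one by (auto simp: kernel_def orbit_pi1_eq)
    have one: "\<one> \<in> N" by (rule subgroup.one_closed[OF N_subgroup])
    have aut: "orbit_aut G S m \<in> Hom OC (lcosets S) (lcosets S)" if "m \<in> N" for m
      unfolding orbit_aut_eq[OF that] using coset_map_G_map[OF S(1) S(1)] N_inv[OF that] N_iff by simp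
    have "path_homotopic OC.RC (OC.edge (lcosets S) (lcosets S) (orbit_aut G S n)) (OC.edge (lcosets S) (lcosets S) (orbit_aut G S \<one>))"
      using eq OC.cls_eq_iff[OF orbit_aut_loop[OF n] orbit_aut_loop[OF one]] unfolding natural_map_cls by simp
    from Q.homotopic_edges_imp_equal[OF aut[OF n] aut[OF one] this]
    have e: "inv\<^bsub>Gam\<^esub> (K #>\<^bsub>norm_grp G S\<^esub> inv n) = inv\<^bsub>Gam\<^esub> (K #>\<^bsub>norm_grp G S\<^esub> \<one>)"
      unfolding to_quotient_aut[OF n] to_quotient_aut[OF one] by simp
    have c: "K #>\<^bsub>norm_grp G S\<^esub> m \<in> carrier Gam" if "m \<in> N" for m
      using that by (auto simp: FactGroup_def RCOSETS_def)
    have KN: "subgroup K (norm_grp G S)" by (rule normal_imp_subgroup[OF K_normal])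
    have "K #>\<^bsub>norm_grp G S\<^esub> inv n = K #>\<^bsub>norm_grp G S\<^esub> \<one>"
      using arg_cong[OF e, of "m_inv Gam"] unfolding group.inv_inv[OF Gam_group c[OF N_inv[OF n]]] group.inv_inv[OF Gam_group c[OF one]] .
    also have "\<dots> = K" using h.G.coset_mult_one[OF subgroup.subset[OF KN]] by simp
    finally have "inv n \<in> K" using h.G.coset_join1[OF _ _ KN, of "inv n"] N_inv[OF n] by simp
    then have "inv (inv n) \<in> K" using subgroup.m_inv_closed[OF KN, of "inv n"] norm_grp_inv[OF S(2) N_inv[OF n]] by simp
    then show "n \<in> K" using N_carrier[OF n] by simp
  qed
qed

text \<open>The kernel is \<open>K\<close> and the map is onto, so this is the first isomorphism theorem; the only
  point to check is that the isomorphism provided by it has the required value on each coset.\<close>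

lemma natural_map_iso:
  "\<exists>\<phi> \<in> iso (norm_grp G S Mod K) (orbit_pi1 G p S). \<forall>n \<in> N. \<phi> (K #>\<^bsub>norm_grp G S\<^esub> n) = natural_map G p S n"
proof -
  interpret h: group_hom "norm_grp G S" "orbit_pi1 G p S" "natural_map G p S" by (rule natural_map_group_hom)
  let ?\<phi> = "\<lambda>X. the_elem (natural_map G p S ` X)"
  have iso: "?\<phi> \<in> iso (norm_grp G S Mod K) (orbit_pi1 G p S)"
    using h.FactGroup_iso_set natural_map_surj by (simp add: natural_map_kernel)
  have "?\<phi> (K #>\<^bsub>norm_grp G S\<^esub> n) = natural_map G p S n" if n: "n \<in> N" for n
  proof -
    have "natural_map G p S m = natural_map G p S n" if m: "m \<in> K #>\<^bsub>norm_grp G S\<^esub> n" for m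
    proof -
      obtain k where k: "k \<in> K" "m = k \<otimes> n" using m by (auto simp: r_coset_def)
      have "k \<in> kernel (norm_grp G S) (orbit_pi1 G p S) (natural_map G p S)" using k(1) natural_map_kernel by simp
      then have "k \<in> N" "natural_map G p S k = \<one>\<^bsub>orbit_pi1 G p S\<^esub>" by (auto simp: kernel_def)
      then show ?thesis using h.hom_mult[of k n] h.hom_closed[of n] n k(2) by simp
    qed
    moreover have "n \<in> K #>\<^bsub>norm_grp G S\<^esub> n"
      using h.G.rcos_self[OF _ normal_imp_subgroup[OF K_normal]] n by simp
    ultimately have "natural_map G p S ` (K #>\<^bsub>norm_grp G S\<^esub> n) = {natural_map G p S n}" by blast
    then show ?thesis by simp
  qed
  then show ?thesis using iso by (intro bexI[of _ ?\<phi>]) auto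
qed

lemma N_inter_Opn_in_kernel:
  "sub P \<Longrightarrow> N \<inter> Opn P \<subseteq> kernel (norm_grp G S) (orbit_pi1 G p S) (natural_map G p S)"
  unfolding natural_map_kernel using chain_in_K[OF _ chain_single[OF _ subset_refl]] by blast

end

theorem theorem4p10:
  fixes G :: "('a, 'b) monoid_scheme" and p :: nat and S :: "'a set"
  assumes "group G" and "finite (carrier G)"
    and "prime p" and "p dvd order G"
    and "sylow_subgroup G p S"
  shows "group_hom (norm_grp G S) (orbit_pi1 G p S) (natural_map G p S) \<and>
    K_orbit G p S \<lhd> norm_grp G S \<and>
    (\<exists>\<phi> \<in> iso (norm_grp G S Mod K_orbit G p S) (orbit_pi1 G p S).
       \<forall>n \<in> carrier (norm_grp G S).
         \<phi> (K_orbit G p S #>\<^bsub>norm_grp G S\<^esub> n) = natural_map G p S n) \<and>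
    (\<forall>P. nontrivial_subgroup_of G S P \<longrightarrow>
       carrier (norm_grp G S) \<inter> Op' p (norm_grp G P)
         \<subseteq> kernel (norm_grp G S) (orbit_pi1 G p S) (natural_map G p S))"
proof -
  interpret orbit_setting G p S
    using assms by (simp add: orbit_setting_def sylow_system_def sylow_system_axioms_def orbit_setting_axioms_def)
  show ?thesis
    using natural_map_group_hom K_normal natural_map_iso N_inter_Opn_in_kernel by simp
qed

end
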